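(* Let $A$ and $B$ be rings. Suppose $A$ and $B$ are symmetric separably equivalent with context $$\Big({}_AP_B,\ {}_BQ_A,\ \nu: P\otimes_B Q\to A,\ \mu: Q\otimes_A P\to B,\ \sum_i q'_i\otimes_A p'_i,\ \sum_j p_j\otimes_B q_j\Big);$$ that is: ${}_AP_B$ and ${}_BQ_A$ are bimodules, each finitely generated projective as a left module and as a right module; $\nu$ is a split epimorphism of $A$-$A$-bimodules; $\mu$ is a split epimorphism of $B$-$B$-bimodules; and $\sum_i q'_i\otimes_A p'_i\in Q\otimes_A P$ and $\sum_j p_j\otimes_B q_j\in P\otimes_B Q$ are elements such that for all $p\in P$ and $q\in Q$ $$\sum_i \nu(p\otimes q'_i)\,p'_i=p,\qquad \sum_i q'_i\,\nu(p'_i\otimes q)=q,$$ $$\sum_j \mu(q\otimes p_j)\,q_j=q,\qquad \sum_j p_j\,\mu(q_j\otimes p)=p.$$ Then: 1. ${}_AP_B$ is a Frobenius bimodule; 2. $A$ is $P$-separable over $B$; 3. there is a ring isomorphism $\mathrm{End}(P_B)\cong P\otimes_B Q$, where $P\otimes_B Q$ carries the $\mu$-multiplication; 4. the mapping $\lambda: A\to \mathrm{End}(P_B)$, $\lambda(a)(p)=ap$, is an injective ring homomorphism making $\mathrm{End}(P_B)$ a split, separable, Frobenius extension of $A$. Conversely, if ${}_AP_B$ is a bimodule such that $P_B$ is a progenerator, ${}_AP$ is finitely generated projective, and condition 4 holds for $P$, then $A$ and $B$ are symmetric separably equivalent.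
   Context: Rings are associative and unital, and modules are unital. Symmetric separable equivalence: rings $A$ and $B$ are symmetric separably equivalent if there are bimodules ${}_AP_B$, ${}_BQ_A$, each finitely generated projective on both sides, a split epimorphism of $A$-$A$-bimodules $\nu: P\otimes_B Q\to A$ and a split epimorphism of $B$-$B$-bimodules $\mu: Q\otimes_A P\to B$, such that the functors $\mathcal P=P\otimes_B-: B\text{-Mod}\to A\text{-Mod}$ and $\mathcal Q=Q\otimes_A-: A\text{-Mod}\to B\text{-Mod}$ form an adjoint pair $(\mathcal P,\mathcal Q)$ ($\mathcal P$ left adjoint to $\mathcal Q$) with counit $\nu$ (i.e. with counit at ${}_AN$ given by $\nu\otimes \mathrm{id}_N$ under $A\otimes_A N\cong N$), and also an adjoint pair $(\mathcal Q,\mathcal P)$ with counit $\mu$. These two adjunctions correspond to the existence of elements $\sum_i q'_i\otimes p'_i$ and $\sum_j p_j\otimes q_j$ satisfying the displayed identities in the claim. Frobenius bimodule: a bimodule ${}_AW_B$ that is finitely generated projective as a left $A$-module and as a right $B$-module and satisfies $\mathrm{Hom}(W_B,B_B)\cong \mathrm{Hom}({}_AW,{}_AA)$ as $B$-$A$-bimodules. $P$-separable: for a bimodule ${}_AP_B$, $A$ is $P$-separable over $B$ if the evaluation map $P\otimes_B \mathrm{Hom}({}_AP,{}_AA)\to A$ is a split epimorphism of $A$-$A$-bimodules. $\mu$-multiplication on $P\otimes_B Q$: $(p\otimes_B q)(p'\otimes_B q')=p\,\mu(q\otimes_A p')\otimes_B q'$, extended linearly. Extensions: a ring homomorphism $A\to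 E$ is a separable extension if the multiplication map $E\otimes_A E\to E$ is a split epimorphism of $E$-$E$-bimodules; a split extension if there is an $A$-$A$-bimodule homomorphism $E\to A$ sending $1_E$ to $1_A$; a Frobenius extension if $E_A$ is finitely generated projective and ${}_AE_E\cong {}_A\mathrm{Hom}(E_A,A_A)_E$ as $A$-$E$-bimodules. *)

theory Defs
  imports "HOL-Algebra.Module" "HOL-Algebra.QuotRing" "HOL-Algebra.Free_Abelian_Groups"
begin

section \<open>Bimodules over noncommutative rings\<close>

text \<open>
  The library's \<open>module\<close> locale assumes a commutative base ring, so only its record is reused.
  As there, the fields \<open>mult\<close> and \<open>one\<close> inherited from \<open>ring\<close> carry no meaning for a bimodule.
\<close>

record ('a, 'b, 'm) bimodule = "('a, 'm) module" +
  rsmult :: "['m, 'b] \<Rightarrow> 'm" (infixl \<open>\<bullet>\<index>\<close> 70)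

locale bimodule = R?: ring R + S?: ring S + M?: abelian_group M
  for R :: "'a ring" (structure) and S :: "'b ring" (structure)
    and M :: "('a, 'b, 'm) bimodule" (structure) +
  assumes lsmult_closed: "\<lbrakk>a \<in> carrier R; x \<in> carrier M\<rbrakk> \<Longrightarrow> a \<odot>\<^bsub>M\<^esub> x \<in> carrier M"
    and lsmult_l_distr: "\<lbrakk>a \<in> carrier R; a' \<in> carrier R; x \<in> carrier M\<rbrakk> \<Longrightarrow>
          (a \<oplus>\<^bsub>R\<^esub> a') \<odot>\<^bsub>M\<^esub> x = a \<odot>\<^bsub>M\<^esub> x \<oplus>\<^bsub>M\<^esub> a' \<odot>\<^bsub>M\<^esub> x"
    and lsmult_r_distr: "\<lbrakk>a \<in> carrier R; x \<in> carrier M; y \<in> carrier M\<rbrakk> \<Longrightarrow>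
          a \<odot>\<^bsub>M\<^esub> (x \<oplus>\<^bsub>M\<^esub> y) = a \<odot>\<^bsub>M\<^esub> x \<oplus>\<^bsub>M\<^esub> a \<odot>\<^bsub>M\<^esub> y"
    and lsmult_assoc: "\<lbrakk>a \<in> carrier R; a' \<in> carrier R; x \<in> carrier M\<rbrakk> \<Longrightarrow>
          (a \<otimes>\<^bsub>R\<^esub> a') \<odot>\<^bsub>M\<^esub> x = a \<odot>\<^bsub>M\<^esub> (a' \<odot>\<^bsub>M\<^esub> x)"
    and lsmult_one: "x \<in> carrier M \<Longrightarrow> \<one>\<^bsub>R\<^esub> \<odot>\<^bsub>M\<^esub> x = x"
    and rsmult_closed: "\<lbrakk>x \<in> carrier M; b \<in> carrier S\<rbrakk> \<Longrightarrow> x \<bullet>\<^bsub>M\<^esub> b \<in> carrier M"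
    and rsmult_r_distr: "\<lbrakk>x \<in> carrier M; b \<in> carrier S; b' \<in> carrier S\<rbrakk> \<Longrightarrow>
          x \<bullet>\<^bsub>M\<^esub> (b \<oplus>\<^bsub>S\<^esub> b') = x \<bullet>\<^bsub>M\<^esub> b \<oplus>\<^bsub>M\<^esub> x \<bullet>\<^bsub>M\<^esub> b'"
    and rsmult_l_distr: "\<lbrakk>x \<in> carrier M; y \<in> carrier M; b \<in> carrier S\<rbrakk> \<Longrightarrow>
          (x \<oplus>\<^bsub>M\<^esub> y) \<bullet>\<^bsub>M\<^esub> b = x \<bullet>\<^bsub>M\<^esub> b \<oplus>\<^bsub>M\<^esub> y \<bullet>\<^bsub>M\<^esub> b"
    and rsmult_assoc: "\<lbrakk>x \<in> carrier M; b \<in> carrier S; b' \<in> carrier S\<rbrakk> \<Longrightarrow>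
          x \<bullet>\<^bsub>M\<^esub> (b \<otimes>\<^bsub>S\<^esub> b') = (x \<bullet>\<^bsub>M\<^esub> b) \<bullet>\<^bsub>M\<^esub> b'"
    and rsmult_one: "x \<in> carrier M \<Longrightarrow> x \<bullet>\<^bsub>M\<^esub> \<one>\<^bsub>S\<^esub> = x"
    and smult_rsmult: "\<lbrakk>a \<in> carrier R; x \<in> carrier M; b \<in> carrier S\<rbrakk> \<Longrightarrow>
          (a \<odot>\<^bsub>M\<^esub> x) \<bullet>\<^bsub>M\<^esub> b = a \<odot>\<^bsub>M\<^esub> (x \<bullet>\<^bsub>M\<^esub> b)"

text \<open>
  \<open>ring_bimodule E \<phi> \<psi>\<close> is the ring \<open>E\<close> with left scalars acting through \<open>\<phi>\<close> and right scalars
  through \<open>\<psi>\<close>.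
\<close>

definition ring_bimodule :: "'e ring \<Rightarrow> ('r \<Rightarrow> 'e) \<Rightarrow> ('s \<Rightarrow> 'e) \<Rightarrow> ('r, 's, 'e) bimodule" where
  "ring_bimodule E \<phi> \<psi> =
    \<lparr>carrier = carrier E, monoid.mult = monoid.mult E, one = \<one>\<^bsub>E\<^esub>, ring.zero = \<zero>\<^bsub>E\<^esub>, add = add E,
     smult = (\<lambda>r x. \<phi> r \<otimes>\<^bsub>E\<^esub> x), rsmult = (\<lambda>x s. x \<otimes>\<^bsub>E\<^esub> \<psi> s)\<rparr>"

abbreviation regular_bimodule :: "'a ring \<Rightarrow> ('a, 'a, 'a) bimodule" where
  "regular_bimodule R \<equiv> ring_bimodule R (\<lambda>x. x) (\<lambda>x. x)"

definition power_bimodule :: "('a, 'b, 'm) bimodule \<Rightarrow> nat \<Rightarrow> ('a, 'b, nat \<Rightarrow> 'm) bimodule" where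
  "power_bimodule M n =
    \<lparr>carrier = {..<n} \<rightarrow>\<^sub>E carrier M, monoid.mult = undefined, one = undefined,
     ring.zero = (\<lambda>i\<in>{..<n}. \<zero>\<^bsub>M\<^esub>), add = (\<lambda>x y. \<lambda>i\<in>{..<n}. x i \<oplus>\<^bsub>M\<^esub> y i),
     smult = (\<lambda>a x. \<lambda>i\<in>{..<n}. a \<odot>\<^bsub>M\<^esub> x i), rsmult = (\<lambda>x b. \<lambda>i\<in>{..<n}. x i \<bullet>\<^bsub>M\<^esub> b)\<rparr>"


section \<open>Homomorphisms\<close>

definition left_linear ::
  "'a ring \<Rightarrow> ('a, 'b, 'm) bimodule \<Rightarrow> ('a, 'c, 'n) bimodule \<Rightarrow> ('m \<Rightarrow> 'n) set" where
  "left_linear A M N = {f \<in> carrier M \<rightarrow> carrier N.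
     (\<forall>x\<in>carrier M. \<forall>y\<in>carrier M. f (x \<oplus>\<^bsub>M\<^esub> y) = f x \<oplus>\<^bsub>N\<^esub> f y) \<and>
     (\<forall>a\<in>carrier A. \<forall>x\<in>carrier M. f (a \<odot>\<^bsub>M\<^esub> x) = a \<odot>\<^bsub>N\<^esub> f x)}"

definition right_linear ::
  "'b ring \<Rightarrow> ('a, 'b, 'm) bimodule \<Rightarrow> ('c, 'b, 'n) bimodule \<Rightarrow> ('m \<Rightarrow> 'n) set" where
  "right_linear B M N = {f \<in> carrier M \<rightarrow> carrier N.
     (\<forall>x\<in>carrier M. \<forall>y\<in>carrier M. f (x \<oplus>\<^bsub>M\<^esub> y) = f x \<oplus>\<^bsub>N\<^esub> f y) \<and>
     (\<forall>b\<in>carrier B. \<forall>x\<in>carrier M. f (x \<bullet>\<^bsub>M\<^esub> b) = f x \<bullet>\<^bsub>N\<^esub> b)}"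

definition bimodule_hom ::
  "'a ring \<Rightarrow> 'b ring \<Rightarrow> ('a, 'b, 'm) bimodule \<Rightarrow> ('a, 'b, 'n) bimodule \<Rightarrow> ('m \<Rightarrow> 'n) set" where
  "bimodule_hom A B M N = left_linear A M N \<inter> right_linear B M N"

definition bimodule_isomorphic ::
  "'a ring \<Rightarrow> 'b ring \<Rightarrow> ('a, 'b, 'm) bimodule \<Rightarrow> ('a, 'b, 'n) bimodule \<Rightarrow> bool" where
  "bimodule_isomorphic A B M N \<longleftrightarrow>
     (\<exists>f \<in> bimodule_hom A B M N. bij_betw f (carrier M) (carrier N))"

definition bimodule_split_epi ::
  "'a ring \<Rightarrow> 'b ring \<Rightarrow> ('a, 'b, 'm) bimodule \<Rightarrow> ('a, 'b, 'n) bimodule \<Rightarrow> ('m \<Rightarrow> 'n) \<Rightarrow> bool" where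
  "bimodule_split_epi A B M N f \<longleftrightarrow>
     f \<in> bimodule_hom A B M N \<and>
     (\<exists>g \<in> bimodule_hom A B N M. \<forall>y\<in>carrier N. f (g y) = y)"

text \<open>The first argument is, up to isomorphism, a direct summand of the second one.\<close>

definition left_summand ::
  "'a ring \<Rightarrow> ('a, 'b, 'm) bimodule \<Rightarrow> ('a, 'c, 'n) bimodule \<Rightarrow> bool" where
  "left_summand A M N \<longleftrightarrow>
     (\<exists>\<iota> \<in> left_linear A M N. \<exists>\<pi> \<in> left_linear A N M. \<forall>x\<in>carrier M. \<pi> (\<iota> x) = x)"

definition right_summand ::
  "'b ring \<Rightarrow> ('a, 'b, 'm) bimodule \<Rightarrow> ('c, 'b, 'n) bimodule \<Rightarrow> bool" where
  "right_summand B M N \<longleftrightarrow>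
     (\<exists>\<iota> \<in> right_linear B M N. \<exists>\<pi> \<in> right_linear B N M. \<forall>x\<in>carrier M. \<pi> (\<iota> x) = x)"

definition fg_projective_left :: "'a ring \<Rightarrow> ('a, 'b, 'm) bimodule \<Rightarrow> bool" where
  "fg_projective_left A M \<longleftrightarrow> (\<exists>n. left_summand A M (power_bimodule (regular_bimodule A) n))"

definition fg_projective_right :: "'b ring \<Rightarrow> ('a, 'b, 'm) bimodule \<Rightarrow> bool" where
  "fg_projective_right B M \<longleftrightarrow> (\<exists>n. right_summand B M (power_bimodule (regular_bimodule B) n))"

definition generator_right :: "'b ring \<Rightarrow> ('a, 'b, 'm) bimodule \<Rightarrow> bool" where
  "generator_right B M \<longleftrightarrow> (\<exists>n. right_summand B (regular_bimodule B) (power_bimodule M n))"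

definition progenerator_right :: "'b ring \<Rightarrow> ('a, 'b, 'm) bimodule \<Rightarrow> bool" where
  "progenerator_right B M \<longleftrightarrow> fg_projective_right B M \<and> generator_right B M"

text \<open>
  Elements of Hom modules and endomorphism rings are functions on the carrier, made unique by
  extensionality. For \<open>\<^sub>AM\<^sub>B\<close> and \<open>\<^sub>AN\<^sub>C\<close>, the \<open>B\<close>-\<open>C\<close>-bimodule \<open>Hom(\<^sub>AM, \<^sub>AN)\<close> has \<open>(b g c)(x) = g(x b) c\<close>;
  for \<open>\<^sub>CM\<^sub>B\<close> and \<open>\<^sub>AN\<^sub>B\<close>, the \<open>A\<close>-\<open>C\<close>-bimodule \<open>Hom(M\<^sub>B, N\<^sub>B)\<close> has \<open>(a f c)(x) = a f(c x)\<close>.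
\<close>

definition Hom_left ::
  "'a ring \<Rightarrow> ('a, 'b, 'm) bimodule \<Rightarrow> ('a, 'c, 'n) bimodule \<Rightarrow> ('b, 'c, 'm \<Rightarrow> 'n) bimodule" where
  "Hom_left A M N =
    \<lparr>carrier = left_linear A M N \<inter> extensional (carrier M),
     monoid.mult = undefined, one = undefined,
     ring.zero = (\<lambda>x\<in>carrier M. \<zero>\<^bsub>N\<^esub>), add = (\<lambda>f g. \<lambda>x\<in>carrier M. f x \<oplus>\<^bsub>N\<^esub> g x),
     smult = (\<lambda>b g. \<lambda>x\<in>carrier M. g (x \<bullet>\<^bsub>M\<^esub> b)), rsmult = (\<lambda>g c. \<lambda>x\<in>carrier M. g x \<bullet>\<^bsub>N\<^esub> c)\<rparr>"

definition Hom_right ::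
  "'b ring \<Rightarrow> ('c, 'b, 'm) bimodule \<Rightarrow> ('a, 'b, 'n) bimodule \<Rightarrow> ('a, 'c, 'm \<Rightarrow> 'n) bimodule" where
  "Hom_right B M N =
    \<lparr>carrier = right_linear B M N \<inter> extensional (carrier M),
     monoid.mult = undefined, one = undefined,
     ring.zero = (\<lambda>x\<in>carrier M. \<zero>\<^bsub>N\<^esub>), add = (\<lambda>f g. \<lambda>x\<in>carrier M. f x \<oplus>\<^bsub>N\<^esub> g x),
     smult = (\<lambda>a f. \<lambda>x\<in>carrier M. a \<odot>\<^bsub>N\<^esub> f x), rsmult = (\<lambda>f c. \<lambda>x\<in>carrier M. f (c \<odot>\<^bsub>M\<^esub> x))\<rparr>"

definition End_right :: "'b ring \<Rightarrow> ('a, 'b, 'm) bimodule \<Rightarrow> ('m \<Rightarrow> 'm) ring" where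
  "End_right B M =
    \<lparr>carrier = right_linear B M M \<inter> extensional (carrier M),
     monoid.mult = (\<lambda>f g. compose (carrier M) f g), one = (\<lambda>x\<in>carrier M. x),
     ring.zero = (\<lambda>x\<in>carrier M. \<zero>\<^bsub>M\<^esub>), add = (\<lambda>f g. \<lambda>x\<in>carrier M. f x \<oplus>\<^bsub>M\<^esub> g x)\<rparr>"

definition left_mult_map :: "('a, 'b, 'm) bimodule \<Rightarrow> 'a \<Rightarrow> ('m \<Rightarrow> 'm)" where
  "left_mult_map P a = (\<lambda>p\<in>carrier P. a \<odot>\<^bsub>P\<^esub> p)"


section \<open>Tensor products\<close>

text \<open>
  \<open>M \<otimes>\<^sub>B N\<close> is the free abelian group on \<open>M \<times> N\<close> modulo the subgroup generated by the usual
  relations; the elements of a free abelian group are formal \<open>\<int>\<close>-linear combinations.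
\<close>

type_synonym ('m, 'n) tensor = "(('m \<times> 'n) \<Rightarrow>\<^sub>0 int) set"

definition tensor_relations ::
  "'b ring \<Rightarrow> ('a, 'b, 'm) bimodule \<Rightarrow> ('b, 'c, 'n) bimodule \<Rightarrow> (('m \<times> 'n) \<Rightarrow>\<^sub>0 int) set" where
  "tensor_relations B M N =
     {frag_of (x \<oplus>\<^bsub>M\<^esub> x', y) - frag_of (x, y) - frag_of (x', y) | x x' y.
        x \<in> carrier M \<and> x' \<in> carrier M \<and> y \<in> carrier N} \<union>
     {frag_of (x, y \<oplus>\<^bsub>N\<^esub> y') - frag_of (x, y) - frag_of (x, y') | x y y'.
        x \<in> carrier M \<and> y \<in> carrier N \<and> y' \<in> carrier N} \<union>
     {frag_of (x \<bullet>\<^bsub>M\<^esub> b, y) - frag_of (x, b \<odot>\<^bsub>N\<^esub> y) | x b y.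
        x \<in> carrier M \<and> b \<in> carrier B \<and> y \<in> carrier N}"

definition tensor_kernel ::
  "'b ring \<Rightarrow> ('a, 'b, 'm) bimodule \<Rightarrow> ('b, 'c, 'n) bimodule \<Rightarrow> (('m \<times> 'n) \<Rightarrow>\<^sub>0 int) set" where
  "tensor_kernel B M N =
     generate (free_Abelian_group (carrier M \<times> carrier N)) (tensor_relations B M N)"

definition pure_tensor ::
  "'b ring \<Rightarrow> ('a, 'b, 'm) bimodule \<Rightarrow> ('b, 'c, 'n) bimodule \<Rightarrow> 'm \<Rightarrow> 'n \<Rightarrow> ('m, 'n) tensor" where
  "pure_tensor B M N x y =
     tensor_kernel B M N #>\<^bsub>free_Abelian_group (carrier M \<times> carrier N)\<^esub> frag_of (x, y)"

text \<open>
  The additive group of the tensor product, as a record with meaningless \<open>mult\<close> and \<open>one\<close>.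
\<close>

definition tensor_group ::
  "'b ring \<Rightarrow> ('a, 'b, 'm) bimodule \<Rightarrow> ('b, 'c, 'n) bimodule \<Rightarrow> ('m, 'n) tensor ring" where
  "tensor_group B M N =
    (let T = free_Abelian_group (carrier M \<times> carrier N) Mod tensor_kernel B M N in
     \<lparr>carrier = carrier T, monoid.mult = undefined, one = undefined,
      ring.zero = \<one>\<^bsub>T\<^esub>, add = monoid.mult T\<rparr>)"

text \<open>
  \<open>tensor_lift C f\<close> is the additive map into \<open>C\<close> sending \<open>x \<otimes> y\<close> to \<open>f x y\<close>, for a balanced
  biadditive \<open>f\<close>: the value of \<open>\<Sum>\<^sub>i k\<^sub>i (x\<^sub>i, y\<^sub>i)\<close> is \<open>\<Sum>\<^sub>i k\<^sub>i f x\<^sub>i y\<^sub>i\<close>, which is the same for all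
  representatives in a coset.
\<close>

definition tensor_lift :: "('c, 'x) ring_scheme \<Rightarrow> ('m \<Rightarrow> 'n \<Rightarrow> 'c) \<Rightarrow> ('m, 'n) tensor \<Rightarrow> 'c" where
  "tensor_lift C f X =
     the_elem ((\<lambda>c. \<Oplus>\<^bsub>C\<^esub>z\<in>Poly_Mapping.keys c.
                      [Poly_Mapping.lookup c z] \<cdot>\<^bsub>C\<^esub> f (fst z) (snd z)) ` X)"

definition tensor_product ::
  "'b ring \<Rightarrow> ('a, 'b, 'm) bimodule \<Rightarrow> ('b, 'c, 'n) bimodule \<Rightarrow> ('a, 'c, ('m, 'n) tensor) bimodule" where
  "tensor_product B M N =
    (let T = tensor_group B M N in
     \<lparr>carrier = carrier T, monoid.mult = undefined, one = undefined, ring.zero = \<zero>\<^bsub>T\<^esub>, add = add T,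
      smult = (\<lambda>a. tensor_lift T (\<lambda>x y. pure_tensor B M N (a \<odot>\<^bsub>M\<^esub> x) y)),
      rsmult = (\<lambda>X c. tensor_lift T (\<lambda>x y. pure_tensor B M N x (y \<bullet>\<^bsub>N\<^esub> c)) X)\<rparr>)"


section \<open>Symmetric separable equivalence\<close>

text \<open>
  The elements \<open>\<Sum>\<^sub>i q'\<^sub>i \<otimes> p'\<^sub>i\<close> (\<open>i < m\<close>) and \<open>\<Sum>\<^sub>j p\<^sub>j \<otimes> q\<^sub>j\<close> (\<open>j < n\<close>) are given by the families of
  their components. They are the data of the adjunctions \<open>P \<otimes>\<^sub>B -\<close> left adjoint to \<open>Q \<otimes>\<^sub>A -\<close> with
  counit \<open>\<nu>\<close>, and \<open>Q \<otimes>\<^sub>A -\<close> left adjoint to \<open>P \<otimes>\<^sub>B -\<close> with counit \<open>\<mu>\<close>; the four identities are the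
  triangle identities.
\<close>

locale sym_sep_context = P: bimodule A B P + Q: bimodule B A Q
  for A :: "'a ring" and B :: "'b ring"
    and P :: "('a, 'b, 'p) bimodule" and Q :: "('b, 'a, 'q) bimodule" +
  fixes \<nu> :: "('p, 'q) tensor \<Rightarrow> 'a" and \<mu> :: "('q, 'p) tensor \<Rightarrow> 'b"
    and m :: nat and q' :: "nat \<Rightarrow> 'q" and p' :: "nat \<Rightarrow> 'p"
    and n :: nat and pj :: "nat \<Rightarrow> 'p" and qj :: "nat \<Rightarrow> 'q"
  assumes P_fgp: "fg_projective_left A P" "fg_projective_right B P"
    and Q_fgp: "fg_projective_left B Q" "fg_projective_right A Q"
    and nu_split_epi: "bimodule_split_epi A A (tensor_product B P Q) (regular_bimodule A) \<nu>"
    and mu_split_epi: "bimodule_split_epi B B (tensor_product A Q P) (regular_bimodule B) \<mu>"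
    and first_family: "\<And>i. i < m \<Longrightarrow> q' i \<in> carrier Q" "\<And>i. i < m \<Longrightarrow> p' i \<in> carrier P"
    and second_family: "\<And>j. j < n \<Longrightarrow> pj j \<in> carrier P" "\<And>j. j < n \<Longrightarrow> qj j \<in> carrier Q"
    and nu_p: "\<And>p. p \<in> carrier P \<Longrightarrow>
          (\<Oplus>\<^bsub>P\<^esub>i\<in>{..<m}. \<nu> (pure_tensor B P Q p (q' i)) \<odot>\<^bsub>P\<^esub> p' i) = p"
    and nu_q: "\<And>q. q \<in> carrier Q \<Longrightarrow>
          (\<Oplus>\<^bsub>Q\<^esub>i\<in>{..<m}. q' i \<bullet>\<^bsub>Q\<^esub> \<nu> (pure_tensor B P Q (p' i) q)) = q"
    and mu_q: "\<And>q. q \<in> carrier Q \<Longrightarrow>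
          (\<Oplus>\<^bsub>Q\<^esub>j\<in>{..<n}. \<mu> (pure_tensor A Q P q (pj j)) \<odot>\<^bsub>Q\<^esub> qj j) = q"
    and mu_p: "\<And>p. p \<in> carrier P \<Longrightarrow>
          (\<Oplus>\<^bsub>P\<^esub>j\<in>{..<n}. pj j \<bullet>\<^bsub>P\<^esub> \<mu> (pure_tensor A Q P (qj j) p)) = p"

text \<open>
  HOL has no quantification over types inside a formula, so the element types of \<open>P\<close> and \<open>Q\<close> are
  parameters; a context over any particular pair of types makes \<open>A\<close> and \<open>B\<close> equivalent.
\<close>

definition sym_sep_equivalent :: "'p itself \<Rightarrow> 'q itself \<Rightarrow> 'a ring \<Rightarrow> 'b ring \<Rightarrow> bool" where
  "sym_sep_equivalent TP TQ A B \<longleftrightarrow>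
     (\<exists>(P :: ('a, 'b, 'p) bimodule) (Q :: ('b, 'a, 'q) bimodule) \<nu> \<mu> m q' p' n pj qj.
        sym_sep_context A B P Q \<nu> \<mu> m q' p' n pj qj)"

text \<open>
  \<open>P \<otimes>\<^sub>B Q\<close> with the \<open>\<mu>\<close>-multiplication \<open>(p \<otimes> q)(p' \<otimes> q') = p \<mu>(q \<otimes> p') \<otimes> q'\<close>. The record needs a
  unit, which is the argument \<open>e\<close>; in a symmetric separable context it is \<open>\<Sum>\<^sub>j p\<^sub>j \<otimes> q\<^sub>j\<close>.
\<close>

definition mu_ring ::
  "'a ring \<Rightarrow> 'b ring \<Rightarrow> ('a, 'b, 'p) bimodule \<Rightarrow> ('b, 'a, 'q) bimodule \<Rightarrow>
   (('q, 'p) tensor \<Rightarrow> 'b) \<Rightarrow> ('p, 'q) tensor \<Rightarrow> ('p, 'q) tensor ring" where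
  "mu_ring A B P Q \<mu> e =
    (let T = tensor_group B P Q in
     \<lparr>carrier = carrier T,
      monoid.mult = (\<lambda>X Y. tensor_lift T (\<lambda>p q. tensor_lift T (\<lambda>p' q'.
        pure_tensor B P Q (p \<bullet>\<^bsub>P\<^esub> \<mu> (pure_tensor A Q P q p')) q') Y) X),
      one = e, ring.zero = \<zero>\<^bsub>T\<^esub>, add = add T\<rparr>)"


section \<open>Frobenius bimodules and ring extensions\<close>

definition frobenius_bimodule :: "'a ring \<Rightarrow> 'b ring \<Rightarrow> ('a, 'b, 'w) bimodule \<Rightarrow> bool" where
  "frobenius_bimodule A B W \<longleftrightarrow>
     bimodule A B W \<and> fg_projective_left A W \<and> fg_projective_right B W \<and>
     bimodule_isomorphic B A
       (Hom_right B W (regular_bimodule B)) (Hom_left A W (regular_bimodule A))"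

definition P_separable :: "'a ring \<Rightarrow> 'b ring \<Rightarrow> ('a, 'b, 'p) bimodule \<Rightarrow> bool" where
  "P_separable A B P \<longleftrightarrow>
     bimodule_split_epi A A
       (tensor_product B P (Hom_left A P (regular_bimodule A))) (regular_bimodule A)
       (tensor_lift A (\<lambda>p f. f p))"

definition separable_extension :: "'a ring \<Rightarrow> 'e ring \<Rightarrow> ('a \<Rightarrow> 'e) \<Rightarrow> bool" where
  "separable_extension A E \<phi> \<longleftrightarrow>
     ring_hom_ring A E \<phi> \<and>
     bimodule_split_epi E E
       (tensor_product A (ring_bimodule E (\<lambda>x. x) \<phi>) (ring_bimodule E \<phi> (\<lambda>x. x)))
       (regular_bimodule E)
       (tensor_lift E (\<lambda>x y. x \<otimes>\<^bsub>E\<^esub> y))"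

definition split_extension :: "'a ring \<Rightarrow> 'e ring \<Rightarrow> ('a \<Rightarrow> 'e) \<Rightarrow> bool" where
  "split_extension A E \<phi> \<longleftrightarrow>
     ring_hom_ring A E \<phi> \<and>
     (\<exists>f \<in> bimodule_hom A A (ring_bimodule E \<phi> \<phi>) (regular_bimodule A). f \<one>\<^bsub>E\<^esub> = \<one>\<^bsub>A\<^esub>)"

definition frobenius_extension :: "'a ring \<Rightarrow> 'e ring \<Rightarrow> ('a \<Rightarrow> 'e) \<Rightarrow> bool" where
  "frobenius_extension A E \<phi> \<longleftrightarrow>
     ring_hom_ring A E \<phi> \<and>
     fg_projective_right A (ring_bimodule E (\<lambda>x. x) \<phi> :: ('e, 'a, 'e) bimodule) \<and>
     bimodule_isomorphic A E
       (ring_bimodule E \<phi> (\<lambda>x. x))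
       (Hom_right A (ring_bimodule E (\<lambda>x. x) \<phi>) (regular_bimodule A))"

definition endomorphism_extension_condition ::
  "'a ring \<Rightarrow> 'b ring \<Rightarrow> ('a, 'b, 'p) bimodule \<Rightarrow> bool" where
  "endomorphism_extension_condition A B P \<longleftrightarrow>
     ring_hom_ring A (End_right B P) (left_mult_map P) \<and>
     inj_on (left_mult_map P) (carrier A) \<and>
     split_extension A (End_right B P) (left_mult_map P) \<and>
     separable_extension A (End_right B P) (left_mult_map P) \<and>
     frobenius_extension A (End_right B P) (left_mult_map P)"

end

theory Submission
  imports Defs
begin

text \<open>
  Write \<open>E\<close> for \<open>End(P\<^sub>B)\<close> and \<open>[p, q] = p \<mu>(q \<otimes> -) \<in> E\<close>. The elements \<open>p\<^sub>j\<close>, \<open>q\<^sub>j\<close> are dual bases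
  for the pairing \<open>\<mu>\<close>, so \<open>f = \<Sum>\<^sub>j [f p\<^sub>j, q\<^sub>j]\<close> for every \<open>f \<in> E\<close>, and \<open>p \<otimes> q \<mapsto> [p, q]\<close> is an
  isomorphism \<open>P \<otimes>\<^sub>B Q \<cong> E\<close> of \<open>A\<close>-\<open>A\<close>-bimodules under which the \<open>\<mu>\<close>-multiplication becomes
  composition. The locale \<open>dual_pair\<close> develops this for an arbitrary balanced \<open>B\<close>-bilinear pairing
  with dual bases. Both implications take place in it: for the converse, the pairing is the
  evaluation of \<open>Q = Hom(P\<^sub>B, B\<^sub>B)\<close> on \<open>P\<close>, with dual bases because \<open>P\<^sub>B\<close> is finitely generated
  projective.

  Two translations turn the three properties of the extension \<open>A \<rightarrow> E\<close> into statements about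
  elements. A bimodule epimorphism onto a ring splits iff some element of its source is mapped to \<open>1\<close>
  and commutes with all scalars (\<open>split_epi_regular_iff\<close>); such an element is called central over \<open>1\<close>
  below. An extension is Frobenius iff it has a bilinear form \<open>F : E \<rightarrow> A\<close> and finite families \<open>X\<^sub>i\<close>, \<open>Y\<^sub>i\<close> with \<open>\<Sum>\<^sub>i X\<^sub>i F(Y\<^sub>i x) = x = \<Sum>\<^sub>i F(x X\<^sub>i) Y\<^sub>i\<close>
  (\<open>frobenius_system\<close>). Each property of the extension then corresponds to one part of the context.

  \<^item> Split, and a splitting of \<open>\<nu>\<close>. If \<open>\<Sum> u \<otimes> v \<in> P \<otimes>\<^sub>B Q\<close> is central over \<open>1\<close>, then
    \<open>g \<mapsto> \<Sum> \<nu>(g u \<otimes> v)\<close> splits \<open>A \<rightarrow> E\<close>. Conversely, a splitting is \<open>F(d -)\<close> for a unique \<open>d \<in> E\<close>, and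
    \<open>d\<close>, seen in \<open>P \<otimes>\<^sub>B Q\<close>, is central over \<open>1\<close>.
  \<^item> Separable, and a splitting of \<open>\<mu>\<close>. If \<open>\<Sum> y \<otimes> x \<in> Q \<otimes>\<^sub>A P\<close> is central over \<open>1\<close>, then
    \<open>\<Sum>\<^sub>j \<Sum> [p\<^sub>j, y] \<otimes> [x, q\<^sub>j] \<in> E \<otimes>\<^sub>A E\<close> is a separability element. Conversely, if \<open>\<Sum>\<^sub>l v\<^sub>l(u\<^sub>l) = 1\<close>
    expresses that \<open>P\<^sub>B\<close> is a generator and \<open>e\<close> is a separability element, then \<open>\<Sum>\<^sub>l v\<^sub>l e u\<^sub>l\<close> is
    central over \<open>1\<close>.
  \<^item> Frobenius, and \<open>\<nu>\<close> with the elements \<open>q'\<^sub>i\<close>, \<open>p'\<^sub>i\<close>. The form \<open>F\<close> is \<open>\<nu>\<close> transported along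
    \<open>P \<otimes>\<^sub>B Q \<cong> E\<close>; its dual families are \<open>[p\<^sub>j, q'\<^sub>i]\<close> and \<open>[p'\<^sub>i, q\<^sub>j]\<close>. Conversely \<open>v\<^sub>l X\<^sub>i\<close> and
    \<open>Y\<^sub>i u\<^sub>l\<close> serve as \<open>q'\<close> and \<open>p'\<close>.

  Finally, \<open>P\<close> is a Frobenius bimodule and \<open>A\<close> is \<open>P\<close>-separable because \<open>Q\<close> is both duals of \<open>P\<close> at
  once: \<open>\<mu>\<close> identifies it with \<open>Hom(P\<^sub>B, B\<^sub>B)\<close>, and \<open>\<nu>\<close> identifies it with \<open>Hom(\<^sub>AP, \<^sub>AA)\<close> and itself with the evaluation map.
\<close>

section \<open>Additive maps and finite sums\<close>

definition additive_maps :: "('g, 'x) ring_scheme \<Rightarrow> ('h, 'y) ring_scheme \<Rightarrow> ('g \<Rightarrow> 'h) set" where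
  "additive_maps G H = {f \<in> carrier G \<rightarrow> carrier H.
     \<forall>x\<in>carrier G. \<forall>y\<in>carrier G. f (x \<oplus>\<^bsub>G\<^esub> y) = f x \<oplus>\<^bsub>H\<^esub> f y}"

lemma additiveI:
  assumes "\<And>x. x \<in> carrier G \<Longrightarrow> f x \<in> carrier H"
    and "\<And>x y. \<lbrakk>x \<in> carrier G; y \<in> carrier G\<rbrakk> \<Longrightarrow> f (x \<oplus>\<^bsub>G\<^esub> y) = f x \<oplus>\<^bsub>H\<^esub> f y"
  shows "f \<in> additive_maps G H"
  using assms by (auto simp: additive_maps_def)

lemma additive_closed: "\<lbrakk>f \<in> additive_maps G H; x \<in> carrier G\<rbrakk> \<Longrightarrow> f x \<in> carrier H"
  by (auto simp: additive_maps_def)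

lemma additive_add:
  "\<lbrakk>f \<in> additive_maps G H; x \<in> carrier G; y \<in> carrier G\<rbrakk> \<Longrightarrow> f (x \<oplus>\<^bsub>G\<^esub> y) = f x \<oplus>\<^bsub>H\<^esub> f y"
  by (auto simp: additive_maps_def)

lemma additive_hom:
  assumes "abelian_group G" "abelian_group H" "f \<in> additive_maps G H"
  shows "abelian_group_hom G H f"
  using assms
  by (intro abelian_group_homI) (auto simp: additive_maps_def group_hom_def group_hom_axioms_def hom_def
      abelian_group.a_group)

lemma additive_zero:
  assumes "abelian_group G" "abelian_group H" "f \<in> additive_maps G H"
  shows "f \<zero>\<^bsub>G\<^esub> = \<zero>\<^bsub>H\<^esub>"
  using abelian_group_hom.hom_zero[OF additive_hom[OF assms]] .

lemma additive_finsum: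
  assumes G: "abelian_group G" and H: "abelian_group H" and f: "f \<in> additive_maps G H"
    and x: "\<And>i. i \<in> I \<Longrightarrow> x i \<in> carrier G"
  shows "f (\<Oplus>\<^bsub>G\<^esub>i\<in>I. x i) = (\<Oplus>\<^bsub>H\<^esub>i\<in>I. f (x i))"
proof -
  interpret G: abelian_group G by (rule G)
  interpret H: abelian_group H by (rule H)
  show ?thesis using x
  proof (induction I rule: infinite_finite_induct)
    case (insert i I)
    then show ?case
      by (subst G.finsum_insert; (subst H.finsum_insert)?)
        (auto simp: additive_add[OF f] additive_closed[OF f])
  qed (simp_all add: additive_zero[OF G H f])
qed

lemma additive_comp:
  assumes "f \<in> additive_maps G H" "g \<in> additive_maps H K"
  shows "(\<lambda>x. g (f x)) \<in> additive_maps G K"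
  by (rule additiveI) (simp_all add: additive_closed[OF assms(1)] additive_closed[OF assms(2)]
      additive_add[OF assms(1)] additive_add[OF assms(2)])

context abelian_group
begin

lemma finsum_swap:
  assumes "finite I" "finite J" "\<And>i j. \<lbrakk>i \<in> I; j \<in> J\<rbrakk> \<Longrightarrow> f i j \<in> carrier G"
  shows "(\<Oplus>i\<in>I. \<Oplus>j\<in>J. f i j) = (\<Oplus>j\<in>J. \<Oplus>i\<in>I. f i j)"
  using assms(1,3)
proof (induction I)
  case (insert i I)
  have "(\<Oplus>j\<in>J. \<Oplus>k\<in>insert i I. f k j) = (\<Oplus>j\<in>J. f i j \<oplus> (\<Oplus>k\<in>I. f k j))"
    by (rule finsum_cong') (use insert in \<open>auto simp: finsum_insert intro!: finsum_closed\<close>)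
  also have "\<dots> = (\<Oplus>j\<in>J. f i j) \<oplus> (\<Oplus>j\<in>J. \<Oplus>k\<in>I. f k j)"
    by (rule finsum_addf) (use insert in \<open>auto intro!: finsum_closed\<close>)
  also have "(\<Oplus>j\<in>J. \<Oplus>k\<in>I. f k j) = (\<Oplus>k\<in>I. \<Oplus>j\<in>J. f k j)"
    using insert by simp
  finally show ?case
    using insert by (subst finsum_insert) (auto intro!: finsum_closed)
qed (simp add: finsum_zero)

lemma finsum_Times:
  assumes "finite I" "finite J" "\<And>i j. \<lbrakk>i \<in> I; j \<in> J\<rbrakk> \<Longrightarrow> f i j \<in> carrier G"
  shows "(\<Oplus>z\<in>I \<times> J. f (fst z) (snd z)) = (\<Oplus>i\<in>I. \<Oplus>j\<in>J. f i j)"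
  using assms(1,3)
proof (induction I)
  case (insert i I)
  have eq: "insert i I \<times> J = Pair i ` J \<union> I \<times> J" by auto
  have "(\<Oplus>z\<in>insert i I \<times> J. f (fst z) (snd z))
      = (\<Oplus>z\<in>Pair i ` J. f (fst z) (snd z)) \<oplus> (\<Oplus>z\<in>I \<times> J. f (fst z) (snd z))"
    unfolding eq by (rule finsum_Un_disjoint) (use insert assms in auto)
  also have "(\<Oplus>z\<in>Pair i ` J. f (fst z) (snd z)) = (\<Oplus>j\<in>J. f i j)"
    by (subst finsum_reindex) (use insert in \<open>auto simp: inj_on_def\<close>)
  finally show ?case
    using insert by (subst finsum_insert) (auto intro!: finsum_closed)
qed simp

lemma finsum_add:
  "\<lbrakk>\<And>i. i \<in> I \<Longrightarrow> f i \<in> carrier G; \<And>i. i \<in> I \<Longrightarrow> g i \<in> carrier G\<rbrakk> \<Longrightarrow>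
   (\<Oplus>i\<in>I. f i \<oplus> g i) = (\<Oplus>i\<in>I. f i) \<oplus> (\<Oplus>i\<in>I. g i)"
  by (rule finsum_addf) auto

lemma finsum_eq:
  "\<lbrakk>\<And>i. i \<in> I \<Longrightarrow> f i = g i; \<And>i. i \<in> I \<Longrightarrow> g i \<in> carrier G\<rbrakk> \<Longrightarrow> (\<Oplus>i\<in>I. f i) = (\<Oplus>i\<in>I. g i)"
  by (rule finsum_cong') auto

end

text \<open>
  The same additive group occurs in several records, such as a ring and the bimodules it carries, or
  \<open>tensor_group\<close> and \<open>tensor_product\<close>; sums only see the group.
\<close>

lemma finsum_same_group:
  assumes "carrier G = carrier H" "add G = add H" "\<zero>\<^bsub>G\<^esub> = \<zero>\<^bsub>H\<^esub>"
  shows "finsum G = finsum H"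
  using assms by (intro ext) (simp add: finsum_def finprod_def)

section \<open>The universal property of tensor products\<close>

definition balanced_maps ::
  "'b ring \<Rightarrow> ('a, 'b, 'm) bimodule \<Rightarrow> ('b, 'c, 'n) bimodule \<Rightarrow> ('k, 'x) ring_scheme \<Rightarrow>
   ('m \<Rightarrow> 'n \<Rightarrow> 'k) set" where
  "balanced_maps B M N K = {f.
     (\<forall>x\<in>carrier M. \<forall>y\<in>carrier N. f x y \<in> carrier K) \<and>
     (\<forall>x\<in>carrier M. \<forall>x'\<in>carrier M. \<forall>y\<in>carrier N. f (x \<oplus>\<^bsub>M\<^esub> x') y = f x y \<oplus>\<^bsub>K\<^esub> f x' y) \<and>
     (\<forall>x\<in>carrier M. \<forall>y\<in>carrier N. \<forall>y'\<in>carrier N. f x (y \<oplus>\<^bsub>N\<^esub> y') = f x y \<oplus>\<^bsub>K\<^esub> f x y') \<and>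
     (\<forall>x\<in>carrier M. \<forall>b\<in>carrier B. \<forall>y\<in>carrier N. f (x \<bullet>\<^bsub>M\<^esub> b) y = f x (b \<odot>\<^bsub>N\<^esub> y))}"

lemma balancedI:
  assumes "\<And>x y. \<lbrakk>x \<in> carrier M; y \<in> carrier N\<rbrakk> \<Longrightarrow> f x y \<in> carrier K"
    and "\<And>x x' y. \<lbrakk>x \<in> carrier M; x' \<in> carrier M; y \<in> carrier N\<rbrakk> \<Longrightarrow>
           f (x \<oplus>\<^bsub>M\<^esub> x') y = f x y \<oplus>\<^bsub>K\<^esub> f x' y"
    and "\<And>x y y'. \<lbrakk>x \<in> carrier M; y \<in> carrier N; y' \<in> carrier N\<rbrakk> \<Longrightarrow>
           f x (y \<oplus>\<^bsub>N\<^esub> y') = f x y \<oplus>\<^bsub>K\<^esub> f x y'"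
    and "\<And>x b y. \<lbrakk>x \<in> carrier M; b \<in> carrier B; y \<in> carrier N\<rbrakk> \<Longrightarrow>
           f (x \<bullet>\<^bsub>M\<^esub> b) y = f x (b \<odot>\<^bsub>N\<^esub> y)"
  shows "f \<in> balanced_maps B M N K"
  using assms unfolding balanced_maps_def by auto

lemma balancedD:
  assumes "f \<in> balanced_maps B M N K"
  shows "\<lbrakk>x \<in> carrier M; y \<in> carrier N\<rbrakk> \<Longrightarrow> f x y \<in> carrier K"
    and "\<lbrakk>x \<in> carrier M; x' \<in> carrier M; y \<in> carrier N\<rbrakk> \<Longrightarrow>
           f (x \<oplus>\<^bsub>M\<^esub> x') y = f x y \<oplus>\<^bsub>K\<^esub> f x' y"
    and "\<lbrakk>x \<in> carrier M; y \<in> carrier N; y' \<in> carrier N\<rbrakk> \<Longrightarrow>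
           f x (y \<oplus>\<^bsub>N\<^esub> y') = f x y \<oplus>\<^bsub>K\<^esub> f x y'"
    and "\<lbrakk>x \<in> carrier M; b \<in> carrier B; y \<in> carrier N\<rbrakk> \<Longrightarrow>
           f (x \<bullet>\<^bsub>M\<^esub> b) y = f x (b \<odot>\<^bsub>N\<^esub> y)"
  using assms unfolding balanced_maps_def by auto

lemma tensor_product_group_simps:
  "carrier (tensor_group B M N) = carrier (tensor_product B M N)"
  "\<zero>\<^bsub>tensor_group B M N\<^esub> = \<zero>\<^bsub>tensor_product B M N\<^esub>"
  "add (tensor_group B M N) = add (tensor_product B M N)"
  "finsum (tensor_group B M N) = finsum (tensor_product B M N)"
proof -
  show *: "carrier (tensor_group B M N) = carrier (tensor_product B M N)"
    "\<zero>\<^bsub>tensor_group B M N\<^esub> = \<zero>\<^bsub>tensor_product B M N\<^esub>"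
    "add (tensor_group B M N) = add (tensor_product B M N)"
    by (simp_all add: tensor_product_def Let_def)
  show "finsum (tensor_group B M N) = finsum (tensor_product B M N)"
    by (rule finsum_same_group) (rule *)+
qed

lemma tensor_lift_same_group:
  assumes "carrier G = carrier H" "add G = add H" "\<zero>\<^bsub>G\<^esub> = \<zero>\<^bsub>H\<^esub>"
  shows "tensor_lift G f = tensor_lift H f"
proof -
  have "[k] \<cdot>\<^bsub>G\<^esub> x = [k] \<cdot>\<^bsub>H\<^esub> x" for k :: int and x
    using assms by (simp add: add_pow_def int_pow_def nat_pow_def m_inv_def Let_def)
  then show ?thesis
    by (intro ext) (simp add: tensor_lift_def finsum_same_group[OF assms])
qed

lemma tensor_lift_tensor_group:
  "tensor_lift (tensor_group B M N) f = tensor_lift (tensor_product B M N) f"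
  by (rule tensor_lift_same_group) (simp_all add: tensor_product_group_simps)

locale tensor = M: bimodule A B M + N: bimodule B C N
  for A :: "'a ring" and B :: "'b ring" and C :: "'c ring"
    and M :: "('a, 'b, 'm) bimodule" and N :: "('b, 'c, 'n) bimodule"
begin

abbreviation "T \<equiv> tensor_product B M N"
abbreviation "pure \<equiv> pure_tensor B M N"
abbreviation "F \<equiv> free_Abelian_group (carrier M \<times> carrier N)"
abbreviation "K \<equiv> tensor_kernel B M N"

sublocale F: comm_group F
  by (rule abelian_free_Abelian_group)

lemma frag_diff_closed: "\<lbrakk>c \<in> carrier F; d \<in> carrier F\<rbrakk> \<Longrightarrow> c - d \<in> carrier F"
  using keys_diff[of c d] by auto

lemma frag_of_closed: "\<lbrakk>x \<in> carrier M; y \<in> carrier N\<rbrakk> \<Longrightarrow> frag_of (x, y) \<in> carrier F"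
  by simp

lemma relations_subset: "tensor_relations B M N \<subseteq> carrier F"
  unfolding tensor_relations_def
  by (auto intro!: frag_diff_closed frag_of_closed M.rsmult_closed N.lsmult_closed
      simp del: carrier_free_Abelian_group_iff)

lemma kernel_subgroup: "subgroup K F"
  unfolding tensor_kernel_def by (rule F.generate_is_subgroup[OF relations_subset])

lemma kernel_normal: "K \<lhd> F"
  by (rule F.subgroup_imp_normal[OF kernel_subgroup])

lemma carrier_T: "carrier T = carrier (F Mod K)"
  and add_T: "add T = monoid.mult (F Mod K)"
  and zero_T: "\<zero>\<^bsub>T\<^esub> = \<one>\<^bsub>F Mod K\<^esub>"
  by (simp_all add: tensor_product_def tensor_group_def Let_def)

lemma abelian_group_T: "abelian_group T"
proof (rule abelian_groupI)
  interpret Q: comm_group "F Mod K"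
    by (rule F.abelian_FactGroup[OF kernel_subgroup])
  show "X \<oplus>\<^bsub>T\<^esub> Y \<in> carrier T" if "X \<in> carrier T" "Y \<in> carrier T" for X Y
    using that unfolding carrier_T add_T by (rule Q.m_closed)
  show "\<zero>\<^bsub>T\<^esub> \<in> carrier T" unfolding carrier_T zero_T by (rule Q.one_closed)
  show "X \<oplus>\<^bsub>T\<^esub> Y \<oplus>\<^bsub>T\<^esub> Z = X \<oplus>\<^bsub>T\<^esub> (Y \<oplus>\<^bsub>T\<^esub> Z)"
    if "X \<in> carrier T" "Y \<in> carrier T" "Z \<in> carrier T" for X Y Z
    using that unfolding carrier_T add_T by (rule Q.m_assoc)
  show "X \<oplus>\<^bsub>T\<^esub> Y = Y \<oplus>\<^bsub>T\<^esub> X" if "X \<in> carrier T" "Y \<in> carrier T" for X Y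
    using that unfolding carrier_T add_T by (rule Q.m_comm)
  show "\<zero>\<^bsub>T\<^esub> \<oplus>\<^bsub>T\<^esub> X = X" if "X \<in> carrier T" for X
    using that unfolding carrier_T add_T zero_T by (rule Q.l_one)
  show "\<exists>Y\<in>carrier T. Y \<oplus>\<^bsub>T\<^esub> X = \<zero>\<^bsub>T\<^esub>" if "X \<in> carrier T" for X
    using that unfolding add_T zero_T carrier_T by (rule Q.l_inv_ex)
qed

sublocale T: abelian_group T by (rule abelian_group_T)

lemma coset_hom: "(\<lambda>c. K #>\<^bsub>F\<^esub> c) \<in> hom F (F Mod K)"
  by (rule normal.r_coset_hom_Mod[OF kernel_normal])

lemma pure_closed [simp]: "\<lbrakk>x \<in> carrier M; y \<in> carrier N\<rbrakk> \<Longrightarrow> pure x y \<in> carrier T"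
  unfolding pure_tensor_def carrier_T by (rule hom_in_carrier[OF coset_hom]) auto

lemma coset_eq_if_diff_in_kernel:
  assumes "c \<in> carrier F" "d \<in> carrier F" "c - d \<in> K"
  shows "K #>\<^bsub>F\<^esub> c = K #>\<^bsub>F\<^esub> d"
proof -
  have "c \<in> K #>\<^bsub>F\<^esub> d"
    unfolding r_coset_def by (rule UN_I[OF assms(3)]) simp
  then show ?thesis
    using F.repr_independence[OF _ assms(2) kernel_subgroup] by simp
qed

lemma relation_in_kernel: "r \<in> tensor_relations B M N \<Longrightarrow> r \<in> K"
  unfolding tensor_kernel_def by (rule generate.incl)

lemma coset_add:
  assumes "c \<in> carrier F" "d \<in> carrier F"
  shows "(K #>\<^bsub>F\<^esub> c) \<oplus>\<^bsub>T\<^esub> (K #>\<^bsub>F\<^esub> d) = K #>\<^bsub>F\<^esub> (c + d)"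
  using hom_mult[OF coset_hom assms] by (simp add: add_T)

lemma pure_add_left:
  assumes "x \<in> carrier M" "x' \<in> carrier M" "y \<in> carrier N"
  shows "pure (x \<oplus>\<^bsub>M\<^esub> x') y = pure x y \<oplus>\<^bsub>T\<^esub> pure x' y"
proof -
  have "frag_of (x \<oplus>\<^bsub>M\<^esub> x', y) - frag_of (x, y) - frag_of (x', y) \<in> K"
    by (rule relation_in_kernel) (use assms in \<open>auto simp: tensor_relations_def\<close>)
  moreover have "frag_of (x, y) + frag_of (x', y) \<in> carrier F"
    using F.m_closed[of "frag_of (x, y)" "frag_of (x', y)"] assms by simp
  ultimately have "K #>\<^bsub>F\<^esub> frag_of (x \<oplus>\<^bsub>M\<^esub> x', y) = K #>\<^bsub>F\<^esub> (frag_of (x, y) + frag_of (x', y))"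
    using assms by (intro coset_eq_if_diff_in_kernel) (auto simp: diff_diff_eq)
  then show ?thesis
    unfolding pure_tensor_def by (subst coset_add) (use assms in auto)
qed

lemma pure_add_right:
  assumes "x \<in> carrier M" "y \<in> carrier N" "y' \<in> carrier N"
  shows "pure x (y \<oplus>\<^bsub>N\<^esub> y') = pure x y \<oplus>\<^bsub>T\<^esub> pure x y'"
proof -
  have "frag_of (x, y \<oplus>\<^bsub>N\<^esub> y') - frag_of (x, y) - frag_of (x, y') \<in> K"
    by (rule relation_in_kernel) (use assms in \<open>auto simp: tensor_relations_def\<close>)
  moreover have "frag_of (x, y) + frag_of (x, y') \<in> carrier F"
    using F.m_closed[of "frag_of (x, y)" "frag_of (x, y')"] assms by simp
  ultimately have "K #>\<^bsub>F\<^esub> frag_of (x, y \<oplus>\<^bsub>N\<^esub> y') = K #>\<^bsub>F\<^esub> (frag_of (x, y) + frag_of (x, y'))"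
    using assms by (intro coset_eq_if_diff_in_kernel) (auto simp: diff_diff_eq)
  then show ?thesis
    unfolding pure_tensor_def by (subst coset_add) (use assms in auto)
qed

lemma pure_balanced:
  assumes "x \<in> carrier M" "b \<in> carrier B" "y \<in> carrier N"
  shows "pure (x \<bullet>\<^bsub>M\<^esub> b) y = pure x (b \<odot>\<^bsub>N\<^esub> y)"
  unfolding pure_tensor_def
  by (rule coset_eq_if_diff_in_kernel; (rule relation_in_kernel)?)
    (use assms in \<open>auto simp: tensor_relations_def M.rsmult_closed N.lsmult_closed\<close>)

lemma pure_uminus:
  assumes "x \<in> carrier M" "y \<in> carrier N"
  shows "\<ominus>\<^bsub>T\<^esub> pure x y = pure (\<ominus>\<^bsub>M\<^esub> x) y"
proof -
  have "(\<lambda>x. pure x y) \<in> additive_maps M T"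
    by (rule additiveI) (simp_all add: assms pure_add_left)
  from abelian_group_hom.hom_a_inv[OF additive_hom[OF M.M.abelian_group_axioms T.abelian_group_axioms this]]
  show ?thesis using assms by simp
qed

text \<open>
  No case for negatives is needed, since \<open>-(x \<otimes> y) = (-x) \<otimes> y\<close>. This is how identities between
  additive maps on a tensor product are checked below.
\<close>

theorem tensor_induct [consumes 1, case_names pure add]:
  assumes "X \<in> carrier T"
    and pure: "\<And>x y. \<lbrakk>x \<in> carrier M; y \<in> carrier N\<rbrakk> \<Longrightarrow> P (pure x y)"
    and add: "\<And>X Y. \<lbrakk>X \<in> carrier T; Y \<in> carrier T; P X; P Y\<rbrakk> \<Longrightarrow> P (X \<oplus>\<^bsub>T\<^esub> Y)"
  shows "P X"
proof -
  (* The free abelian group is generated under differences, which preserve R but not P alone. *)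
  define R where "R X \<longleftrightarrow> X \<in> carrier T \<and> P X \<and> P (\<ominus>\<^bsub>T\<^esub> X)" for X
  have R_pure: "R (pure x y)" if "x \<in> carrier M" "y \<in> carrier N" for x y
    using that by (simp add: R_def pure pure_uminus)
  have R_add: "R (X \<oplus>\<^bsub>T\<^esub> Y)" if "R X" "R Y" for X Y
    using that by (auto simp: R_def T.minus_add intro: add)
  have R_minus: "R (\<ominus>\<^bsub>T\<^esub> X)" if "R X" for X
    using that by (auto simp: R_def)
  from assms(1) obtain c where c: "c \<in> carrier F" and X: "X = K #>\<^bsub>F\<^esub> c"
    unfolding carrier_T by (auto simp: FactGroup_def RCOSETS_def)
  have "R (K #>\<^bsub>F\<^esub> c)"
    using c[simplified carrier_free_Abelian_group_iff]
  proof (induction c rule: free_Abelian_group_induct[consumes 1, case_names zero diff of])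
    case zero
    have "pure \<zero>\<^bsub>M\<^esub> \<zero>\<^bsub>N\<^esub> \<oplus>\<^bsub>T\<^esub> (\<ominus>\<^bsub>T\<^esub> pure \<zero>\<^bsub>M\<^esub> \<zero>\<^bsub>N\<^esub>) = \<zero>\<^bsub>T\<^esub>"
      by (simp add: T.r_neg)
    moreover have "R (pure \<zero>\<^bsub>M\<^esub> \<zero>\<^bsub>N\<^esub> \<oplus>\<^bsub>T\<^esub> (\<ominus>\<^bsub>T\<^esub> pure \<zero>\<^bsub>M\<^esub> \<zero>\<^bsub>N\<^esub>))"
      by (intro R_add R_minus R_pure) auto
    moreover have "K #>\<^bsub>F\<^esub> 0 = \<zero>\<^bsub>T\<^esub>"
      using hom_one[OF coset_hom] F.is_group
      by (simp add: zero_T group.is_group normal.factorgroup_is_group[OF kernel_normal])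
    ultimately show ?case by simp
  next
    case (diff c d)
    have "K #>\<^bsub>F\<^esub> (c - d) = (K #>\<^bsub>F\<^esub> c) \<oplus>\<^bsub>T\<^esub> (\<ominus>\<^bsub>T\<^esub> (K #>\<^bsub>F\<^esub> d))"
    proof -
      have cd: "c - d \<in> carrier F" by (rule frag_diff_closed) (use diff in auto)
      have "(K #>\<^bsub>F\<^esub> (c - d)) \<oplus>\<^bsub>T\<^esub> (K #>\<^bsub>F\<^esub> d) = K #>\<^bsub>F\<^esub> c"
        by (subst coset_add) (use cd diff in auto)
      moreover have "K #>\<^bsub>F\<^esub> (c - d) \<in> carrier T"
        using hom_in_carrier[OF coset_hom cd] by (simp add: carrier_T)
      moreover have "K #>\<^bsub>F\<^esub> d \<in> carrier T"
        using diff R_def by blast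
      ultimately show ?thesis
        by (metis T.a_assoc T.a_inv_closed T.r_neg T.r_zero)
    qed
    then show ?case using diff by (auto intro!: R_add R_minus)
  next
    case (of a)
    then show ?case using R_pure[of "fst a" "snd a"] by (auto simp: pure_tensor_def)
  qed
  then show ?thesis using X by (simp add: R_def)
qed

text \<open>
  The sum in the definition of \<open>tensor_lift\<close> is the homomorphic extension \<open>h\<close> of \<open>f\<close> to the free
  abelian group. As \<open>f\<close> is balanced, \<open>h\<close> kills the relations, so it is constant on cosets.
\<close>

lemma tensor_lift_coset:
  fixes G :: "('g, 'x) ring_scheme"
  assumes G: "abelian_group G" and f: "f \<in> balanced_maps B M N G"
  obtains h where "h \<in> hom F (add_monoid G)"
    and "\<And>x y. \<lbrakk>x \<in> carrier M; y \<in> carrier N\<rbrakk> \<Longrightarrow> h (frag_of (x, y)) = f x y"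
    and "\<And>c. c \<in> carrier F \<Longrightarrow> tensor_lift G f (K #>\<^bsub>F\<^esub> c) = h c"
proof -
  interpret G: abelian_group G by (rule G)
  have "(\<lambda>z. f (fst z) (snd z)) ` (carrier M \<times> carrier N) \<subseteq> carrier (add_monoid G)"
    using balancedD(1)[OF f] by auto
  then obtain h where h: "h \<in> hom F (add_monoid G)"
    and h_of: "\<And>z. z \<in> carrier M \<times> carrier N \<Longrightarrow> h (frag_of z) = f (fst z) (snd z)"
    by (rule comm_group.free_Abelian_group_universal[OF G.a_comm_group]) blast
  interpret h: group_hom F "add_monoid G" h
    using h by (simp add: group_hom_def group_hom_axioms_def F.is_group G.a_group)
  have diff: "h (c - d) = h c \<ominus>\<^bsub>G\<^esub> h d" if "c \<in> carrier F" "d \<in> carrier F" for c d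
  proof -
    have eq: "c - d = c \<otimes>\<^bsub>F\<^esub> inv\<^bsub>F\<^esub> d" using that by simp
    have "h (c \<otimes>\<^bsub>F\<^esub> inv\<^bsub>F\<^esub> d) = h c \<oplus>\<^bsub>G\<^esub> \<ominus>\<^bsub>G\<^esub> h d"
      using h.hom_mult[of c "inv\<^bsub>F\<^esub> d"] h.hom_inv[of d] that F.inv_closed[of d] by (simp add: a_inv_def)
    then show ?thesis unfolding eq a_minus_def .
  qed
  have explicit: "(\<Oplus>\<^bsub>G\<^esub>z\<in>Poly_Mapping.keys c. [Poly_Mapping.lookup c z] \<cdot>\<^bsub>G\<^esub> f (fst z) (snd z)) = h c"
    if c: "c \<in> carrier F" for c
  proof -
    have h_sum: "h (\<Sum>z\<in>Z. frag_cmul (k z) (frag_of z)) = (\<Oplus>\<^bsub>G\<^esub>z\<in>Z. [k z] \<cdot>\<^bsub>G\<^esub> f (fst z) (snd z))"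
      if "finite Z" "Z \<subseteq> carrier M \<times> carrier N" for Z k
      using that
    proof (induction Z)
      case empty
      then show ?case using h.hom_one by simp
    next
      case (insert z Z)
      then have z: "z \<in> carrier M \<times> carrier N" and Z: "Z \<subseteq> carrier M \<times> carrier N"
        by simp_all
      have cl: "[k z] \<cdot>\<^bsub>G\<^esub> f (fst z) (snd z) \<in> carrier G" if "z \<in> carrier M \<times> carrier N" for z
        using that by (intro G.add.int_pow_closed balancedD(1)[OF f]) auto
      have cmul: "frag_cmul l (frag_of z) \<in> carrier F" if "z \<in> carrier M \<times> carrier N" for l z
        using that order_trans[OF keys_cmul[of l "frag_of z"]] by simp
      have hz: "h (frag_cmul (k z) (frag_of z)) = [k z] \<cdot>\<^bsub>G\<^esub> f (fst z) (snd z)"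
      proof -
        have "frag_cmul (k z) (frag_of z) = frag_of z [^]\<^bsub>F\<^esub> k z"
          by (rule int_pow_free_Abelian_group[symmetric]) (use z in simp)
        then show ?thesis
          using h.hom_int_pow[of "frag_of z" "k z"] z h_of[OF z] by (simp add: add_pow_def)
      qed
      have "h (\<Sum>z\<in>insert z Z. frag_cmul (k z) (frag_of z))
          = h (frag_cmul (k z) (frag_of z) \<otimes>\<^bsub>F\<^esub> (\<Sum>z\<in>Z. frag_cmul (k z) (frag_of z)))"
        using insert.hyps by simp
      also have "\<dots> = h (frag_cmul (k z) (frag_of z)) \<oplus>\<^bsub>G\<^esub> h (\<Sum>z\<in>Z. frag_cmul (k z) (frag_of z))"
        by (subst h.hom_mult) (use cmul z Z in \<open>auto intro!: sum_closed_free_Abelian_group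
              simp del: carrier_free_Abelian_group_iff mult_free_Abelian_group\<close>)
      also have "\<dots> = (\<Oplus>\<^bsub>G\<^esub>z\<in>insert z Z. [k z] \<cdot>\<^bsub>G\<^esub> f (fst z) (snd z))"
        unfolding hz insert.IH[OF Z]
        by (rule G.finsum_insert[symmetric]) (use insert.hyps cl z Z in blast)+
      finally show ?case .
    qed
    have "c = (\<Sum>z\<in>Poly_Mapping.keys c. frag_cmul (Poly_Mapping.lookup c z) (frag_of z))"
      using frag_expansion[of c] by (simp add: frag_extend_def)
    then show ?thesis
      using h_sum[of "Poly_Mapping.keys c" "Poly_Mapping.lookup c"] c by simp
  qed
  have cancel: "a \<oplus>\<^bsub>G\<^esub> (b \<oplus>\<^bsub>G\<^esub> (\<ominus>\<^bsub>G\<^esub> a \<oplus>\<^bsub>G\<^esub> \<ominus>\<^bsub>G\<^esub> b)) = \<zero>\<^bsub>G\<^esub>"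
    if "a \<in> carrier G" "b \<in> carrier G" for a b
    using that by (simp add: G.a_lcomm[of b "\<ominus>\<^bsub>G\<^esub> a"] G.r_neg)
  have rel: "h r = \<zero>\<^bsub>G\<^esub>" if "r \<in> tensor_relations B M N" for r
    using that unfolding tensor_relations_def
    by (auto simp: diff frag_diff_closed frag_of_closed h_of M.rsmult_closed N.lsmult_closed balancedD[OF f]
        a_minus_def G.r_neg G.minus_add G.a_ac simp del: carrier_free_Abelian_group_iff)
      (simp_all add: cancel balancedD[OF f])
  have ker: "h k = \<zero>\<^bsub>G\<^esub>" if "k \<in> K" for k
  proof -
    have "K \<subseteq> kernel F (add_monoid G) h"
      unfolding tensor_kernel_def
      by (rule F.generate_subgroup_incl[OF _ h.subgroup_kernel])
        (use rel relations_subset in \<open>auto simp: kernel_def simp del: carrier_free_Abelian_group_iff\<close>)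
    then show ?thesis using that by (auto simp: kernel_def)
  qed
  have K_sub: "k \<in> carrier F" if "k \<in> K" for k
    using that subgroup.mem_carrier[OF kernel_subgroup] by blast
  show thesis
  proof (rule that[OF h])
    show "h (frag_of (x, y)) = f x y" if "x \<in> carrier M" "y \<in> carrier N" for x y
      using h_of that by simp
    show "tensor_lift G f (K #>\<^bsub>F\<^esub> c) = h c" if c: "c \<in> carrier F" for c
    proof -
      have "(\<lambda>c. \<Oplus>\<^bsub>G\<^esub>z\<in>Poly_Mapping.keys c. [Poly_Mapping.lookup c z] \<cdot>\<^bsub>G\<^esub> f (fst z) (snd z)) ` (K #>\<^bsub>F\<^esub> c)
          = h ` (K #>\<^bsub>F\<^esub> c)"
        by (rule image_cong[OF refl explicit])
          (use F.r_coset_subset_G[OF subgroup.subset[OF kernel_subgroup] c] in blast)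
      also have "h ` (K #>\<^bsub>F\<^esub> c) = {h c}"
      proof -
        have "h d = h c" if "d \<in> K #>\<^bsub>F\<^esub> c" for d
        proof -
          obtain k where k: "k \<in> K" "d = k + c" using \<open>d \<in> K #>\<^bsub>F\<^esub> c\<close> by (auto simp: r_coset_def)
          then have "h d = h k \<oplus>\<^bsub>G\<^esub> h c"
            using h.hom_mult[OF K_sub[OF k(1)] c] by simp
          then show ?thesis using ker[OF k(1)] h.hom_closed[OF c] by simp
        qed
        moreover have "c \<in> K #>\<^bsub>F\<^esub> c" by (rule F.rcos_self[OF c kernel_subgroup])
        ultimately show ?thesis by (intro equalityI subsetI) (blast, metis imageI singletonD)
      qed
      finally show ?thesis unfolding tensor_lift_def by (simp only: the_elem_eq)
    qed
  qed
qed

theorem tensor_lift_additive: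
  assumes G: "abelian_group G" and f: "f \<in> balanced_maps B M N G"
  shows "tensor_lift G f \<in> additive_maps T G"
proof -
  obtain h where h: "h \<in> hom F (add_monoid G)"
    and lift: "\<And>c. c \<in> carrier F \<Longrightarrow> tensor_lift G f (K #>\<^bsub>F\<^esub> c) = h c"
    using tensor_lift_coset[OF G f] by metis
  have rep: "\<exists>c. c \<in> carrier F \<and> X = K #>\<^bsub>F\<^esub> c" if "X \<in> carrier T" for X
    using that unfolding carrier_T by (auto simp: FactGroup_def RCOSETS_def simp del: carrier_free_Abelian_group_iff)
  show ?thesis
  proof (rule additiveI)
    fix X assume "X \<in> carrier T"
    then obtain c where "c \<in> carrier F" "X = K #>\<^bsub>F\<^esub> c" using rep by metis
    then show "tensor_lift G f X \<in> carrier G"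
      using lift[of c] hom_in_carrier[OF h, of c] by simp
  next
    fix X Y assume "X \<in> carrier T" "Y \<in> carrier T"
    then obtain c d where cd: "c \<in> carrier F" "X = K #>\<^bsub>F\<^esub> c" "d \<in> carrier F" "Y = K #>\<^bsub>F\<^esub> d"
      using rep by metis
    have "c + d \<in> carrier F" using F.m_closed[OF cd(1,3)] by simp
    then show "tensor_lift G f (X \<oplus>\<^bsub>T\<^esub> Y) = tensor_lift G f X \<oplus>\<^bsub>G\<^esub> tensor_lift G f Y"
      using cd coset_add[OF cd(1,3)] lift hom_mult[OF h cd(1,3)] by simp
  qed
qed

theorem tensor_lift_pure:
  assumes G: "abelian_group G" and f: "f \<in> balanced_maps B M N G"
    and x: "x \<in> carrier M" and y: "y \<in> carrier N"
  shows "tensor_lift G f (pure x y) = f x y"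
proof -
  have "frag_of (x, y) \<in> carrier F" using x y by simp
  then show ?thesis
    using tensor_lift_coset[OF G f] x y unfolding pure_tensor_def by metis
qed

lemma lsmult_balanced:
  assumes "a \<in> carrier A"
  shows "(\<lambda>x y. pure (a \<odot>\<^bsub>M\<^esub> x) y) \<in> balanced_maps B M N T"
  by (rule balancedI) (simp_all add: assms M.lsmult_closed M.lsmult_r_distr pure_add_left
      pure_add_right M.smult_rsmult pure_balanced[symmetric])

lemma rsmult_balanced:
  assumes "c \<in> carrier C"
  shows "(\<lambda>x y. pure x (y \<bullet>\<^bsub>N\<^esub> c)) \<in> balanced_maps B M N T"
  by (rule balancedI) (simp_all add: assms N.rsmult_closed N.rsmult_l_distr pure_add_left
      pure_add_right N.smult_rsmult pure_balanced)

lemma lsmult_T: "a \<odot>\<^bsub>T\<^esub> X = tensor_lift T (\<lambda>x y. pure (a \<odot>\<^bsub>M\<^esub> x) y) X"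
  and rsmult_T: "X \<bullet>\<^bsub>T\<^esub> c = tensor_lift T (\<lambda>x y. pure x (y \<bullet>\<^bsub>N\<^esub> c)) X"
  unfolding tensor_lift_tensor_group[symmetric]
  by (simp_all add: tensor_product_def Let_def)

lemma lsmult_additive: "a \<in> carrier A \<Longrightarrow> (\<lambda>X. a \<odot>\<^bsub>T\<^esub> X) \<in> additive_maps T T"
  unfolding lsmult_T using tensor_lift_additive[OF T.abelian_group_axioms lsmult_balanced] by simp

lemma rsmult_additive: "c \<in> carrier C \<Longrightarrow> (\<lambda>X. X \<bullet>\<^bsub>T\<^esub> c) \<in> additive_maps T T"
  unfolding rsmult_T using tensor_lift_additive[OF T.abelian_group_axioms rsmult_balanced] by simp

lemma lsmult_pure [simp]:
  "\<lbrakk>a \<in> carrier A; x \<in> carrier M; y \<in> carrier N\<rbrakk> \<Longrightarrow> a \<odot>\<^bsub>T\<^esub> pure x y = pure (a \<odot>\<^bsub>M\<^esub> x) y"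
  unfolding lsmult_T by (rule tensor_lift_pure[OF T.abelian_group_axioms lsmult_balanced])

lemma rsmult_pure [simp]:
  "\<lbrakk>c \<in> carrier C; x \<in> carrier M; y \<in> carrier N\<rbrakk> \<Longrightarrow> pure x y \<bullet>\<^bsub>T\<^esub> c = pure x (y \<bullet>\<^bsub>N\<^esub> c)"
  unfolding rsmult_T by (rule tensor_lift_pure[OF T.abelian_group_axioms rsmult_balanced])

lemmas action_simps [simp] = additive_closed[OF lsmult_additive] additive_add[OF lsmult_additive]
  additive_closed[OF rsmult_additive] additive_add[OF rsmult_additive]

theorem bimodule_T: "bimodule A C T"
proof -
  note [simp] = M.lsmult_closed N.rsmult_closed
  show ?thesis
  proof (intro bimodule.intro bimodule_axioms.intro)
    show "ring A" "ring C" "abelian_group T"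
      by (rule M.R.ring_axioms N.S.ring_axioms T.abelian_group_axioms)+
  next
    fix a a' X assume a: "a \<in> carrier A" "a' \<in> carrier A" and X: "X \<in> carrier T"
    show "(a \<oplus>\<^bsub>A\<^esub> a') \<odot>\<^bsub>T\<^esub> X = a \<odot>\<^bsub>T\<^esub> X \<oplus>\<^bsub>T\<^esub> a' \<odot>\<^bsub>T\<^esub> X"
      using X by (induction X rule: tensor_induct)
        (simp_all add: a M.lsmult_l_distr pure_add_left T.a_ac)
    show "(a \<otimes>\<^bsub>A\<^esub> a') \<odot>\<^bsub>T\<^esub> X = a \<odot>\<^bsub>T\<^esub> (a' \<odot>\<^bsub>T\<^esub> X)"
      using X by (induction X rule: tensor_induct) (simp_all add: a M.lsmult_assoc)
  next
    fix X c c' assume X: "X \<in> carrier T" and c: "c \<in> carrier C" "c' \<in> carrier C"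
    show "X \<bullet>\<^bsub>T\<^esub> (c \<oplus>\<^bsub>C\<^esub> c') = X \<bullet>\<^bsub>T\<^esub> c \<oplus>\<^bsub>T\<^esub> X \<bullet>\<^bsub>T\<^esub> c'"
      using X by (induction X rule: tensor_induct)
        (simp_all add: c N.rsmult_r_distr pure_add_right T.a_ac)
    show "X \<bullet>\<^bsub>T\<^esub> (c \<otimes>\<^bsub>C\<^esub> c') = (X \<bullet>\<^bsub>T\<^esub> c) \<bullet>\<^bsub>T\<^esub> c'"
      using X by (induction X rule: tensor_induct) (simp_all add: c N.rsmult_assoc)
  next
    fix X assume X: "X \<in> carrier T"
    show "\<one>\<^bsub>A\<^esub> \<odot>\<^bsub>T\<^esub> X = X"
      using X by (induction X rule: tensor_induct) (simp_all add: M.lsmult_one)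
    show "X \<bullet>\<^bsub>T\<^esub> \<one>\<^bsub>C\<^esub> = X"
      using X by (induction X rule: tensor_induct) (simp_all add: N.rsmult_one)
  next
    fix a X c assume a: "a \<in> carrier A" and X: "X \<in> carrier T" and c: "c \<in> carrier C"
    show "(a \<odot>\<^bsub>T\<^esub> X) \<bullet>\<^bsub>T\<^esub> c = a \<odot>\<^bsub>T\<^esub> (X \<bullet>\<^bsub>T\<^esub> c)"
      using X by (induction X rule: tensor_induct) (simp_all add: a c)
  qed simp_all
qed

end

section \<open>Bimodules and linear maps\<close>

context bimodule
begin

lemma lsmult_additive: "a \<in> carrier R \<Longrightarrow> (\<lambda>x. a \<odot>\<^bsub>M\<^esub> x) \<in> additive_maps M M"
  by (rule additiveI) (simp_all add: lsmult_closed lsmult_r_distr)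

lemma rsmult_additive: "b \<in> carrier S \<Longrightarrow> (\<lambda>x. x \<bullet>\<^bsub>M\<^esub> b) \<in> additive_maps M M"
  by (rule additiveI) (simp_all add: rsmult_closed rsmult_l_distr)

lemma lscalar_additive: "x \<in> carrier M \<Longrightarrow> (\<lambda>a. a \<odot>\<^bsub>M\<^esub> x) \<in> additive_maps R M"
  by (rule additiveI) (simp_all add: lsmult_closed lsmult_l_distr)

lemma rscalar_additive: "x \<in> carrier M \<Longrightarrow> (\<lambda>b. x \<bullet>\<^bsub>M\<^esub> b) \<in> additive_maps S M"
  by (rule additiveI) (simp_all add: rsmult_closed rsmult_r_distr)

lemmas lsmult_finsum = additive_finsum[OF M.abelian_group_axioms M.abelian_group_axioms lsmult_additive]
lemmas rsmult_finsum = additive_finsum[OF M.abelian_group_axioms M.abelian_group_axioms rsmult_additive]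
lemmas finsum_lsmult = additive_finsum[OF R.abelian_group_axioms M.abelian_group_axioms lscalar_additive]
lemmas finsum_rsmult = additive_finsum[OF S.abelian_group_axioms M.abelian_group_axioms rscalar_additive]

lemma lsmult_zero: "a \<in> carrier R \<Longrightarrow> a \<odot>\<^bsub>M\<^esub> \<zero>\<^bsub>M\<^esub> = \<zero>\<^bsub>M\<^esub>"
  by (rule additive_zero[OF M.abelian_group_axioms M.abelian_group_axioms lsmult_additive])

lemma rsmult_zero: "b \<in> carrier S \<Longrightarrow> \<zero>\<^bsub>M\<^esub> \<bullet>\<^bsub>M\<^esub> b = \<zero>\<^bsub>M\<^esub>"
  by (rule additive_zero[OF M.abelian_group_axioms M.abelian_group_axioms rsmult_additive])

lemma lsmult_minus: "\<lbrakk>a \<in> carrier R; x \<in> carrier M\<rbrakk> \<Longrightarrow> a \<odot>\<^bsub>M\<^esub> (\<ominus>\<^bsub>M\<^esub> x) = \<ominus>\<^bsub>M\<^esub> (a \<odot>\<^bsub>M\<^esub> x)"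
  using abelian_group_hom.hom_a_inv[OF additive_hom[OF M.abelian_group_axioms M.abelian_group_axioms lsmult_additive]] .

lemma rsmult_minus: "\<lbrakk>b \<in> carrier S; x \<in> carrier M\<rbrakk> \<Longrightarrow> (\<ominus>\<^bsub>M\<^esub> x) \<bullet>\<^bsub>M\<^esub> b = \<ominus>\<^bsub>M\<^esub> (x \<bullet>\<^bsub>M\<^esub> b)"
  using abelian_group_hom.hom_a_inv[OF additive_hom[OF M.abelian_group_axioms M.abelian_group_axioms rsmult_additive]] .

end

lemma left_linear_iff: "f \<in> left_linear A M N \<longleftrightarrow> f \<in> additive_maps M N \<and>
    (\<forall>a\<in>carrier A. \<forall>x\<in>carrier M. f (a \<odot>\<^bsub>M\<^esub> x) = a \<odot>\<^bsub>N\<^esub> f x)"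
  by (auto simp: left_linear_def additive_maps_def)

lemma right_linear_iff: "f \<in> right_linear B M N \<longleftrightarrow> f \<in> additive_maps M N \<and>
    (\<forall>b\<in>carrier B. \<forall>x\<in>carrier M. f (x \<bullet>\<^bsub>M\<^esub> b) = f x \<bullet>\<^bsub>N\<^esub> b)"
  by (auto simp: right_linear_def additive_maps_def)

lemma left_linearI:
  assumes "f \<in> additive_maps M N"
    and "\<And>a x. \<lbrakk>a \<in> carrier A; x \<in> carrier M\<rbrakk> \<Longrightarrow> f (a \<odot>\<^bsub>M\<^esub> x) = a \<odot>\<^bsub>N\<^esub> f x"
  shows "f \<in> left_linear A M N"
  using assms by (simp add: left_linear_iff)

lemma right_linearI:
  assumes "f \<in> additive_maps M N"
    and "\<And>b x. \<lbrakk>b \<in> carrier B; x \<in> carrier M\<rbrakk> \<Longrightarrow> f (x \<bullet>\<^bsub>M\<^esub> b) = f x \<bullet>\<^bsub>N\<^esub> b"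
  shows "f \<in> right_linear B M N"
  using assms by (simp add: right_linear_iff)

lemma left_linearD:
  assumes "f \<in> left_linear A M N"
  shows "f \<in> additive_maps M N"
    and "\<lbrakk>a \<in> carrier A; x \<in> carrier M\<rbrakk> \<Longrightarrow> f (a \<odot>\<^bsub>M\<^esub> x) = a \<odot>\<^bsub>N\<^esub> f x"
    and "x \<in> carrier M \<Longrightarrow> f x \<in> carrier N"
    and "\<lbrakk>x \<in> carrier M; y \<in> carrier M\<rbrakk> \<Longrightarrow> f (x \<oplus>\<^bsub>M\<^esub> y) = f x \<oplus>\<^bsub>N\<^esub> f y"
  using assms by (auto simp: left_linear_def additive_maps_def)

lemma right_linearD:
  assumes "f \<in> right_linear B M N"
  shows "f \<in> additive_maps M N"
    and "\<lbrakk>b \<in> carrier B; x \<in> carrier M\<rbrakk> \<Longrightarrow> f (x \<bullet>\<^bsub>M\<^esub> b) = f x \<bullet>\<^bsub>N\<^esub> b"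
    and "x \<in> carrier M \<Longrightarrow> f x \<in> carrier N"
    and "\<lbrakk>x \<in> carrier M; y \<in> carrier M\<rbrakk> \<Longrightarrow> f (x \<oplus>\<^bsub>M\<^esub> y) = f x \<oplus>\<^bsub>N\<^esub> f y"
  using assms by (auto simp: right_linear_def additive_maps_def)

lemma bimodule_homI:
  assumes "f \<in> additive_maps M N"
    and "\<And>a x. \<lbrakk>a \<in> carrier A; x \<in> carrier M\<rbrakk> \<Longrightarrow> f (a \<odot>\<^bsub>M\<^esub> x) = a \<odot>\<^bsub>N\<^esub> f x"
    and "\<And>b x. \<lbrakk>b \<in> carrier B; x \<in> carrier M\<rbrakk> \<Longrightarrow> f (x \<bullet>\<^bsub>M\<^esub> b) = f x \<bullet>\<^bsub>N\<^esub> b"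
  shows "f \<in> bimodule_hom A B M N"
  using assms by (simp add: bimodule_hom_def left_linear_iff right_linear_iff)

lemma bimodule_homD:
  assumes "f \<in> bimodule_hom A B M N"
  shows "f \<in> additive_maps M N"
    and "\<lbrakk>a \<in> carrier A; x \<in> carrier M\<rbrakk> \<Longrightarrow> f (a \<odot>\<^bsub>M\<^esub> x) = a \<odot>\<^bsub>N\<^esub> f x"
    and "\<lbrakk>b \<in> carrier B; x \<in> carrier M\<rbrakk> \<Longrightarrow> f (x \<bullet>\<^bsub>M\<^esub> b) = f x \<bullet>\<^bsub>N\<^esub> b"
    and "x \<in> carrier M \<Longrightarrow> f x \<in> carrier N"
    and "\<lbrakk>x \<in> carrier M; y \<in> carrier M\<rbrakk> \<Longrightarrow> f (x \<oplus>\<^bsub>M\<^esub> y) = f x \<oplus>\<^bsub>N\<^esub> f y"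
  using assms by (auto simp: bimodule_hom_def left_linear_iff right_linear_iff
      intro: additive_closed additive_add)

lemma ring_bimodule_simps [simp]:
  "carrier (ring_bimodule E \<phi> \<psi>) = carrier E"
  "add (ring_bimodule E \<phi> \<psi>) = add E"
  "\<zero>\<^bsub>ring_bimodule E \<phi> \<psi>\<^esub> = \<zero>\<^bsub>E\<^esub>"
  "r \<odot>\<^bsub>ring_bimodule E \<phi> \<psi>\<^esub> x = \<phi> r \<otimes>\<^bsub>E\<^esub> x"
  "x \<bullet>\<^bsub>ring_bimodule E \<phi> \<psi>\<^esub> s = x \<otimes>\<^bsub>E\<^esub> \<psi> s"
  by (simp_all add: ring_bimodule_def)

lemma ring_bimodule_finsum [simp]: "finsum (ring_bimodule E \<phi> \<psi>) = finsum E"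
  by (rule finsum_same_group) simp_all

lemma ring_bimodule_additive_maps [simp]:
  "additive_maps (ring_bimodule E \<phi> \<psi>) H = additive_maps E H"
  "additive_maps H (ring_bimodule E \<phi> \<psi>) = additive_maps H E"
  by (simp_all add: additive_maps_def)

lemma ring_bimodule_bimodule:
  assumes "ring E" "ring R" "ring S" and \<phi>: "\<phi> \<in> ring_hom R E" and \<psi>: "\<psi> \<in> ring_hom S E"
  shows "bimodule R S (ring_bimodule E \<phi> \<psi>)"
proof -
  interpret E: ring E by (rule assms(1))
  interpret R: ring R by (rule assms(2))
  interpret S: ring S by (rule assms(3))
  note [simp] = ring_hom_closed[OF \<phi>] ring_hom_closed[OF \<psi>] ring_hom_add[OF \<phi>] ring_hom_add[OF \<psi>]
    ring_hom_mult[OF \<phi>] ring_hom_mult[OF \<psi>] ring_hom_one[OF \<phi>] ring_hom_one[OF \<psi>]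
  have "abelian_group (ring_bimodule E \<phi> \<psi>)"
    by (rule abelian_groupI) (simp_all add: E.a_ac E.add.l_inv_ex)
  then show ?thesis
    by (intro bimodule.intro bimodule_axioms.intro assms)
      (simp_all add: E.l_distr E.r_distr E.m_assoc)
qed

lemma regular_bimodule_bimodule: "ring R \<Longrightarrow> bimodule R R (regular_bimodule R)"
  by (rule ring_bimodule_bimodule) (auto simp: ring_hom_def)

text \<open>
  Powers, Hom modules and endomorphism rings consist of functions under pointwise addition; this lemma
  provides the group structure of all of them.
\<close>

lemma pointwise_abelian_group:
  fixes G :: "('i \<Rightarrow> 'n, 'x) ring_scheme" and N :: "('n, 'y) ring_scheme"
  assumes "abelian_group N"
    and sub: "carrier G \<subseteq> D \<rightarrow>\<^sub>E carrier N"
    and add: "\<And>f g. f \<oplus>\<^bsub>G\<^esub> g = (\<lambda>x\<in>D. f x \<oplus>\<^bsub>N\<^esub> g x)"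
    and zero: "\<zero>\<^bsub>G\<^esub> = (\<lambda>x\<in>D. \<zero>\<^bsub>N\<^esub>)"
    and add_closed: "\<And>f g. \<lbrakk>f \<in> carrier G; g \<in> carrier G\<rbrakk> \<Longrightarrow> (\<lambda>x\<in>D. f x \<oplus>\<^bsub>N\<^esub> g x) \<in> carrier G"
    and zero_closed: "(\<lambda>x\<in>D. \<zero>\<^bsub>N\<^esub>) \<in> carrier G"
    and neg_closed: "\<And>f. f \<in> carrier G \<Longrightarrow> (\<lambda>x\<in>D. \<ominus>\<^bsub>N\<^esub> f x) \<in> carrier G"
  shows "abelian_group G"
proof -
  interpret N: abelian_group N by (rule assms(1))
  have mem: "f x \<in> carrier N" if "f \<in> carrier G" "x \<in> D" for f x using sub that by auto
  have out: "f x = undefined" if "f \<in> carrier G" "x \<notin> D" for f x using sub that by (auto simp: PiE_def extensional_def)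
  show ?thesis
  proof (rule abelian_groupI)
    show "\<zero>\<^bsub>G\<^esub> \<oplus>\<^bsub>G\<^esub> f = f" if "f \<in> carrier G" for f
      by (rule ext) (auto simp: add zero mem out that)
    show "\<exists>g\<in>carrier G. g \<oplus>\<^bsub>G\<^esub> f = \<zero>\<^bsub>G\<^esub>" if "f \<in> carrier G" for f
      by (rule bexI[OF _ neg_closed[OF that]]) (auto simp: add zero mem that N.l_neg)
  qed (auto simp: add zero add_closed zero_closed mem N.a_ac)
qed

lemma pointwise_eval_additive:
  assumes "carrier G \<subseteq> D \<rightarrow>\<^sub>E carrier N" "\<And>f g. f \<oplus>\<^bsub>G\<^esub> g = (\<lambda>x\<in>D. f x \<oplus>\<^bsub>N\<^esub> g x)" "x \<in> D"
  shows "(\<lambda>f. f x) \<in> additive_maps G N"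
  by (rule additiveI) (use assms in auto)

lemma power_bimodule_simps [simp]:
  "carrier (power_bimodule M n) = {..<n} \<rightarrow>\<^sub>E carrier M"
  "x \<oplus>\<^bsub>power_bimodule M n\<^esub> y = (\<lambda>i\<in>{..<n}. x i \<oplus>\<^bsub>M\<^esub> y i)"
  "\<zero>\<^bsub>power_bimodule M n\<^esub> = (\<lambda>i\<in>{..<n}. \<zero>\<^bsub>M\<^esub>)"
  "a \<odot>\<^bsub>power_bimodule M n\<^esub> x = (\<lambda>i\<in>{..<n}. a \<odot>\<^bsub>M\<^esub> x i)"
  "x \<bullet>\<^bsub>power_bimodule M n\<^esub> b = (\<lambda>i\<in>{..<n}. x i \<bullet>\<^bsub>M\<^esub> b)"
  by (simp_all add: power_bimodule_def)

lemma power_abelian_group: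
  assumes "abelian_group M"
  shows "abelian_group (power_bimodule M n)"
proof -
  interpret M: abelian_group M by (rule assms)
  show ?thesis
    by (rule pointwise_abelian_group[where D = "{..<n}", OF assms]) auto
qed

lemma power_eval_additive: "i < n \<Longrightarrow> (\<lambda>x. x i) \<in> additive_maps (power_bimodule M n) M"
  by (rule pointwise_eval_additive[where D = "{..<n}"]) auto

definition coordinate_vector :: "('a, 'b, 'm) bimodule \<Rightarrow> nat \<Rightarrow> nat \<Rightarrow> 'm \<Rightarrow> (nat \<Rightarrow> 'm)" where
  "coordinate_vector M n i u = (\<lambda>j\<in>{..<n}. if i = j then u else \<zero>\<^bsub>M\<^esub>)"

lemma coordinate_vector_closed:
  assumes "abelian_group M" "u \<in> carrier M"
  shows "coordinate_vector M n i u \<in> carrier (power_bimodule M n)"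
proof -
  interpret M: abelian_group M by (rule assms(1))
  show ?thesis using assms(2) by (auto simp: coordinate_vector_def)
qed

lemma coordinate_vector_additive:
  assumes "abelian_group M"
  shows "coordinate_vector M n i \<in> additive_maps M (power_bimodule M n)"
proof -
  interpret M: abelian_group M by (rule assms)
  show ?thesis
    by (rule additiveI[OF coordinate_vector_closed[OF assms]]) (auto simp: coordinate_vector_def)
qed

lemma power_expansion:
  assumes M: "abelian_group M" and x: "x \<in> carrier (power_bimodule M n)"
  shows "(\<Oplus>\<^bsub>power_bimodule M n\<^esub>i\<in>{..<n}. coordinate_vector M n i (x i)) = x" (is "?s = x")
proof -
  interpret M: abelian_group M by (rule M)
  interpret Mn: abelian_group "power_bimodule M n" by (rule power_abelian_group[OF M])
  have xc: "x i \<in> carrier M" if "i < n" for i using x that by auto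
  have s: "?s \<in> carrier (power_bimodule M n)"
    by (rule Mn.finsum_closed) (use xc coordinate_vector_closed[OF M] in auto)
  have "?s j = x j" for j
  proof (cases "j < n")
    case True
    have "?s j = (\<Oplus>\<^bsub>M\<^esub>i\<in>{..<n}. coordinate_vector M n i (x i) j)"
      by (rule additive_finsum[OF Mn.abelian_group_axioms M power_eval_additive[OF True]])
        (use xc coordinate_vector_closed[OF M] in auto)
    also have "\<dots> = (\<Oplus>\<^bsub>M\<^esub>i\<in>{..<n}. if j = i then x i else \<zero>\<^bsub>M\<^esub>)"
      by (rule M.finsum_eq) (use True xc in \<open>auto simp: coordinate_vector_def\<close>)
    also have "\<dots> = x j"
      by (rule M.finsum_singleton) (use True xc in auto)
    finally show ?thesis .
  next
    case False
    then show ?thesis using s x by (auto simp: PiE_def extensional_def)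
  qed
  then show ?thesis by (rule ext)
qed

section \<open>Finitely generated projective modules and generators\<close>

text \<open>
  If \<open>M\<close> is a retract of \<open>B\<^sup>n\<close>, the images of the unit vectors under the retraction and the coordinates
  of the section form a dual basis.
\<close>

lemma fg_projective_right_dual_basis:
  fixes M :: "('a, 'b, 'm) bimodule"
  assumes M: "bimodule A B M" and fgp: "fg_projective_right B M"
  obtains n :: nat and x f where "\<And>i. i < n \<Longrightarrow> x i \<in> carrier M"
    and "\<And>i. i < n \<Longrightarrow> f i \<in> right_linear B M (regular_bimodule B)"
    and "\<And>y. y \<in> carrier M \<Longrightarrow> (\<Oplus>\<^bsub>M\<^esub>i\<in>{..<n}. x i \<bullet>\<^bsub>M\<^esub> f i y) = y"
proof -
  interpret M: bimodule A B M by (rule M)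
  let ?B = "regular_bimodule B"
  interpret RB: bimodule B B ?B by (rule regular_bimodule_bimodule[OF M.S.ring_axioms])
  from fgp obtain n \<iota> \<pi> where \<iota>: "\<iota> \<in> right_linear B M (power_bimodule ?B n)"
    and \<pi>: "\<pi> \<in> right_linear B (power_bimodule ?B n) M" and id: "\<And>x. x \<in> carrier M \<Longrightarrow> \<pi> (\<iota> x) = x"
    unfolding fg_projective_right_def right_summand_def by blast
  interpret Bn: abelian_group "power_bimodule ?B n"
    by (rule power_abelian_group[OF RB.M.abelian_group_axioms])
  define e where "e i = coordinate_vector ?B n i \<one>\<^bsub>B\<^esub>" for i
  have e: "e i \<in> carrier (power_bimodule ?B n)" for i
    unfolding e_def by (rule coordinate_vector_closed[OF RB.M.abelian_group_axioms]) simp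
  have e_smult: "coordinate_vector ?B n i b = e i \<bullet>\<^bsub>power_bimodule ?B n\<^esub> b" if "b \<in> carrier B" for i b
    using that by (auto simp: e_def coordinate_vector_def)
  show thesis
  proof (rule that[of n "\<lambda>i. \<pi> (e i)" "\<lambda>i y. \<iota> y i"])
    show "\<pi> (e i) \<in> carrier M" for i by (rule right_linearD(3)[OF \<pi> e])
    show "(\<lambda>y. \<iota> y i) \<in> right_linear B M ?B" if "i < n" for i
    proof (rule right_linearI)
      show "(\<lambda>y. \<iota> y i) \<in> additive_maps M ?B"
        by (rule additive_comp[OF right_linearD(1)[OF \<iota>] power_eval_additive[OF that]])
      show "\<iota> (x \<bullet>\<^bsub>M\<^esub> b) i = \<iota> x i \<bullet>\<^bsub>?B\<^esub> b" if "b \<in> carrier B" "x \<in> carrier M" for b x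
        using right_linearD(2)[OF \<iota> that] \<open>i < n\<close> by simp
    qed
    fix y assume y: "y \<in> carrier M"
    have iy: "\<iota> y \<in> carrier (power_bimodule ?B n)" by (rule right_linearD(3)[OF \<iota> y])
    then have iyi: "\<iota> y i \<in> carrier B" if "i < n" for i using that by auto
    have "y = \<pi> (\<Oplus>\<^bsub>power_bimodule ?B n\<^esub>i\<in>{..<n}. coordinate_vector ?B n i (\<iota> y i))"
      unfolding power_expansion[OF RB.M.abelian_group_axioms iy] using id[OF y] by simp
    also have "\<dots> = (\<Oplus>\<^bsub>M\<^esub>i\<in>{..<n}. \<pi> (coordinate_vector ?B n i (\<iota> y i)))"
      by (rule additive_finsum[OF Bn.abelian_group_axioms M.M.abelian_group_axioms right_linearD(1)[OF \<pi>]])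
        (use coordinate_vector_closed[OF RB.M.abelian_group_axioms] iyi in auto)
    also have "\<dots> = (\<Oplus>\<^bsub>M\<^esub>i\<in>{..<n}. \<pi> (e i) \<bullet>\<^bsub>M\<^esub> \<iota> y i)"
    proof (rule M.M.finsum_eq)
      fix i assume "i \<in> {..<n}"
      then have i: "\<iota> y i \<in> carrier B" using iyi by simp
      show "\<pi> (coordinate_vector ?B n i (\<iota> y i)) = \<pi> (e i) \<bullet>\<^bsub>M\<^esub> \<iota> y i"
        unfolding e_smult[OF i] by (rule right_linearD(2)[OF \<pi> i e])
      show "\<pi> (e i) \<bullet>\<^bsub>M\<^esub> \<iota> y i \<in> carrier M"
        by (rule M.rsmult_closed[OF right_linearD(3)[OF \<pi> e] i])
    qed
    finally show "(\<Oplus>\<^bsub>M\<^esub>i\<in>{..<n}. \<pi> (e i) \<bullet>\<^bsub>M\<^esub> \<iota> y i) = y" by simp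
  qed
qed

text \<open>
  The index set is any finite set because the dual bases met later are indexed by pairs.
\<close>

lemma fg_projective_rightI:
  fixes M :: "('a, 'b, 'm) bimodule"
  assumes M: "bimodule A B M" and fin: "finite I"
    and x: "\<And>i. i \<in> I \<Longrightarrow> x i \<in> carrier M"
    and f: "\<And>i. i \<in> I \<Longrightarrow> f i \<in> right_linear B M (regular_bimodule B)"
    and dual: "\<And>y. y \<in> carrier M \<Longrightarrow> (\<Oplus>\<^bsub>M\<^esub>i\<in>I. x i \<bullet>\<^bsub>M\<^esub> f i y) = y"
  shows "fg_projective_right B M"
proof -
  interpret M: bimodule A B M by (rule M)
  let ?n = "card I" and ?B = "regular_bimodule B"
  obtain h where h: "bij_betw h {..<?n} I"
    using ex_bij_betw_nat_finite[OF fin] by (auto simp: atLeast0LessThan)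
  then have hI: "h i \<in> I" if "i < ?n" for i using that by (auto simp: bij_betw_def)
  define \<iota> where "\<iota> y = (\<lambda>i\<in>{..<?n}. f (h i) y)" for y
  define \<pi> where "\<pi> c = (\<Oplus>\<^bsub>M\<^esub>i\<in>{..<?n}. x (h i) \<bullet>\<^bsub>M\<^esub> c i)" for c
  have fcI: "f i y \<in> carrier B" if "i \<in> I" "y \<in> carrier M" for i y
    using right_linearD(3)[OF f[OF that(1)] that(2)] by simp
  note fc = fcI[OF hI]
  have "\<iota> \<in> right_linear B M (power_bimodule ?B ?n)"
    using fc right_linearD(2,4)[OF f[OF hI]]
    by (intro right_linearI additiveI) (auto simp: \<iota>_def)
  moreover have "\<pi> \<in> right_linear B (power_bimodule ?B ?n) M"
  proof (intro right_linearI additiveI)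
    fix c assume "c \<in> carrier (power_bimodule ?B ?n)"
    then have c: "c i \<in> carrier B" if "i < ?n" for i using that by auto
    show "\<pi> c \<in> carrier M"
      unfolding \<pi>_def using c x[OF hI] by (auto intro!: M.finsum_closed M.rsmult_closed)
    show "\<pi> (c \<bullet>\<^bsub>power_bimodule ?B ?n\<^esub> b) = \<pi> c \<bullet>\<^bsub>M\<^esub> b" if b: "b \<in> carrier B" for b
      unfolding \<pi>_def using c x[OF hI] b
      by (subst M.rsmult_finsum[OF b])
        (auto intro!: M.M.finsum_eq M.rsmult_closed simp: M.rsmult_assoc)
    fix d assume "d \<in> carrier (power_bimodule ?B ?n)"
    then have d: "d i \<in> carrier B" if "i < ?n" for i using that by auto
    show "\<pi> (c \<oplus>\<^bsub>power_bimodule ?B ?n\<^esub> d) = \<pi> c \<oplus>\<^bsub>M\<^esub> \<pi> d"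
      unfolding \<pi>_def using c d x[OF hI]
      by (subst M.M.finsum_add[symmetric])
        (auto intro!: M.M.finsum_eq M.rsmult_closed M.a_closed simp: M.rsmult_r_distr)
  qed
  moreover have "\<pi> (\<iota> y) = y" if y: "y \<in> carrier M" for y
  proof -
    have "\<pi> (\<iota> y) = (\<Oplus>\<^bsub>M\<^esub>i\<in>{..<?n}. x (h i) \<bullet>\<^bsub>M\<^esub> f (h i) y)"
      unfolding \<pi>_def \<iota>_def using fc y x[OF hI] by (auto intro!: M.M.finsum_eq M.rsmult_closed)
    also have "\<dots> = (\<Oplus>\<^bsub>M\<^esub>i\<in>h ` {..<?n}. x i \<bullet>\<^bsub>M\<^esub> f i y)"
      by (rule M.M.finsum_reindex[symmetric])
        (use h x hI fcI y in \<open>auto simp: bij_betw_def intro!: M.rsmult_closed\<close>)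
    also have "\<dots> = y" using h dual[OF y] by (simp add: bij_betw_def)
    finally show ?thesis .
  qed
  ultimately show ?thesis
    unfolding fg_projective_right_def right_summand_def by blast
qed

lemma fg_projective_leftI:
  fixes M :: "('a, 'b, 'm) bimodule"
  assumes M: "bimodule A B M" and fin: "finite I"
    and x: "\<And>i. i \<in> I \<Longrightarrow> x i \<in> carrier M"
    and f: "\<And>i. i \<in> I \<Longrightarrow> f i \<in> left_linear A M (regular_bimodule A)"
    and dual: "\<And>y. y \<in> carrier M \<Longrightarrow> (\<Oplus>\<^bsub>M\<^esub>i\<in>I. f i y \<odot>\<^bsub>M\<^esub> x i) = y"
  shows "fg_projective_left A M"
proof -
  interpret M: bimodule A B M by (rule M)
  let ?n = "card I" and ?A = "regular_bimodule A"
  obtain h where h: "bij_betw h {..<?n} I"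
    using ex_bij_betw_nat_finite[OF fin] by (auto simp: atLeast0LessThan)
  then have hI: "h i \<in> I" if "i < ?n" for i using that by (auto simp: bij_betw_def)
  define \<iota> where "\<iota> y = (\<lambda>i\<in>{..<?n}. f (h i) y)" for y
  define \<pi> where "\<pi> c = (\<Oplus>\<^bsub>M\<^esub>i\<in>{..<?n}. c i \<odot>\<^bsub>M\<^esub> x (h i))" for c
  have fcI: "f i y \<in> carrier A" if "i \<in> I" "y \<in> carrier M" for i y
    using left_linearD(3)[OF f[OF that(1)] that(2)] by simp
  note fc = fcI[OF hI]
  have "\<iota> \<in> left_linear A M (power_bimodule ?A ?n)"
    using fc left_linearD(2,4)[OF f[OF hI]]
    by (intro left_linearI additiveI) (auto simp: \<iota>_def)
  moreover have "\<pi> \<in> left_linear A (power_bimodule ?A ?n) M"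
  proof (intro left_linearI additiveI)
    fix c assume "c \<in> carrier (power_bimodule ?A ?n)"
    then have c: "c i \<in> carrier A" if "i < ?n" for i using that by auto
    show "\<pi> c \<in> carrier M"
      unfolding \<pi>_def using c x[OF hI] by (auto intro!: M.finsum_closed M.lsmult_closed)
    show "\<pi> (a \<odot>\<^bsub>power_bimodule ?A ?n\<^esub> c) = a \<odot>\<^bsub>M\<^esub> \<pi> c" if a: "a \<in> carrier A" for a
      unfolding \<pi>_def using c x[OF hI] a
      by (subst M.lsmult_finsum[OF a])
        (auto intro!: M.M.finsum_eq M.lsmult_closed simp: M.lsmult_assoc)
    fix d assume "d \<in> carrier (power_bimodule ?A ?n)"
    then have d: "d i \<in> carrier A" if "i < ?n" for i using that by auto
    show "\<pi> (c \<oplus>\<^bsub>power_bimodule ?A ?n\<^esub> d) = \<pi> c \<oplus>\<^bsub>M\<^esub> \<pi> d"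
      unfolding \<pi>_def using c d x[OF hI]
      by (subst M.M.finsum_add[symmetric])
        (auto intro!: M.M.finsum_eq M.lsmult_closed M.a_closed simp: M.lsmult_l_distr)
  qed
  moreover have "\<pi> (\<iota> y) = y" if y: "y \<in> carrier M" for y
  proof -
    have "\<pi> (\<iota> y) = (\<Oplus>\<^bsub>M\<^esub>i\<in>{..<?n}. f (h i) y \<odot>\<^bsub>M\<^esub> x (h i))"
      unfolding \<pi>_def \<iota>_def using fc y x[OF hI] by (auto intro!: M.M.finsum_eq M.lsmult_closed)
    also have "\<dots> = (\<Oplus>\<^bsub>M\<^esub>i\<in>h ` {..<?n}. f i y \<odot>\<^bsub>M\<^esub> x i)"
      by (rule M.M.finsum_reindex[symmetric])
        (use h x hI fcI y in \<open>auto simp: bij_betw_def intro!: M.lsmult_closed\<close>)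
    also have "\<dots> = y" using h dual[OF y] by (simp add: bij_betw_def)
    finally show ?thesis .
  qed
  ultimately show ?thesis
    unfolding fg_projective_left_def left_summand_def by blast
qed

text \<open>
  A retraction \<open>M\<^sup>n \<rightarrow> B\<close> maps some vector to \<open>1\<close>; decomposing that vector into its coordinates exhibits
  \<open>1\<close> as an element of the trace ideal of \<open>M\<close>.
\<close>

lemma generator_right_unit:
  fixes M :: "('a, 'b, 'm) bimodule"
  assumes M: "bimodule A B M" and gen: "generator_right B M"
  obtains n :: nat and u v where "\<And>i. i < n \<Longrightarrow> u i \<in> carrier M"
    and "\<And>i. i < n \<Longrightarrow> v i \<in> right_linear B M (regular_bimodule B)"
    and "(\<Oplus>\<^bsub>B\<^esub>i\<in>{..<n}. v i (u i)) = \<one>\<^bsub>B\<^esub>"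
proof -
  interpret M: bimodule A B M by (rule M)
  let ?B = "regular_bimodule B"
  interpret RB: bimodule B B ?B by (rule regular_bimodule_bimodule[OF M.S.ring_axioms])
  from gen obtain n \<iota> \<pi> where \<iota>: "\<iota> \<in> right_linear B ?B (power_bimodule M n)"
    and \<pi>: "\<pi> \<in> right_linear B (power_bimodule M n) ?B" and id: "\<And>x. x \<in> carrier B \<Longrightarrow> \<pi> (\<iota> x) = x"
    unfolding generator_right_def right_summand_def by auto
  interpret Mn: abelian_group "power_bimodule M n"
    by (rule power_abelian_group[OF M.M.abelian_group_axioms])
  have i1: "\<iota> \<one>\<^bsub>B\<^esub> \<in> carrier (power_bimodule M n)"
    by (rule right_linearD(3)[OF \<iota>]) simp
  then have i1i: "\<iota> \<one>\<^bsub>B\<^esub> i \<in> carrier M" if "i < n" for i using that by auto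
  show thesis
  proof (rule that[of n "\<iota> \<one>\<^bsub>B\<^esub>" "\<lambda>i u. \<pi> (coordinate_vector M n i u)"])
    show "\<iota> \<one>\<^bsub>B\<^esub> i \<in> carrier M" if "i < n" for i by (rule i1i[OF that])
    show "(\<lambda>u. \<pi> (coordinate_vector M n i u)) \<in> right_linear B M ?B" for i
    proof (rule right_linearI)
      show "(\<lambda>u. \<pi> (coordinate_vector M n i u)) \<in> additive_maps M ?B"
        by (rule additive_comp[OF coordinate_vector_additive[OF M.M.abelian_group_axioms]
              right_linearD(1)[OF \<pi>]])
      fix b u assume bu: "b \<in> carrier B" "u \<in> carrier M"
      have "coordinate_vector M n i (u \<bullet>\<^bsub>M\<^esub> b) = coordinate_vector M n i u \<bullet>\<^bsub>power_bimodule M n\<^esub> b"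
        using bu by (auto simp: coordinate_vector_def M.rsmult_zero)
      then show "\<pi> (coordinate_vector M n i (u \<bullet>\<^bsub>M\<^esub> b)) = \<pi> (coordinate_vector M n i u) \<bullet>\<^bsub>?B\<^esub> b"
        using right_linearD(2)[OF \<pi> bu(1) coordinate_vector_closed[OF M.M.abelian_group_axioms bu(2)]]
        by simp
    qed
    have "\<one>\<^bsub>B\<^esub> = \<pi> (\<Oplus>\<^bsub>power_bimodule M n\<^esub>i\<in>{..<n}. coordinate_vector M n i (\<iota> \<one>\<^bsub>B\<^esub> i))"
      unfolding power_expansion[OF M.M.abelian_group_axioms i1] using id by simp
    also have "\<dots> = (\<Oplus>\<^bsub>?B\<^esub>i\<in>{..<n}. \<pi> (coordinate_vector M n i (\<iota> \<one>\<^bsub>B\<^esub> i)))"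
      by (rule additive_finsum[OF Mn.abelian_group_axioms RB.M.abelian_group_axioms right_linearD(1)[OF \<pi>]])
        (use coordinate_vector_closed[OF M.M.abelian_group_axioms] i1i in auto)
    finally show "(\<Oplus>\<^bsub>B\<^esub>i\<in>{..<n}. \<pi> (coordinate_vector M n i (\<iota> \<one>\<^bsub>B\<^esub> i))) = \<one>\<^bsub>B\<^esub>"
      by simp
  qed
qed

section \<open>Hom modules and endomorphism rings\<close>

lemma Hom_right_simps [simp]:
  "carrier (Hom_right B M N) = right_linear B M N \<inter> extensional (carrier M)"
  "f \<oplus>\<^bsub>Hom_right B M N\<^esub> g = (\<lambda>x\<in>carrier M. f x \<oplus>\<^bsub>N\<^esub> g x)"
  "\<zero>\<^bsub>Hom_right B M N\<^esub> = (\<lambda>x\<in>carrier M. \<zero>\<^bsub>N\<^esub>)"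
  "a \<odot>\<^bsub>Hom_right B M N\<^esub> f = (\<lambda>x\<in>carrier M. a \<odot>\<^bsub>N\<^esub> f x)"
  "f \<bullet>\<^bsub>Hom_right B M N\<^esub> c = (\<lambda>x\<in>carrier M. f (c \<odot>\<^bsub>M\<^esub> x))"
  by (simp_all add: Hom_right_def)

lemma Hom_left_simps [simp]:
  "carrier (Hom_left A M N) = left_linear A M N \<inter> extensional (carrier M)"
  "f \<oplus>\<^bsub>Hom_left A M N\<^esub> g = (\<lambda>x\<in>carrier M. f x \<oplus>\<^bsub>N\<^esub> g x)"
  "\<zero>\<^bsub>Hom_left A M N\<^esub> = (\<lambda>x\<in>carrier M. \<zero>\<^bsub>N\<^esub>)"
  "b \<odot>\<^bsub>Hom_left A M N\<^esub> f = (\<lambda>x\<in>carrier M. f (x \<bullet>\<^bsub>M\<^esub> b))"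
  "f \<bullet>\<^bsub>Hom_left A M N\<^esub> c = (\<lambda>x\<in>carrier M. f x \<bullet>\<^bsub>N\<^esub> c)"
  by (simp_all add: Hom_left_def)

lemma End_right_simps [simp]:
  "carrier (End_right B M) = right_linear B M M \<inter> extensional (carrier M)"
  "f \<otimes>\<^bsub>End_right B M\<^esub> g = (\<lambda>x\<in>carrier M. f (g x))"
  "\<one>\<^bsub>End_right B M\<^esub> = (\<lambda>x\<in>carrier M. x)"
  "f \<oplus>\<^bsub>End_right B M\<^esub> g = (\<lambda>x\<in>carrier M. f x \<oplus>\<^bsub>M\<^esub> g x)"
  "\<zero>\<^bsub>End_right B M\<^esub> = (\<lambda>x\<in>carrier M. \<zero>\<^bsub>M\<^esub>)"
  by (simp_all add: End_right_def compose_def)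

lemma restrict_right_linear:
  assumes "bimodule C B M" "f \<in> right_linear B M N"
  shows "(\<lambda>x\<in>carrier M. f x) \<in> right_linear B M N"
proof -
  interpret M: bimodule C B M by (rule assms(1))
  show ?thesis
    using right_linearD[OF assms(2)]
    by (intro right_linearI additiveI) (simp_all add: M.rsmult_closed)
qed

lemma restrict_left_linear:
  assumes "bimodule A C M" "f \<in> left_linear A M N"
  shows "(\<lambda>x\<in>carrier M. f x) \<in> left_linear A M N"
proof -
  interpret M: bimodule A C M by (rule assms(1))
  show ?thesis
    using left_linearD[OF assms(2)]
    by (intro left_linearI additiveI) (simp_all add: M.lsmult_closed)
qed

lemma right_linear_group:
  assumes M: "bimodule C B M" and N: "bimodule A B N"
  shows "\<lbrakk>f \<in> right_linear B M N; g \<in> right_linear B M N\<rbrakk> \<Longrightarrow> (\<lambda>x. f x \<oplus>\<^bsub>N\<^esub> g x) \<in> right_linear B M N"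
    and "(\<lambda>x. \<zero>\<^bsub>N\<^esub>) \<in> right_linear B M N"
    and "f \<in> right_linear B M N \<Longrightarrow> (\<lambda>x. \<ominus>\<^bsub>N\<^esub> f x) \<in> right_linear B M N"
proof -
  interpret M: bimodule C B M by (rule M)
  interpret N: bimodule A B N by (rule N)
  show "(\<lambda>x. f x \<oplus>\<^bsub>N\<^esub> g x) \<in> right_linear B M N" if "f \<in> right_linear B M N" "g \<in> right_linear B M N"
    using right_linearD[OF that(1)] right_linearD[OF that(2)]
    by (intro right_linearI additiveI) (simp_all add: N.rsmult_l_distr N.M.a_ac)
  show "(\<lambda>x. \<zero>\<^bsub>N\<^esub>) \<in> right_linear B M N"
    by (intro right_linearI additiveI) (simp_all add: N.rsmult_zero)
  show "(\<lambda>x. \<ominus>\<^bsub>N\<^esub> f x) \<in> right_linear B M N" if "f \<in> right_linear B M N"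
    using right_linearD[OF that]
    by (intro right_linearI additiveI) (simp_all add: N.rsmult_minus N.M.minus_add)
qed

lemma left_linear_group:
  assumes M: "bimodule A C M" and N: "bimodule A B N"
  shows "\<lbrakk>f \<in> left_linear A M N; g \<in> left_linear A M N\<rbrakk> \<Longrightarrow> (\<lambda>x. f x \<oplus>\<^bsub>N\<^esub> g x) \<in> left_linear A M N"
    and "(\<lambda>x. \<zero>\<^bsub>N\<^esub>) \<in> left_linear A M N"
    and "f \<in> left_linear A M N \<Longrightarrow> (\<lambda>x. \<ominus>\<^bsub>N\<^esub> f x) \<in> left_linear A M N"
proof -
  interpret M: bimodule A C M by (rule M)
  interpret N: bimodule A B N by (rule N)
  show "(\<lambda>x. f x \<oplus>\<^bsub>N\<^esub> g x) \<in> left_linear A M N" if "f \<in> left_linear A M N" "g \<in> left_linear A M N"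
    using left_linearD[OF that(1)] left_linearD[OF that(2)]
    by (intro left_linearI additiveI) (simp_all add: N.lsmult_r_distr N.M.a_ac)
  show "(\<lambda>x. \<zero>\<^bsub>N\<^esub>) \<in> left_linear A M N"
    by (intro left_linearI additiveI) (simp_all add: N.lsmult_zero)
  show "(\<lambda>x. \<ominus>\<^bsub>N\<^esub> f x) \<in> left_linear A M N" if "f \<in> left_linear A M N"
    using left_linearD[OF that]
    by (intro left_linearI additiveI) (simp_all add: N.lsmult_minus N.M.minus_add)
qed

lemma Hom_right_bimodule:
  assumes M: "bimodule C B M" and N: "bimodule A B N"
  shows "bimodule A C (Hom_right B M N)"
proof -
  interpret M: bimodule C B M by (rule M)
  interpret N: bimodule A B N by (rule N)
  have cl: "f x \<in> carrier N" if "f \<in> right_linear B M N" "x \<in> carrier M" for f x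
    by (rule right_linearD(3)[OF that])
  have sub: "carrier (Hom_right B M N) \<subseteq> carrier M \<rightarrow>\<^sub>E carrier N"
    using cl by (auto simp only: PiE_def Pi_iff Hom_right_simps Int_iff)
  note rl = restrict_right_linear[OF M]
  have grp: "abelian_group (Hom_right B M N)"
    by (rule pointwise_abelian_group[where D = "carrier M", OF N.M.abelian_group_axioms sub])
      (auto simp: cl intro!: rl right_linear_group[OF M N])
  have "(\<lambda>x. a \<odot>\<^bsub>N\<^esub> f x) \<in> right_linear B M N" if "a \<in> carrier A" "f \<in> right_linear B M N" for a f
    using right_linearD[OF that(2)] that(1)
    by (intro right_linearI additiveI) (simp_all add: N.lsmult_closed N.lsmult_r_distr N.smult_rsmult)
  moreover have "(\<lambda>x. f (c \<odot>\<^bsub>M\<^esub> x)) \<in> right_linear B M N" if "c \<in> carrier C" "f \<in> right_linear B M N" for c f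
    using right_linearD[OF that(2)] that(1)
    by (intro right_linearI additiveI)
      (simp_all add: M.lsmult_closed M.lsmult_r_distr M.smult_rsmult[symmetric])
  moreover have "f (c \<odot>\<^bsub>M\<^esub> x \<oplus>\<^bsub>M\<^esub> c' \<odot>\<^bsub>M\<^esub> x) = f (c \<odot>\<^bsub>M\<^esub> x) \<oplus>\<^bsub>N\<^esub> f (c' \<odot>\<^bsub>M\<^esub> x)"
    if "f \<in> right_linear B M N" "c \<in> carrier C" "c' \<in> carrier C" "x \<in> carrier M" for f c c' x
    using right_linearD(4)[OF that(1)] that by (simp add: M.lsmult_closed)
  moreover have "(\<lambda>x\<in>carrier M. \<one>\<^bsub>A\<^esub> \<odot>\<^bsub>N\<^esub> f x) = f" "(\<lambda>x\<in>carrier M. f (\<one>\<^bsub>C\<^esub> \<odot>\<^bsub>M\<^esub> x)) = f"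
    if "f \<in> right_linear B M N" "f \<in> extensional (carrier M)" for f
    using cl[OF that(1)] extensional_arb[OF that(2)] by (auto simp: N.lsmult_one M.lsmult_one)
  ultimately show ?thesis
    by (intro bimodule.intro bimodule_axioms.intro N.R.ring_axioms M.R.ring_axioms grp)
      (auto simp: cl M.lsmult_closed N.lsmult_closed N.lsmult_l_distr N.lsmult_r_distr N.lsmult_assoc
         M.lsmult_l_distr M.lsmult_assoc  intro!: rl)
qed

lemma Hom_left_bimodule:
  assumes M: "bimodule A B M" and N: "bimodule A C N"
  shows "bimodule B C (Hom_left A M N)"
proof -
  interpret M: bimodule A B M by (rule M)
  interpret N: bimodule A C N by (rule N)
  have cl: "f x \<in> carrier N" if "f \<in> left_linear A M N" "x \<in> carrier M" for f x
    by (rule left_linearD(3)[OF that])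
  have sub: "carrier (Hom_left A M N) \<subseteq> carrier M \<rightarrow>\<^sub>E carrier N"
    using cl by (auto simp only: PiE_def Pi_iff Hom_left_simps Int_iff)
  note rl = restrict_left_linear[OF M]
  have grp: "abelian_group (Hom_left A M N)"
    by (rule pointwise_abelian_group[where D = "carrier M", OF N.M.abelian_group_axioms sub])
      (auto simp: cl intro!: rl left_linear_group[OF M N])
  have "(\<lambda>x. f x \<bullet>\<^bsub>N\<^esub> c) \<in> left_linear A M N" if "c \<in> carrier C" "f \<in> left_linear A M N" for c f
    using left_linearD[OF that(2)] that(1)
    by (intro left_linearI additiveI) (simp_all add: N.rsmult_closed N.rsmult_l_distr N.smult_rsmult)
  moreover have "(\<lambda>x. f (x \<bullet>\<^bsub>M\<^esub> b)) \<in> left_linear A M N" if "b \<in> carrier B" "f \<in> left_linear A M N" for b f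
    using left_linearD[OF that(2)] that(1)
    by (intro left_linearI additiveI)
      (simp_all add: M.rsmult_closed M.rsmult_l_distr M.smult_rsmult)
  moreover have "f (x \<bullet>\<^bsub>M\<^esub> b \<oplus>\<^bsub>M\<^esub> x \<bullet>\<^bsub>M\<^esub> b') = f (x \<bullet>\<^bsub>M\<^esub> b) \<oplus>\<^bsub>N\<^esub> f (x \<bullet>\<^bsub>M\<^esub> b')"
    if "f \<in> left_linear A M N" "b \<in> carrier B" "b' \<in> carrier B" "x \<in> carrier M" for f b b' x
    using left_linearD(4)[OF that(1)] that by (simp add: M.rsmult_closed)
  moreover have "(\<lambda>x\<in>carrier M. f x \<bullet>\<^bsub>N\<^esub> \<one>\<^bsub>C\<^esub>) = f" "(\<lambda>x\<in>carrier M. f (x \<bullet>\<^bsub>M\<^esub> \<one>\<^bsub>B\<^esub>)) = f"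
    if "f \<in> left_linear A M N" "f \<in> extensional (carrier M)" for f
    using cl[OF that(1)] extensional_arb[OF that(2)] by (auto simp: N.rsmult_one M.rsmult_one)
  ultimately show ?thesis
    by (intro bimodule.intro bimodule_axioms.intro N.S.ring_axioms M.S.ring_axioms grp)
      (auto simp: cl M.rsmult_closed N.rsmult_closed N.rsmult_l_distr N.rsmult_r_distr N.rsmult_assoc
         M.rsmult_r_distr M.rsmult_assoc  intro!: rl)
qed

lemma End_right_ring:
  assumes M: "bimodule A B M"
  shows "ring (End_right B M)"
proof -
  interpret M: bimodule A B M by (rule M)
  have cl: "f x \<in> carrier M" if "f \<in> right_linear B M M" "x \<in> carrier M" for f x
    by (rule right_linearD(3)[OF that])
  have sub: "carrier (End_right B M) \<subseteq> carrier M \<rightarrow>\<^sub>E carrier M"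
    using cl by (auto simp only: PiE_def Pi_iff End_right_simps Int_iff)
  note rl = restrict_right_linear[OF M]
  have "abelian_group (End_right B M)"
    by (rule pointwise_abelian_group[where D = "carrier M", OF M.M.abelian_group_axioms sub])
      (auto simp: cl intro!: rl right_linear_group[OF M M])
  moreover have "(\<lambda>x. f (g x)) \<in> right_linear B M M" if "f \<in> right_linear B M M" "g \<in> right_linear B M M" for f g
    using right_linearD[OF that(1)] right_linearD[OF that(2)]
    by (intro right_linearI additiveI) simp_all
  moreover have "(\<lambda>x. x) \<in> right_linear B M M"
    by (intro right_linearI additiveI) simp_all
  moreover have "(\<lambda>x\<in>carrier M. if f x \<in> carrier M then f x else undefined) = f"
    "(\<lambda>x\<in>carrier M. f (if x \<in> carrier M then x else undefined)) = f"
    if "f \<in> right_linear B M M" "f \<in> extensional (carrier M)" for f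
    using cl[OF that(1)] extensional_arb[OF that(2)] by auto
  ultimately show ?thesis
    by (intro ringI monoidI)
      (auto simp: cl right_linearD(4) intro!: rl)
qed

lemma left_mult_map_ring_hom:
  assumes M: "bimodule A B M"
  shows "left_mult_map M \<in> ring_hom A (End_right B M)"
proof -
  interpret M: bimodule A B M by (rule M)
  have "(\<lambda>x. a \<odot>\<^bsub>M\<^esub> x) \<in> right_linear B M M" if "a \<in> carrier A" for a
    using that by (intro right_linearI M.lsmult_additive) (simp_all add: M.smult_rsmult)
  then show ?thesis
    by (intro ring_hom_memI)
      (auto simp: left_mult_map_def M.lsmult_closed M.lsmult_l_distr M.lsmult_assoc M.lsmult_one
        intro!: restrict_right_linear[OF M])
qed

section \<open>Split epimorphisms onto a ring and Frobenius systems\<close>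

text \<open>
  A bimodule map out of \<open>R\<close> is determined by the image \<open>z\<close> of \<open>1\<close>, and \<open>r \<mapsto> r z\<close> is such a map exactly
  when \<open>z\<close> commutes with the scalars.
\<close>

theorem split_epi_regular_iff:
  assumes M: "bimodule R R M"
  shows "bimodule_split_epi R R M (regular_bimodule R) f \<longleftrightarrow>
    f \<in> bimodule_hom R R M (regular_bimodule R) \<and>
    (\<exists>z\<in>carrier M. f z = \<one>\<^bsub>R\<^esub> \<and> (\<forall>r\<in>carrier R. r \<odot>\<^bsub>M\<^esub> z = z \<bullet>\<^bsub>M\<^esub> r))"
proof -
  interpret M: bimodule R R M by (rule M)
  show ?thesis
  proof (intro iffI conjI; (elim conjE bexE)?)
    assume split: "bimodule_split_epi R R M (regular_bimodule R) f"
    then show "f \<in> bimodule_hom R R M (regular_bimodule R)"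
      by (simp add: bimodule_split_epi_def)
    from split obtain g where g: "g \<in> bimodule_hom R R (regular_bimodule R) M"
      and fg: "\<And>y. y \<in> carrier R \<Longrightarrow> f (g y) = y"
      by (auto simp: bimodule_split_epi_def)
    have "r \<odot>\<^bsub>M\<^esub> g \<one>\<^bsub>R\<^esub> = g \<one>\<^bsub>R\<^esub> \<bullet>\<^bsub>M\<^esub> r" if r: "r \<in> carrier R" for r
      using bimodule_homD(2)[OF g r, of "\<one>\<^bsub>R\<^esub>"] bimodule_homD(3)[OF g r, of "\<one>\<^bsub>R\<^esub>"] r by simp
    then show "\<exists>z\<in>carrier M. f z = \<one>\<^bsub>R\<^esub> \<and> (\<forall>r\<in>carrier R. r \<odot>\<^bsub>M\<^esub> z = z \<bullet>\<^bsub>M\<^esub> r)"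
      using fg bimodule_homD(4)[OF g, of "\<one>\<^bsub>R\<^esub>"] by (intro bexI[of _ "g \<one>\<^bsub>R\<^esub>"]) auto
  next
    fix z assume f: "f \<in> bimodule_hom R R M (regular_bimodule R)" and z: "z \<in> carrier M" "f z = \<one>\<^bsub>R\<^esub>"
      and central: "\<forall>r\<in>carrier R. r \<odot>\<^bsub>M\<^esub> z = z \<bullet>\<^bsub>M\<^esub> r"
    have "(\<lambda>r. r \<odot>\<^bsub>M\<^esub> z) \<in> bimodule_hom R R (regular_bimodule R) M"
    proof (rule bimodule_homI)
      show "(\<lambda>r. r \<odot>\<^bsub>M\<^esub> z) \<in> additive_maps (regular_bimodule R) M"
        using M.lscalar_additive[OF z(1)] by simp
      fix b x assume "b \<in> carrier R" "x \<in> carrier (regular_bimodule R)"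
      then show "(x \<bullet>\<^bsub>regular_bimodule R\<^esub> b) \<odot>\<^bsub>M\<^esub> z = x \<odot>\<^bsub>M\<^esub> z \<bullet>\<^bsub>M\<^esub> b"
        using z central by (simp add: M.rsmult_assoc)
    qed (use z in \<open>simp add: M.lsmult_assoc\<close>)
    moreover have "f (r \<odot>\<^bsub>M\<^esub> z) = r" if "r \<in> carrier R" for r
      using bimodule_homD(2)[OF f that z(1)] z that by simp
    ultimately show "bimodule_split_epi R R M (regular_bimodule R) f"
      using f unfolding bimodule_split_epi_def
      by (intro conjI bexI[of _ "\<lambda>r. r \<odot>\<^bsub>M\<^esub> z"] ballI) simp_all
  qed
qed

text \<open>
  The form \<open>F\<close> is a Frobenius homomorphism and \<open>X\<close>, \<open>Y\<close> are dual bases for it. Unlike an abstract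
  isomorphism \<open>E \<cong> Hom(E\<^sub>A, A\<^sub>A)\<close>, these data can be written down from a context and fed back into one.
\<close>

locale frobenius_system = A: ring A + E: ring E
  for A :: "'a ring" and E :: "'e ring" +
  fixes \<phi> :: "'a \<Rightarrow> 'e" and F :: "'e \<Rightarrow> 'a" and I :: "'i set" and X Y :: "'i \<Rightarrow> 'e"
  assumes hom: "\<phi> \<in> ring_hom A E"
    and F: "F \<in> bimodule_hom A A (ring_bimodule E \<phi> \<phi>) (regular_bimodule A)"
    and fin: "finite I"
    and XE: "\<And>i. i \<in> I \<Longrightarrow> X i \<in> carrier E"
    and YE: "\<And>i. i \<in> I \<Longrightarrow> Y i \<in> carrier E"
    and X_dual: "\<And>x. x \<in> carrier E \<Longrightarrow> (\<Oplus>\<^bsub>E\<^esub>i\<in>I. X i \<otimes>\<^bsub>E\<^esub> \<phi> (F (Y i \<otimes>\<^bsub>E\<^esub> x))) = x"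
    and Y_dual: "\<And>x. x \<in> carrier E \<Longrightarrow> (\<Oplus>\<^bsub>E\<^esub>i\<in>I. \<phi> (F (x \<otimes>\<^bsub>E\<^esub> X i)) \<otimes>\<^bsub>E\<^esub> Y i) = x"
begin

lemma F_closed [simp]: "x \<in> carrier E \<Longrightarrow> F x \<in> carrier A"
  using bimodule_homD(4)[OF F] by simp

lemma hom_closed [simp]: "a \<in> carrier A \<Longrightarrow> \<phi> a \<in> carrier E"
  by (rule ring_hom_closed[OF hom])

lemma F_additive: "F \<in> additive_maps E A"
  using bimodule_homD(1)[OF F] by simp

lemma F_left: "\<lbrakk>a \<in> carrier A; x \<in> carrier E\<rbrakk> \<Longrightarrow> F (\<phi> a \<otimes>\<^bsub>E\<^esub> x) = a \<otimes>\<^bsub>A\<^esub> F x"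
  using bimodule_homD(2)[OF F] by simp

lemma F_right: "\<lbrakk>a \<in> carrier A; x \<in> carrier E\<rbrakk> \<Longrightarrow> F (x \<otimes>\<^bsub>E\<^esub> \<phi> a) = F x \<otimes>\<^bsub>A\<^esub> a"
  using bimodule_homD(3)[OF F] by simp

lemma mult_additive: "d \<in> carrier E \<Longrightarrow> (\<lambda>x. d \<otimes>\<^bsub>E\<^esub> x) \<in> additive_maps E E"
  by (rule additiveI) (simp_all add: E.r_distr)

lemma F_nondegenerate:
  assumes "d \<in> carrier E" "d' \<in> carrier E" "\<And>x. x \<in> carrier E \<Longrightarrow> F (d \<otimes>\<^bsub>E\<^esub> x) = F (d' \<otimes>\<^bsub>E\<^esub> x)"
  shows "d = d'"
proof -
  have "(\<Oplus>\<^bsub>E\<^esub>i\<in>I. \<phi> (F (d \<otimes>\<^bsub>E\<^esub> X i)) \<otimes>\<^bsub>E\<^esub> Y i) = (\<Oplus>\<^bsub>E\<^esub>i\<in>I. \<phi> (F (d' \<otimes>\<^bsub>E\<^esub> X i)) \<otimes>\<^bsub>E\<^esub> Y i)"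
    by (rule E.finsum_eq) (simp_all add: assms XE YE)
  then show ?thesis using Y_dual assms(1,2) by simp
qed

lemma F_represents:
  assumes h: "h \<in> right_linear A (ring_bimodule E (\<lambda>x. x) \<phi> :: ('e, 'a, 'e) bimodule) (regular_bimodule A)"
  obtains d where "d \<in> carrier E" "\<And>x. x \<in> carrier E \<Longrightarrow> h x = F (d \<otimes>\<^bsub>E\<^esub> x)"
proof
  have h_closed: "h x \<in> carrier A" if "x \<in> carrier E" for x
    using right_linearD(3)[OF h] that by simp
  have h_right: "h (x \<otimes>\<^bsub>E\<^esub> \<phi> a) = h x \<otimes>\<^bsub>A\<^esub> a" if "x \<in> carrier E" "a \<in> carrier A" for x a
    using right_linearD(2)[OF h, of a x] that by simp
  have h_additive: "h \<in> additive_maps E A" using right_linearD(1)[OF h] by simp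
  define d where "d = (\<Oplus>\<^bsub>E\<^esub>i\<in>I. \<phi> (h (X i)) \<otimes>\<^bsub>E\<^esub> Y i)"
  have t: "\<phi> (h (X i)) \<otimes>\<^bsub>E\<^esub> Y i \<in> carrier E" if "i \<in> I" for i
    using that by (simp add: h_closed XE YE)
  show "d \<in> carrier E" unfolding d_def by (rule E.finsum_closed) (use t in auto)
  fix x assume x: "x \<in> carrier E"
  have "F (d \<otimes>\<^bsub>E\<^esub> x) = F (\<Oplus>\<^bsub>E\<^esub>i\<in>I. \<phi> (h (X i)) \<otimes>\<^bsub>E\<^esub> Y i \<otimes>\<^bsub>E\<^esub> x)"
    unfolding d_def by (subst E.finsum_ldistr[OF fin x]) (use t in auto)
  also have "\<dots> = (\<Oplus>\<^bsub>A\<^esub>i\<in>I. F (\<phi> (h (X i)) \<otimes>\<^bsub>E\<^esub> Y i \<otimes>\<^bsub>E\<^esub> x))"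
    by (rule additive_finsum[OF E.abelian_group_axioms A.abelian_group_axioms F_additive])
      (use t x in simp)
  also have "\<dots> = (\<Oplus>\<^bsub>A\<^esub>i\<in>I. h (X i \<otimes>\<^bsub>E\<^esub> \<phi> (F (Y i \<otimes>\<^bsub>E\<^esub> x))))"
    by (rule A.finsum_eq) (use x in \<open>simp_all add: h_closed h_right XE YE E.m_assoc F_left\<close>)
  also have "\<dots> = h (\<Oplus>\<^bsub>E\<^esub>i\<in>I. X i \<otimes>\<^bsub>E\<^esub> \<phi> (F (Y i \<otimes>\<^bsub>E\<^esub> x)))"
    by (rule additive_finsum[OF E.abelian_group_axioms A.abelian_group_axioms h_additive, symmetric])
      (use x in \<open>simp add: XE YE\<close>)
  finally show "h x = F (d \<otimes>\<^bsub>E\<^esub> x)" using X_dual[OF x] by simp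
qed

lemma bimodule_right: "bimodule E A (ring_bimodule E (\<lambda>x. x) \<phi> :: ('e, 'a, 'e) bimodule)"
  by (rule ring_bimodule_bimodule[OF E.ring_axioms E.ring_axioms A.ring_axioms _ hom])
    (simp add: ring_hom_def)

text \<open>
  The isomorphism is \<open>d \<mapsto> F(d -)\<close>: it is injective by nondegeneracy and surjective by
  \<open>F_represents\<close>, and the functionals \<open>F(Y\<^sub>i -)\<close> complete the \<open>X\<^sub>i\<close> to a dual basis of \<open>E\<^sub>A\<close>.
\<close>

theorem frobenius_extension: "frobenius_extension A E \<phi>"
proof -
  let ?EA = "ring_bimodule E (\<lambda>x. x) \<phi> :: ('e, 'a, 'e) bimodule"
  let ?AE = "ring_bimodule E \<phi> (\<lambda>x. x) :: ('a, 'e, 'e) bimodule"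
  let ?A = "regular_bimodule A"
  have translate: "(\<lambda>x. F (d \<otimes>\<^bsub>E\<^esub> x)) \<in> right_linear A ?EA ?A" if d: "d \<in> carrier E" for d
  proof (rule right_linearI)
    show "(\<lambda>x. F (d \<otimes>\<^bsub>E\<^esub> x)) \<in> additive_maps ?EA ?A"
      using additive_comp[OF mult_additive[OF d] F_additive] by simp
    show "F (d \<otimes>\<^bsub>E\<^esub> (x \<bullet>\<^bsub>?EA\<^esub> a)) = F (d \<otimes>\<^bsub>E\<^esub> x) \<bullet>\<^bsub>?A\<^esub> a" if "a \<in> carrier A" "x \<in> carrier ?EA" for a x
      using that d by (simp add: E.m_assoc[symmetric] F_right)
  qed
  have "fg_projective_right A ?EA"
  proof (rule fg_projective_rightI[OF bimodule_right fin, of X "\<lambda>i x. F (Y i \<otimes>\<^bsub>E\<^esub> x)"])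
    show "(\<lambda>x. F (Y i \<otimes>\<^bsub>E\<^esub> x)) \<in> right_linear A ?EA ?A" if "i \<in> I" for i
      by (rule translate[OF YE[OF that]])
  qed (simp_all add: XE X_dual)
  moreover have "bimodule_isomorphic A E ?AE (Hom_right A ?EA ?A)"
  proof -
    define \<theta> where "\<theta> d = (\<lambda>x\<in>carrier E. F (d \<otimes>\<^bsub>E\<^esub> x))" for d
    have \<theta>_closed: "\<theta> d \<in> carrier (Hom_right A ?EA ?A)" if "d \<in> carrier E" for d
      using restrict_right_linear[OF bimodule_right translate[OF that]] by (simp add: \<theta>_def)
    have "\<theta> \<in> bimodule_hom A E ?AE (Hom_right A ?EA ?A)"
    proof (intro bimodule_homI additiveI)
      show "\<theta> d \<in> carrier (Hom_right A ?EA ?A)" if "d \<in> carrier ?AE" for d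
        using \<theta>_closed that by simp
      show "\<theta> (d \<oplus>\<^bsub>?AE\<^esub> d') = \<theta> d \<oplus>\<^bsub>Hom_right A ?EA ?A\<^esub> \<theta> d'" if "d \<in> carrier ?AE" "d' \<in> carrier ?AE" for d d'
        using that by (auto simp: \<theta>_def E.l_distr additive_add[OF F_additive])
      show "\<theta> (a \<odot>\<^bsub>?AE\<^esub> d) = a \<odot>\<^bsub>Hom_right A ?EA ?A\<^esub> \<theta> d" if "a \<in> carrier A" "d \<in> carrier ?AE" for a d
        using that by (auto simp: \<theta>_def E.m_assoc F_left)
      show "\<theta> (d \<bullet>\<^bsub>?AE\<^esub> e) = \<theta> d \<bullet>\<^bsub>Hom_right A ?EA ?A\<^esub> e" if "e \<in> carrier E" "d \<in> carrier ?AE" for e d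
        using that by (auto simp: \<theta>_def E.m_assoc)
    qed
    moreover have "bij_betw \<theta> (carrier ?AE) (carrier (Hom_right A ?EA ?A))"
    proof (rule bij_betwI')
      fix d d' assume d: "d \<in> carrier ?AE" "d' \<in> carrier ?AE"
      show "\<theta> d = \<theta> d' \<longleftrightarrow> d = d'"
      proof
        assume eq: "\<theta> d = \<theta> d'"
        have "F (d \<otimes>\<^bsub>E\<^esub> x) = F (d' \<otimes>\<^bsub>E\<^esub> x)" if "x \<in> carrier E" for x
          using fun_cong[OF eq, of x] that by (simp add: \<theta>_def)
        then show "d = d'" using F_nondegenerate d by simp
      qed simp
    next
      fix d assume "d \<in> carrier ?AE"
      then show "\<theta> d \<in> carrier (Hom_right A ?EA ?A)" using \<theta>_closed by simp
    next
      fix h assume "h \<in> carrier (Hom_right A ?EA ?A)"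
      then have h: "h \<in> right_linear A ?EA ?A" "h \<in> extensional (carrier E)" by simp_all
      obtain d where d: "d \<in> carrier E" "\<And>x. x \<in> carrier E \<Longrightarrow> h x = F (d \<otimes>\<^bsub>E\<^esub> x)"
        by (rule F_represents[OF h(1)]) blast
      then have "h = \<theta> d"
        using extensional_arb[OF h(2)] by (auto simp: \<theta>_def)
      then show "\<exists>d\<in>carrier ?AE. h = \<theta> d" using d(1) by auto
    qed
    ultimately show ?thesis unfolding bimodule_isomorphic_def by blast
  qed
  ultimately show ?thesis
    unfolding frobenius_extension_def
    using ring_hom_ringI2[OF A.ring_axioms E.ring_axioms hom] by blast
qed

end

text \<open>
  Given an isomorphism \<open>\<theta> : E \<rightarrow> Hom(E\<^sub>A, A\<^sub>A)\<close>, put \<open>F = \<theta>(1)\<close>, so that \<open>\<theta>(y) = F(y -)\<close>. The coordinate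
  functionals of a dual basis \<open>X\<close> of \<open>E\<^sub>A\<close> are then \<open>\<theta>(Y\<^sub>i)\<close> for some \<open>Y\<^sub>i\<close>, which is the first
  identity; the second holds because \<open>\<theta>\<close> maps both of its sides to \<open>F(x -)\<close>.
\<close>

theorem frobenius_extension_system:
  fixes A :: "'a ring" and E :: "'e ring"
  assumes "frobenius_extension A E \<phi>"
  obtains F n X Y where "frobenius_system A E \<phi> F {..<n::nat} X Y"
proof -
  let ?EA = "ring_bimodule E (\<lambda>x. x) \<phi> :: ('e, 'a, 'e) bimodule"
  let ?AE = "ring_bimodule E \<phi> (\<lambda>x. x) :: ('a, 'e, 'e) bimodule"
  let ?A = "regular_bimodule A"
  let ?H = "Hom_right A ?EA ?A"
  from assms have rh: "ring_hom_ring A E \<phi>" and fgp: "fg_projective_right A ?EA"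
    and iso: "bimodule_isomorphic A E ?AE ?H"
    by (simp_all add: frobenius_extension_def)
  interpret rh: ring_hom_ring A E \<phi> by (rule rh)
  note hom = rh.homh
  have EA: "bimodule E A ?EA"
    by (rule ring_bimodule_bimodule[OF rh.S.ring_axioms rh.S.ring_axioms rh.R.ring_axioms _ hom])
      (simp add: ring_hom_def)
  from iso obtain \<theta> where \<theta>: "\<theta> \<in> bimodule_hom A E ?AE ?H" and bij: "bij_betw \<theta> (carrier E) (carrier ?H)"
    unfolding bimodule_isomorphic_def by auto
  define F where "F = \<theta> \<one>\<^bsub>E\<^esub>"
  have FH: "F \<in> carrier ?H" unfolding F_def using bimodule_homD(4)[OF \<theta>] by simp
  then have F_lin: "F \<in> right_linear A ?EA ?A" by simp
  have \<theta>_eq: "\<theta> y x = F (y \<otimes>\<^bsub>E\<^esub> x)" if "y \<in> carrier E" "x \<in> carrier E" for x y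
  proof -
    have "\<theta> y = F \<bullet>\<^bsub>?H\<^esub> y"
      using bimodule_homD(3)[OF \<theta>, of y "\<one>\<^bsub>E\<^esub>"] that by (simp add: F_def)
    then show ?thesis using that by simp
  qed
  have F_hom: "F \<in> bimodule_hom A A (ring_bimodule E \<phi> \<phi>) ?A"
  proof (rule bimodule_homI)
    show "F \<in> additive_maps (ring_bimodule E \<phi> \<phi>) ?A" using right_linearD(1)[OF F_lin] by simp
    show "F (a \<odot>\<^bsub>ring_bimodule E \<phi> \<phi>\<^esub> x) = a \<odot>\<^bsub>?A\<^esub> F x" if "a \<in> carrier A" "x \<in> carrier (ring_bimodule E \<phi> \<phi>)" for a x
    proof -
      have "\<theta> (\<phi> a) = a \<odot>\<^bsub>?H\<^esub> F"
        using bimodule_homD(2)[OF \<theta>, of a "\<one>\<^bsub>E\<^esub>"] that by (simp add: F_def)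
      then show ?thesis using \<theta>_eq[of "\<phi> a" x] that by simp
    qed
    show "F (x \<bullet>\<^bsub>ring_bimodule E \<phi> \<phi>\<^esub> a) = F x \<bullet>\<^bsub>?A\<^esub> a" if "a \<in> carrier A" "x \<in> carrier (ring_bimodule E \<phi> \<phi>)" for a x
      using right_linearD(2)[OF F_lin, of a x] that by simp
  qed
  obtain n :: nat and X h where X: "\<And>i. i < n \<Longrightarrow> X i \<in> carrier ?EA"
    and h: "\<And>i. i < n \<Longrightarrow> h i \<in> right_linear A ?EA ?A"
    and dual: "\<And>y. y \<in> carrier ?EA \<Longrightarrow> (\<Oplus>\<^bsub>?EA\<^esub>i\<in>{..<n}. X i \<bullet>\<^bsub>?EA\<^esub> h i y) = y"
    by (rule fg_projective_right_dual_basis[OF EA fgp]) blast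
  have "\<exists>y. y \<in> carrier E \<and> \<theta> y = (\<lambda>x\<in>carrier E. h i x)" if "i < n" for i
  proof -
    have "(\<lambda>x\<in>carrier E. h i x) \<in> carrier ?H"
      using restrict_right_linear[OF EA h[OF that]] by simp
    then show ?thesis using bij unfolding bij_betw_def by (metis imageE)
  qed
  then obtain Y where Y: "\<And>i. i < n \<Longrightarrow> Y i \<in> carrier E"
    and \<theta>Y: "\<And>i. i < n \<Longrightarrow> \<theta> (Y i) = (\<lambda>x\<in>carrier E. h i x)" by metis
  have hY: "h i x = F (Y i \<otimes>\<^bsub>E\<^esub> x)" if "i < n" "x \<in> carrier E" for i x
    using \<theta>_eq[OF Y[OF that(1)] that(2)] \<theta>Y[OF that(1)] that(2) by simp
  have F_closed: "F x \<in> carrier A" if "x \<in> carrier E" for x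
    using right_linearD(3)[OF F_lin] that by simp
  have F_add: "F \<in> additive_maps E A" using right_linearD(1)[OF F_lin] by simp
  have F_l: "F (\<phi> a \<otimes>\<^bsub>E\<^esub> x) = a \<otimes>\<^bsub>A\<^esub> F x" and F_r: "F (x \<otimes>\<^bsub>E\<^esub> \<phi> a) = F x \<otimes>\<^bsub>A\<^esub> a"
    if "a \<in> carrier A" "x \<in> carrier E" for a x
    using bimodule_homD(2,3)[OF F_hom that(1)] that(2) by simp_all
  have X_dual: "(\<Oplus>\<^bsub>E\<^esub>i\<in>{..<n}. X i \<otimes>\<^bsub>E\<^esub> \<phi> (F (Y i \<otimes>\<^bsub>E\<^esub> x))) = x" if x: "x \<in> carrier E" for x
  proof -
    have "(\<Oplus>\<^bsub>E\<^esub>i\<in>{..<n}. X i \<otimes>\<^bsub>E\<^esub> \<phi> (F (Y i \<otimes>\<^bsub>E\<^esub> x))) = (\<Oplus>\<^bsub>E\<^esub>i\<in>{..<n}. X i \<otimes>\<^bsub>E\<^esub> \<phi> (h i x))"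
      by (rule rh.S.finsum_eq) (use x X Y F_closed in \<open>simp_all add: hY\<close>)
    then show ?thesis using dual x by simp
  qed
  have Y_dual: "(\<Oplus>\<^bsub>E\<^esub>i\<in>{..<n}. \<phi> (F (x \<otimes>\<^bsub>E\<^esub> X i)) \<otimes>\<^bsub>E\<^esub> Y i) = x" if x: "x \<in> carrier E" for x
  proof -
    let ?s = "\<Oplus>\<^bsub>E\<^esub>i\<in>{..<n}. \<phi> (F (x \<otimes>\<^bsub>E\<^esub> X i)) \<otimes>\<^bsub>E\<^esub> Y i"
    have t: "\<phi> (F (x \<otimes>\<^bsub>E\<^esub> X i)) \<otimes>\<^bsub>E\<^esub> Y i \<in> carrier E" if "i < n" for i
      using that x X Y F_closed by simp
    have s: "?s \<in> carrier E" by (rule rh.S.finsum_closed) (use t in auto)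
    have "F (?s \<otimes>\<^bsub>E\<^esub> z) = F (x \<otimes>\<^bsub>E\<^esub> z)" if z: "z \<in> carrier E" for z
    proof -
      have "F (?s \<otimes>\<^bsub>E\<^esub> z) = F (\<Oplus>\<^bsub>E\<^esub>i\<in>{..<n}. \<phi> (F (x \<otimes>\<^bsub>E\<^esub> X i)) \<otimes>\<^bsub>E\<^esub> Y i \<otimes>\<^bsub>E\<^esub> z)"
        by (subst rh.S.finsum_ldistr[OF _ z]) (use t in auto)
      also have "\<dots> = (\<Oplus>\<^bsub>A\<^esub>i\<in>{..<n}. F (\<phi> (F (x \<otimes>\<^bsub>E\<^esub> X i)) \<otimes>\<^bsub>E\<^esub> Y i \<otimes>\<^bsub>E\<^esub> z))"
        by (rule additive_finsum[OF rh.S.abelian_group_axioms rh.R.abelian_group_axioms F_add])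
          (use t z in simp)
      also have "\<dots> = (\<Oplus>\<^bsub>A\<^esub>i\<in>{..<n}. F (x \<otimes>\<^bsub>E\<^esub> (X i \<otimes>\<^bsub>E\<^esub> \<phi> (F (Y i \<otimes>\<^bsub>E\<^esub> z)))))"
        by (rule rh.R.finsum_eq)
          (use x z X Y F_closed in \<open>simp_all add: rh.S.m_assoc[symmetric] F_r, simp_all add: rh.S.m_assoc F_l\<close>)
      also have "\<dots> = F (\<Oplus>\<^bsub>E\<^esub>i\<in>{..<n}. x \<otimes>\<^bsub>E\<^esub> (X i \<otimes>\<^bsub>E\<^esub> \<phi> (F (Y i \<otimes>\<^bsub>E\<^esub> z))))"
        by (rule additive_finsum[OF rh.S.abelian_group_axioms rh.R.abelian_group_axioms F_add, symmetric])
          (use x z X Y F_closed in simp)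
      also have "\<dots> = F (x \<otimes>\<^bsub>E\<^esub> z)"
        by (subst rh.S.finsum_rdistr[OF _ x, symmetric])
          (use z X Y F_closed X_dual[OF z] in auto)
      finally show ?thesis .
    qed
    then have "\<theta> ?s z = \<theta> x z" if "z \<in> carrier E" for z
      using \<theta>_eq s x that by simp
    moreover have "\<theta> ?s \<in> extensional (carrier E)" "\<theta> x \<in> extensional (carrier E)"
      using bimodule_homD(4)[OF \<theta>] s x by auto
    ultimately have "\<theta> ?s = \<theta> x"
      by (intro extensionalityI[of _ "carrier E"])
    then show ?thesis using bij s x unfolding bij_betw_def inj_on_def by blast
  qed
  show thesis
    by (rule that[of F n X Y], unfold_locales)
      (use hom F_hom X Y X_dual Y_dual in auto)
qed

section \<open>Dual pairs of bimodules\<close>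

text \<open>
  From here on, membership in a Hom module or endomorphism ring and the operations of the latter stay
  folded, so that the ring laws and closure rules apply to them.
\<close>

declare End_right_simps [simp del] Hom_right_simps(1) [simp del] Hom_left_simps(1) [simp del]

lemma finsum_induct:
  assumes G: "abelian_group G"
    and zero: "P \<zero>\<^bsub>G\<^esub>"
    and add: "\<And>x y. \<lbrakk>x \<in> carrier G; y \<in> carrier G; P x; P y\<rbrakk> \<Longrightarrow> P (x \<oplus>\<^bsub>G\<^esub> y)"
    and f: "\<And>i. i \<in> I \<Longrightarrow> f i \<in> carrier G" "\<And>i. i \<in> I \<Longrightarrow> P (f i)"
  shows "P (\<Oplus>\<^bsub>G\<^esub>i\<in>I. f i)"
proof -
  interpret G: abelian_group G by (rule G)
  show ?thesis using f
    by (induction I rule: infinite_finite_induct)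
      (auto simp: zero intro!: add G.finsum_closed)
qed

text \<open>
  A balanced pairing of \<open>Q\<close> with \<open>P\<close> that is bilinear over \<open>B\<close> and has dual bases. It abstracts both
  \<open>\<mu>\<close> and the evaluation of \<open>Hom(P\<^sub>B, B\<^sub>B)\<close> on \<open>P\<close>.
\<close>

locale dual_pair = P: bimodule A B P + Q: bimodule B A Q
  for A :: "'a ring" and B :: "'b ring"
    and P :: "('a, 'b, 'p) bimodule" and Q :: "('b, 'a, 'q) bimodule" +
  fixes pair :: "'q \<Rightarrow> 'p \<Rightarrow> 'b" and n :: nat and pj :: "nat \<Rightarrow> 'p" and qj :: "nat \<Rightarrow> 'q"
  assumes pair_balanced: "pair \<in> balanced_maps A Q P B"
    and pair_left: "\<lbrakk>b \<in> carrier B; q \<in> carrier Q; p \<in> carrier P\<rbrakk> \<Longrightarrow> pair (b \<odot>\<^bsub>Q\<^esub> q) p = b \<otimes>\<^bsub>B\<^esub> pair q p"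
    and pair_right: "\<lbrakk>b \<in> carrier B; q \<in> carrier Q; p \<in> carrier P\<rbrakk> \<Longrightarrow> pair q (p \<bullet>\<^bsub>P\<^esub> b) = pair q p \<otimes>\<^bsub>B\<^esub> b"
    and pj: "\<And>j. j < n \<Longrightarrow> pj j \<in> carrier P" and qj: "\<And>j. j < n \<Longrightarrow> qj j \<in> carrier Q"
    and dual_p: "\<And>p. p \<in> carrier P \<Longrightarrow> (\<Oplus>\<^bsub>P\<^esub>j\<in>{..<n}. pj j \<bullet>\<^bsub>P\<^esub> pair (qj j) p) = p"
    and dual_q: "\<And>q. q \<in> carrier Q \<Longrightarrow> (\<Oplus>\<^bsub>Q\<^esub>j\<in>{..<n}. pair q (pj j) \<odot>\<^bsub>Q\<^esub> qj j) = q"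
begin

sublocale PQ: tensor A B A P Q by unfold_locales
sublocale QP: tensor B A B Q P by unfold_locales

abbreviation "E \<equiv> End_right B P"
abbreviation "lam \<equiv> left_mult_map P"

sublocale E: ring E by (rule End_right_ring[OF P.bimodule_axioms])

lemmas pair_closed [simp] = balancedD(1)[OF pair_balanced]
lemmas pair_add_left = balancedD(2)[OF pair_balanced]
lemmas pair_add_right = balancedD(3)[OF pair_balanced]
lemmas pair_middle = balancedD(4)[OF pair_balanced]

lemmas [simp] = P.lsmult_closed P.rsmult_closed Q.lsmult_closed Q.rsmult_closed

lemma E_apply:
  assumes "f \<in> carrier E"
  shows "x \<in> carrier P \<Longrightarrow> f x \<in> carrier P"
    and "\<lbrakk>x \<in> carrier P; y \<in> carrier P\<rbrakk> \<Longrightarrow> f (x \<oplus>\<^bsub>P\<^esub> y) = f x \<oplus>\<^bsub>P\<^esub> f y"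
    and "\<lbrakk>x \<in> carrier P; b \<in> carrier B\<rbrakk> \<Longrightarrow> f (x \<bullet>\<^bsub>P\<^esub> b) = f x \<bullet>\<^bsub>P\<^esub> b"
    and "f \<in> additive_maps P P"
  using assms right_linearD[of f B P P] by (simp_all add: End_right_simps)

lemma E_eqI:
  assumes "f \<in> carrier E" "g \<in> carrier E" "\<And>x. x \<in> carrier P \<Longrightarrow> f x = g x"
  shows "f = g"
  using assms by (intro extensionalityI[of _ "carrier P"]) (simp_all add: End_right_simps)

lemma E_mult_apply [simp]: "x \<in> carrier P \<Longrightarrow> (f \<otimes>\<^bsub>E\<^esub> g) x = f (g x)"
  and E_add_apply [simp]: "x \<in> carrier P \<Longrightarrow> (f \<oplus>\<^bsub>E\<^esub> g) x = f x \<oplus>\<^bsub>P\<^esub> g x"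
  and E_one_apply [simp]: "x \<in> carrier P \<Longrightarrow> \<one>\<^bsub>E\<^esub> x = x"
  by (simp_all add: End_right_simps)

lemma eval_additive: "x \<in> carrier P \<Longrightarrow> (\<lambda>f. f x) \<in> additive_maps E P"
  by (rule additiveI) (simp_all add: E_apply)

lemma lam_hom: "lam \<in> ring_hom A E"
  by (rule left_mult_map_ring_hom[OF P.bimodule_axioms])

lemma lam_closed [simp]: "a \<in> carrier A \<Longrightarrow> lam a \<in> carrier E"
  by (rule ring_hom_closed[OF lam_hom])

lemma lam_apply [simp]: "x \<in> carrier P \<Longrightarrow> lam a x = a \<odot>\<^bsub>P\<^esub> x"
  by (simp add: left_mult_map_def)

text \<open>
  This is \<open>[p, q]\<close> in the comments.
\<close>

definition rank_one :: "'p \<Rightarrow> 'q \<Rightarrow> 'p \<Rightarrow> 'p" where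
  "rank_one p q = (\<lambda>x\<in>carrier P. p \<bullet>\<^bsub>P\<^esub> pair q x)"

lemma rank_one_apply [simp]: "x \<in> carrier P \<Longrightarrow> rank_one p q x = p \<bullet>\<^bsub>P\<^esub> pair q x"
  by (simp add: rank_one_def)

lemma rank_one_closed [simp]:
  assumes "p \<in> carrier P" "q \<in> carrier Q"
  shows "rank_one p q \<in> carrier E"
proof -
  have "(\<lambda>x. p \<bullet>\<^bsub>P\<^esub> pair q x) \<in> right_linear B P P"
    using assms by (intro right_linearI additiveI)
      (simp_all add: pair_add_right P.rsmult_r_distr pair_right P.rsmult_assoc)
  then show ?thesis
    using restrict_right_linear[OF P.bimodule_axioms] by (simp add: End_right_simps rank_one_def)
qed

lemma rank_one_balanced: "rank_one \<in> balanced_maps B P Q E"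
proof (rule balancedI)
  show "rank_one (x \<oplus>\<^bsub>P\<^esub> x') y = rank_one x y \<oplus>\<^bsub>E\<^esub> rank_one x' y" if "x \<in> carrier P" "x' \<in> carrier P" "y \<in> carrier Q" for x x' y
    using that by (intro E_eqI) (simp_all add: P.rsmult_l_distr)
  show "rank_one x (y \<oplus>\<^bsub>Q\<^esub> y') = rank_one x y \<oplus>\<^bsub>E\<^esub> rank_one x y'" if "x \<in> carrier P" "y \<in> carrier Q" "y' \<in> carrier Q" for x y y'
    using that by (intro E_eqI) (simp_all add: P.rsmult_r_distr pair_add_left)
  show "rank_one (x \<bullet>\<^bsub>P\<^esub> b) y = rank_one x (b \<odot>\<^bsub>Q\<^esub> y)" if "x \<in> carrier P" "b \<in> carrier B" "y \<in> carrier Q" for x b y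
    using that by (intro E_eqI) (simp_all add: P.rsmult_assoc pair_left)
qed simp

lemmas rank_one_add_left = balancedD(2)[OF rank_one_balanced]
lemmas rank_one_add_right = balancedD(3)[OF rank_one_balanced]
lemmas rank_one_middle = balancedD(4)[OF rank_one_balanced]

lemma rank_one_left_additive: "q \<in> carrier Q \<Longrightarrow> (\<lambda>p. rank_one p q) \<in> additive_maps P E"
  by (rule additiveI) (simp_all add: rank_one_add_left)

lemma rank_one_right_additive: "p \<in> carrier P \<Longrightarrow> (\<lambda>q. rank_one p q) \<in> additive_maps Q E"
  by (rule additiveI) (simp_all add: rank_one_add_right)

lemma E_mult_rank_one:
  assumes "f \<in> carrier E" "p \<in> carrier P" "q \<in> carrier Q"
  shows "f \<otimes>\<^bsub>E\<^esub> rank_one p q = rank_one (f p) q"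
  using assms by (intro E_eqI) (simp_all add: E_apply)

lemma rank_one_mult_rank_one:
  assumes "p \<in> carrier P" "q \<in> carrier Q" "p' \<in> carrier P" "q' \<in> carrier Q"
  shows "rank_one p q \<otimes>\<^bsub>E\<^esub> rank_one p' q' = rank_one (p \<bullet>\<^bsub>P\<^esub> pair q p') q'"
  using assms by (simp add: E_mult_rank_one)

lemma rank_one_mult_lam:
  assumes "a \<in> carrier A" "p \<in> carrier P" "q \<in> carrier Q"
  shows "rank_one p q \<otimes>\<^bsub>E\<^esub> lam a = rank_one p (q \<bullet>\<^bsub>Q\<^esub> a)"
  using assms by (intro E_eqI) (simp_all add: pair_middle)

text \<open>
  Apply \<open>f\<close> to the expansion of an element of \<open>P\<close> in the dual basis. Hence the maps \<open>rank_one p q\<close>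
  generate \<open>E\<close> additively, which is what makes \<open>E_induct\<close> below possible.
\<close>

lemma E_expansion:
  assumes f: "f \<in> carrier E"
  shows "(\<Oplus>\<^bsub>E\<^esub>j\<in>{..<n}. rank_one (f (pj j)) (qj j)) = f"
proof (rule E_eqI)
  have t: "rank_one (f (pj j)) (qj j) \<in> carrier E" if "j < n" for j
    using that f by (simp add: E_apply pj qj)
  show "(\<Oplus>\<^bsub>E\<^esub>j\<in>{..<n}. rank_one (f (pj j)) (qj j)) \<in> carrier E"
    by (rule E.finsum_closed) (use t in auto)
  fix x assume x: "x \<in> carrier P"
  have "(\<Oplus>\<^bsub>E\<^esub>j\<in>{..<n}. rank_one (f (pj j)) (qj j)) x = (\<Oplus>\<^bsub>P\<^esub>j\<in>{..<n}. rank_one (f (pj j)) (qj j) x)"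
    by (rule additive_finsum[OF E.abelian_group_axioms P.M.abelian_group_axioms eval_additive[OF x]])
      (use t in simp)
  also have "\<dots> = (\<Oplus>\<^bsub>P\<^esub>j\<in>{..<n}. f (pj j \<bullet>\<^bsub>P\<^esub> pair (qj j) x))"
    by (rule P.M.finsum_eq) (use x f in \<open>simp_all add: E_apply pj qj\<close>)
  also have "\<dots> = f (\<Oplus>\<^bsub>P\<^esub>j\<in>{..<n}. pj j \<bullet>\<^bsub>P\<^esub> pair (qj j) x)"
    by (rule additive_finsum[OF P.M.abelian_group_axioms P.M.abelian_group_axioms E_apply(4)[OF f], symmetric])
      (use x in \<open>simp add: pj qj\<close>)
  finally show "(\<Oplus>\<^bsub>E\<^esub>j\<in>{..<n}. rank_one (f (pj j)) (qj j)) x = f x" using dual_p[OF x] by simp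
qed (rule f)

lemma E_induct [consumes 1, case_names rank_one add]:
  assumes f: "f \<in> carrier E"
    and rank_one: "\<And>p q. \<lbrakk>p \<in> carrier P; q \<in> carrier Q\<rbrakk> \<Longrightarrow> R (rank_one p q)"
    and add: "\<And>f g. \<lbrakk>f \<in> carrier E; g \<in> carrier E; R f; R g\<rbrakk> \<Longrightarrow> R (f \<oplus>\<^bsub>E\<^esub> g)"
  shows "R f"
proof -
  have "rank_one \<zero>\<^bsub>P\<^esub> \<zero>\<^bsub>Q\<^esub> = \<zero>\<^bsub>E\<^esub>"
    using additive_zero[OF P.M.abelian_group_axioms E.abelian_group_axioms rank_one_left_additive] by simp
  then have zero: "R \<zero>\<^bsub>E\<^esub>" using rank_one[of "\<zero>\<^bsub>P\<^esub>" "\<zero>\<^bsub>Q\<^esub>"] by simp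
  have "R (\<Oplus>\<^bsub>E\<^esub>j\<in>{..<n}. rank_one (f (pj j)) (qj j))"
    by (rule finsum_induct[OF E.abelian_group_axioms, where P = R])
      (use f in \<open>simp_all add: zero add rank_one E_apply pj qj\<close>)
  then show ?thesis by (simp add: E_expansion[OF f])
qed

text \<open>
  Mutually inverse isomorphisms between \<open>E\<close> and \<open>P \<otimes>\<^sub>B Q\<close>; the first reads the expansion of \<open>f\<close> in
  rank-one maps as a tensor.
\<close>

definition \<alpha> :: "('p \<Rightarrow> 'p) \<Rightarrow> ('p, 'q) tensor" where
  "\<alpha> f = (\<Oplus>\<^bsub>PQ.T\<^esub>j\<in>{..<n}. PQ.pure (f (pj j)) (qj j))"

definition \<beta> :: "('p, 'q) tensor \<Rightarrow> ('p \<Rightarrow> 'p)" where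
  "\<beta> = tensor_lift E rank_one"

lemma \<beta>_additive: "\<beta> \<in> additive_maps PQ.T E"
  unfolding \<beta>_def by (rule PQ.tensor_lift_additive[OF E.abelian_group_axioms rank_one_balanced])

lemma \<beta>_pure [simp]: "\<lbrakk>p \<in> carrier P; q \<in> carrier Q\<rbrakk> \<Longrightarrow> \<beta> (PQ.pure p q) = rank_one p q"
  unfolding \<beta>_def by (rule PQ.tensor_lift_pure[OF E.abelian_group_axioms rank_one_balanced])

lemma \<alpha>_additive: "\<alpha> \<in> additive_maps E PQ.T"
proof (rule additiveI)
  show "\<alpha> f \<in> carrier PQ.T" if "f \<in> carrier E" for f
    unfolding \<alpha>_def by (rule PQ.T.finsum_closed) (use that in \<open>auto simp: E_apply pj qj\<close>)
  show "\<alpha> (f \<oplus>\<^bsub>E\<^esub> g) = \<alpha> f \<oplus>\<^bsub>PQ.T\<^esub> \<alpha> g" if "f \<in> carrier E" "g \<in> carrier E" for f g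
  proof -
    have "\<alpha> (f \<oplus>\<^bsub>E\<^esub> g) = (\<Oplus>\<^bsub>PQ.T\<^esub>j\<in>{..<n}. PQ.pure (f (pj j)) (qj j) \<oplus>\<^bsub>PQ.T\<^esub> PQ.pure (g (pj j)) (qj j))"
      unfolding \<alpha>_def by (rule PQ.T.finsum_eq) (use that in \<open>simp_all add: E_apply pj qj PQ.pure_add_left\<close>)
    also have "\<dots> = \<alpha> f \<oplus>\<^bsub>PQ.T\<^esub> \<alpha> g"
      unfolding \<alpha>_def by (rule PQ.T.finsum_add) (use that in \<open>simp_all add: E_apply pj qj\<close>)
    finally show ?thesis .
  qed
qed

lemmas \<alpha>_closed [simp] = additive_closed[OF \<alpha>_additive]
lemmas \<alpha>_add = additive_add[OF \<alpha>_additive]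
lemmas \<beta>_closed [simp] = additive_closed[OF \<beta>_additive]
lemmas \<beta>_add = additive_add[OF \<beta>_additive]

lemma \<alpha>_rank_one [simp]:
  assumes "p \<in> carrier P" "q \<in> carrier Q"
  shows "\<alpha> (rank_one p q) = PQ.pure p q"
proof -
  have "\<alpha> (rank_one p q) = (\<Oplus>\<^bsub>PQ.T\<^esub>j\<in>{..<n}. PQ.pure p (pair q (pj j) \<odot>\<^bsub>Q\<^esub> qj j))"
    unfolding \<alpha>_def
    by (rule PQ.T.finsum_eq) (use assms in \<open>simp_all add: pj qj PQ.pure_balanced\<close>)
  also have "\<dots> = PQ.pure p (\<Oplus>\<^bsub>Q\<^esub>j\<in>{..<n}. pair q (pj j) \<odot>\<^bsub>Q\<^esub> qj j)"
    by (rule additive_finsum[OF Q.M.abelian_group_axioms PQ.T.abelian_group_axioms, symmetric])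
      (use assms in \<open>auto intro!: additiveI simp: pj qj PQ.pure_add_right\<close>)
  finally show ?thesis using dual_q[OF assms(2)] by simp
qed

lemma \<beta>_\<alpha> [simp]: "f \<in> carrier E \<Longrightarrow> \<beta> (\<alpha> f) = f"
  by (induction f rule: E_induct) (simp_all add: \<alpha>_add \<beta>_add)

lemma \<alpha>_\<beta> [simp]: "X \<in> carrier PQ.T \<Longrightarrow> \<alpha> (\<beta> X) = X"
  by (induction X rule: PQ.tensor_induct) (simp_all add: \<alpha>_add \<beta>_add)

lemma \<alpha>_bij: "bij_betw \<alpha> (carrier E) (carrier PQ.T)"
  by (rule bij_betw_byWitness[where f' = \<beta>]) auto

lemma \<alpha>_left:
  assumes "a \<in> carrier A" "f \<in> carrier E"
  shows "\<alpha> (lam a \<otimes>\<^bsub>E\<^esub> f) = a \<odot>\<^bsub>PQ.T\<^esub> \<alpha> f"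
  using assms(2) by (induction f rule: E_induct)
    (simp_all add: assms(1) E_mult_rank_one E.r_distr \<alpha>_add)

lemma \<alpha>_right:
  assumes "a \<in> carrier A" "f \<in> carrier E"
  shows "\<alpha> (f \<otimes>\<^bsub>E\<^esub> lam a) = \<alpha> f \<bullet>\<^bsub>PQ.T\<^esub> a"
  using assms(2) by (induction f rule: E_induct)
    (simp_all add: assms(1) rank_one_mult_lam E.l_distr \<alpha>_add)

lemma \<beta>_left:
  assumes "a \<in> carrier A" "X \<in> carrier PQ.T"
  shows "\<beta> (a \<odot>\<^bsub>PQ.T\<^esub> X) = lam a \<otimes>\<^bsub>E\<^esub> \<beta> X"
  using \<alpha>_left[OF assms(1) \<beta>_closed[OF assms(2)]] assms by (metis E.m_closed \<alpha>_\<beta> \<beta>_\<alpha> \<beta>_closed lam_closed)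

lemma \<beta>_right:
  assumes "a \<in> carrier A" "X \<in> carrier PQ.T"
  shows "\<beta> (X \<bullet>\<^bsub>PQ.T\<^esub> a) = \<beta> X \<otimes>\<^bsub>E\<^esub> lam a"
  using \<alpha>_right[OF assms(1) \<beta>_closed[OF assms(2)]] assms by (metis E.m_closed \<alpha>_\<beta> \<beta>_\<alpha> \<beta>_closed lam_closed)

text \<open>
  The functionals \<open>pair q\<^sub>j\<close> are the coordinates with respect to the \<open>p\<^sub>j\<close>, so every functional on \<open>P\<^sub>B\<close>
  is a left combination of them.
\<close>

theorem Q_iso_Hom: 
  "\<exists>f \<in> bimodule_hom B A Q (Hom_right B P (regular_bimodule B)).
     bij_betw f (carrier Q) (carrier (Hom_right B P (regular_bimodule B)))"
proof -
  let ?B = "regular_bimodule B" and ?H = "Hom_right B P (regular_bimodule B)"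
  define f where "f q = (\<lambda>p\<in>carrier P. pair q p)" for q
  define g where "g h = (\<Oplus>\<^bsub>Q\<^esub>j\<in>{..<n}. h (pj j) \<odot>\<^bsub>Q\<^esub> qj j)" for h
  have f_closed: "f q \<in> carrier ?H" if q: "q \<in> carrier Q" for q
  proof -
    have "pair q \<in> right_linear B P ?B"
      using q by (intro right_linearI additiveI) (simp_all add: pair_add_right pair_right)
    then show ?thesis
      using restrict_right_linear[OF P.bimodule_axioms] by (simp add: Hom_right_simps f_def)
  qed
  have f_hom: "f \<in> bimodule_hom B A Q ?H"
    using f_closed by (intro bimodule_homI additiveI) (auto simp: f_def pair_add_left pair_left pair_middle)
  have gf: "g (f q) = q" if q: "q \<in> carrier Q" for q
  proof -
    have "g (f q) = (\<Oplus>\<^bsub>Q\<^esub>j\<in>{..<n}. pair q (pj j) \<odot>\<^bsub>Q\<^esub> qj j)"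
      unfolding g_def f_def by (rule Q.M.finsum_eq) (use q in \<open>simp_all add: pj qj\<close>)
    then show ?thesis using dual_q[OF q] by simp
  qed
  have h_closed: "h x \<in> carrier B" if "h \<in> carrier ?H" "x \<in> carrier P" for h x
    using right_linearD(3)[of h B P ?B] that by (simp add: Hom_right_simps)
  have h_right: "h (x \<bullet>\<^bsub>P\<^esub> b) = h x \<otimes>\<^bsub>B\<^esub> b"
    if "h \<in> carrier ?H" "x \<in> carrier P" "b \<in> carrier B" for h x b
    using right_linearD(2)[of h B P ?B] that by (simp add: Hom_right_simps)
  have h_additive: "h \<in> additive_maps P B" if "h \<in> carrier ?H" for h
    using right_linearD(1)[of h B P ?B] that by (simp add: Hom_right_simps)
  have g_closed: "g h \<in> carrier Q" if "h \<in> carrier ?H" for h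
    unfolding g_def by (rule Q.M.finsum_closed) (use h_closed[OF that] in \<open>auto simp: pj qj\<close>)
  have fg: "f (g h) = h" if h: "h \<in> carrier ?H" for h
  proof (rule extensionalityI[of _ "carrier P"])
    show "f (g h) \<in> extensional (carrier P)" by (simp add: f_def)
    show "h \<in> extensional (carrier P)" using h by (simp add: Hom_right_simps)
    fix x assume x: "x \<in> carrier P"
    have hp: "h (pj j) \<in> carrier B" if "j < n" for j by (rule h_closed[OF h pj[OF that]])
    have "f (g h) x = pair (g h) x" using x by (simp add: f_def)
    also have "\<dots> = (\<Oplus>\<^bsub>B\<^esub>j\<in>{..<n}. pair (h (pj j) \<odot>\<^bsub>Q\<^esub> qj j) x)"
      unfolding g_def
      by (rule additive_finsum[OF Q.M.abelian_group_axioms P.S.abelian_group_axioms])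
        (use x hp in \<open>auto intro!: additiveI simp: pair_add_left qj\<close>)
    also have "\<dots> = (\<Oplus>\<^bsub>B\<^esub>j\<in>{..<n}. h (pj j \<bullet>\<^bsub>P\<^esub> pair (qj j) x))"
      by (rule P.S.finsum_eq) (use x hp h_right[OF h] in \<open>simp_all add: pair_left pj qj\<close>)
    also have "\<dots> = h (\<Oplus>\<^bsub>P\<^esub>j\<in>{..<n}. pj j \<bullet>\<^bsub>P\<^esub> pair (qj j) x)"
      by (rule additive_finsum[OF P.M.abelian_group_axioms P.S.abelian_group_axioms, symmetric])
        (use x h_additive[OF h] in \<open>auto simp: pj qj\<close>)
    finally show "f (g h) x = h x" using dual_p[OF x] by simp
  qed
  have "bij_betw f (carrier Q) (carrier ?H)"
    by (rule bij_betw_byWitness[where f' = g]) (use f_closed g_closed fg gf in auto)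
  then show ?thesis using f_hom by blast
qed

section \<open>The multiplication on the tensor product\<close>

definition mu_mult :: "('p, 'q) tensor \<Rightarrow> ('p, 'q) tensor \<Rightarrow> ('p, 'q) tensor" where
  "mu_mult X Y = tensor_lift PQ.T (\<lambda>p q. tensor_lift PQ.T (\<lambda>p' q'. PQ.pure (p \<bullet>\<^bsub>P\<^esub> pair q p') q') Y) X"

lemma inner_mult:
  assumes pq: "p \<in> carrier P" "q \<in> carrier Q" and Y: "Y \<in> carrier PQ.T"
  shows "tensor_lift PQ.T (\<lambda>p' q'. PQ.pure (p \<bullet>\<^bsub>P\<^esub> pair q p') q') Y = \<alpha> (rank_one p q \<otimes>\<^bsub>E\<^esub> \<beta> Y)"
proof -
  have bal: "(\<lambda>p' q'. PQ.pure (p \<bullet>\<^bsub>P\<^esub> pair q p') q') \<in> balanced_maps B P Q PQ.T"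
    by (rule balancedI) (use pq in \<open>simp_all add: pair_add_right P.rsmult_r_distr PQ.pure_add_left
        PQ.pure_add_right pair_right P.rsmult_assoc PQ.pure_balanced\<close>)
  show ?thesis using Y
    by (induction Y rule: PQ.tensor_induct)
      (simp_all add: PQ.tensor_lift_pure[OF PQ.T.abelian_group_axioms bal]
        additive_add[OF PQ.tensor_lift_additive[OF PQ.T.abelian_group_axioms bal]]
        pq rank_one_mult_rank_one \<alpha>_add \<beta>_add E.r_distr)
qed

text \<open>
  The \<open>\<mu>\<close>-multiplication is composition transported along \<open>E \<cong> P \<otimes>\<^sub>B Q\<close>, so all ring laws for it come
  from \<open>E\<close>.
\<close>

lemma mu_mult_eq:
  assumes X: "X \<in> carrier PQ.T" and Y: "Y \<in> carrier PQ.T"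
  shows "mu_mult X Y = \<alpha> (\<beta> X \<otimes>\<^bsub>E\<^esub> \<beta> Y)"
proof -
  let ?f = "\<lambda>p q. tensor_lift PQ.T (\<lambda>p' q'. PQ.pure (p \<bullet>\<^bsub>P\<^esub> pair q p') q') Y"
  have bal: "?f \<in> balanced_maps B P Q PQ.T"
    by (rule balancedI)
      (use Y in \<open>simp_all add: inner_mult rank_one_add_left rank_one_add_right rank_one_middle E.l_distr \<alpha>_add\<close>)
  show ?thesis unfolding mu_mult_def using X
    by (induction X rule: PQ.tensor_induct)
      (use Y in \<open>simp_all add: PQ.tensor_lift_pure[OF PQ.T.abelian_group_axioms bal]
        additive_add[OF PQ.tensor_lift_additive[OF PQ.T.abelian_group_axioms bal]]
        inner_mult \<alpha>_add \<beta>_add E.l_distr\<close>)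
qed

theorem End_iso_mu_ring:
  fixes \<mu>
  assumes \<mu>: "pair = (\<lambda>q p. \<mu> (QP.pure q p))"
  defines "R \<equiv> mu_ring A B P Q \<mu> (\<Oplus>\<^bsub>tensor_group B P Q\<^esub>j\<in>{..<n}. PQ.pure (pj j) (qj j))"
  shows "\<alpha> \<in> ring_iso E R" and "ring R"
proof -
  have one: "\<one>\<^bsub>R\<^esub> = \<alpha> \<one>\<^bsub>E\<^esub>"
  proof -
    have "\<one>\<^bsub>R\<^esub> = (\<Oplus>\<^bsub>PQ.T\<^esub>j\<in>{..<n}. PQ.pure (pj j) (qj j))"
      by (simp add: R_def mu_ring_def Let_def tensor_product_group_simps)
    also have "\<dots> = \<alpha> \<one>\<^bsub>E\<^esub>"
      unfolding \<alpha>_def by (rule PQ.T.finsum_eq) (simp_all add: pj qj)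
    finally show ?thesis .
  qed
  have carr: "carrier R = carrier PQ.T" and zero: "\<zero>\<^bsub>R\<^esub> = \<zero>\<^bsub>PQ.T\<^esub>" and add: "add R = add PQ.T"
    by (simp_all add: R_def mu_ring_def Let_def tensor_product_group_simps)
  have mult: "X \<otimes>\<^bsub>R\<^esub> Y = mu_mult X Y" if "X \<in> carrier PQ.T" "Y \<in> carrier PQ.T" for X Y
  proof -
    have "\<mu> (QP.pure q p) = pair q p" for q p by (simp add: \<mu>)
    then show ?thesis
      by (simp add: R_def mu_ring_def Let_def mu_mult_def tensor_lift_tensor_group)
  qed
  have "\<alpha> \<in> ring_hom E R"
    by (rule ring_hom_memI) (simp_all add: carr add mult mu_mult_eq \<alpha>_add one)
  then show iso: "\<alpha> \<in> ring_iso E R"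
    using \<alpha>_bij by (simp add: ring_iso_def carr)
  have "\<alpha> \<zero>\<^bsub>E\<^esub> = \<zero>\<^bsub>R\<^esub>"
    using additive_zero[OF E.abelian_group_axioms PQ.T.abelian_group_axioms \<alpha>_additive] zero by simp
  then show "ring R"
    using E.ring_iso_imp_img_ring[OF iso] by simp
qed

end

section \<open>Separable extensions\<close>

locale ring_extension = A: ring A + E: ring E for A :: "'a ring" and E :: "'e ring" +
  fixes \<phi> :: "'a \<Rightarrow> 'e"
  assumes hom: "\<phi> \<in> ring_hom A E"
begin

lemmas hom_closed [simp] = ring_hom_closed[OF hom]

sublocale EE: tensor E A E "ring_bimodule E (\<lambda>x. x) \<phi>" "ring_bimodule E \<phi> (\<lambda>x. x)"
  by (intro tensor.intro ring_bimodule_bimodule E.ring_axioms A.ring_axioms hom) (simp_all add: ring_hom_def)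

definition mult :: "('e, 'e) tensor \<Rightarrow> 'e" where
  "mult = tensor_lift E (\<lambda>x y. x \<otimes>\<^bsub>E\<^esub> y)"

lemma mult_balanced:
  "(\<lambda>x y. x \<otimes>\<^bsub>E\<^esub> y) \<in> balanced_maps A (ring_bimodule E (\<lambda>x. x) \<phi>) (ring_bimodule E \<phi> (\<lambda>x. x)) E"
  by (rule balancedI) (simp_all add: E.l_distr E.r_distr E.m_assoc)

lemma mult_additive: "mult \<in> additive_maps EE.T E"
  unfolding mult_def by (rule EE.tensor_lift_additive[OF E.abelian_group_axioms mult_balanced])

lemma mult_pure [simp]: "\<lbrakk>x \<in> carrier E; y \<in> carrier E\<rbrakk> \<Longrightarrow> mult (EE.pure x y) = x \<otimes>\<^bsub>E\<^esub> y"
  unfolding mult_def using EE.tensor_lift_pure[OF E.abelian_group_axioms mult_balanced] by simp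

lemma mult_bimodule_hom: "mult \<in> bimodule_hom E E EE.T (regular_bimodule E)"
proof (rule bimodule_homI)
  show "mult \<in> additive_maps EE.T (regular_bimodule E)" using mult_additive by simp
  note add = additive_add[OF mult_additive] additive_closed[OF mult_additive]
  show "mult (x \<odot>\<^bsub>EE.T\<^esub> X) = x \<odot>\<^bsub>regular_bimodule E\<^esub> mult X" if "x \<in> carrier E" "X \<in> carrier EE.T" for x X
    using that(2) by (induction X rule: EE.tensor_induct) (simp_all add: that(1) add E.m_assoc E.r_distr)
  show "mult (X \<bullet>\<^bsub>EE.T\<^esub> x) = mult X \<bullet>\<^bsub>regular_bimodule E\<^esub> x" if "x \<in> carrier E" "X \<in> carrier EE.T" for x X
    using that(2) by (induction X rule: EE.tensor_induct) (simp_all add: that(1) add E.m_assoc E.l_distr)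
qed

text \<open>
  This is the splitting criterion for epimorphisms onto a ring, applied to multiplication; \<open>e\<close> is what
  is classically called a separability element.
\<close>

theorem separable_extension_iff:
  "separable_extension A E \<phi> \<longleftrightarrow>
     (\<exists>e\<in>carrier EE.T. mult e = \<one>\<^bsub>E\<^esub> \<and> (\<forall>x\<in>carrier E. x \<odot>\<^bsub>EE.T\<^esub> e = e \<bullet>\<^bsub>EE.T\<^esub> x))"
  unfolding separable_extension_def mult_def[symmetric] split_epi_regular_iff[OF EE.bimodule_T]
  using mult_bimodule_hom ring_hom_ringI2[OF A.ring_axioms E.ring_axioms hom] by blast

end

text \<open>
  For a Frobenius bimodule the span is \<open>Hom(P\<^sub>B, B\<^sub>B) \<leftarrow> Q \<rightarrow> Hom(\<^sub>AP, \<^sub>AA)\<close>.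
\<close>

lemma bimodule_isomorphic_span:
  assumes f: "f \<in> bimodule_hom A B M N" "bij_betw f (carrier M) (carrier N)"
    and g: "g \<in> bimodule_hom A B M L" "bij_betw g (carrier M) (carrier L)"
    and M: "bimodule A B M"
  shows "bimodule_isomorphic A B N L"
proof -
  interpret M: bimodule A B M by (rule M)
  define h where "h = inv_into (carrier M) f"
  have h: "h y \<in> carrier M" "f (h y) = y" if "y \<in> carrier N" for y
    using f(2) that by (auto simp: h_def bij_betw_def inv_into_into f_inv_into_f)
  have h_eq: "h y = x" if "x \<in> carrier M" "f x = y" for x y
    using f(2) that by (auto simp: h_def bij_betw_def)
  note [simp] = bimodule_homD(2-)[OF f(1)] bimodule_homD(2-)[OF g(1)]
  have "(\<lambda>y. g (h y)) \<in> bimodule_hom A B N L"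
  proof (intro bimodule_homI additiveI)
    show "g (h (x \<oplus>\<^bsub>N\<^esub> y)) = g (h x) \<oplus>\<^bsub>L\<^esub> g (h y)" if "x \<in> carrier N" "y \<in> carrier N" for x y
      using h_eq[of "h x \<oplus>\<^bsub>M\<^esub> h y" "x \<oplus>\<^bsub>N\<^esub> y"] h that by simp
    show "g (h (a \<odot>\<^bsub>N\<^esub> x)) = a \<odot>\<^bsub>L\<^esub> g (h x)" if "a \<in> carrier A" "x \<in> carrier N" for a x
      using h_eq[of "a \<odot>\<^bsub>M\<^esub> h x" "a \<odot>\<^bsub>N\<^esub> x"] h that by (simp add: M.lsmult_closed)
    show "g (h (x \<bullet>\<^bsub>N\<^esub> b)) = g (h x) \<bullet>\<^bsub>L\<^esub> b" if "b \<in> carrier B" "x \<in> carrier N" for b x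
      using h_eq[of "h x \<bullet>\<^bsub>M\<^esub> b" "x \<bullet>\<^bsub>N\<^esub> b"] h that by (simp add: M.rsmult_closed)
  qed (use h in simp)
  moreover have "bij_betw (\<lambda>y. g (h y)) (carrier N) (carrier L)"
    using bij_betw_trans[OF bij_betw_inv_into[OF f(2)] g(2)] by (simp add: h_def comp_def)
  ultimately show ?thesis unfolding bimodule_isomorphic_def by blast
qed

section \<open>From a symmetric separable equivalence to the endomorphism ring\<close>

context dual_pair
begin

sublocale ext: ring_extension A E lam
  by unfold_locales (rule lam_hom)

lemma lam_mult_rank_one:
  "\<lbrakk>a \<in> carrier A; p \<in> carrier P; q \<in> carrier Q\<rbrakk> \<Longrightarrow> lam a \<otimes>\<^bsub>E\<^esub> rank_one p q = rank_one (a \<odot>\<^bsub>P\<^esub> p) q"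
  by (simp add: E_mult_rank_one)

text \<open>
  Writing \<open>w = \<Sum> y \<otimes> x\<close>, put \<open>D(p, q) = \<Sum> [p, y] \<otimes> [x, q]\<close>. Centrality of \<open>w\<close> says that \<open>D\<close> is
  balanced over \<open>B\<close>, so \<open>D\<close> factors through \<open>P \<otimes>\<^sub>B Q \<cong> E\<close> and yields an \<open>E\<close>-\<open>E\<close>-bilinear map
  \<open>G : E \<rightarrow> E \<otimes>\<^sub>A E\<close>. Since multiplication sends \<open>D(p, q)\<close> to \<open>[p \<mu>(w), q] = [p, q]\<close>, the map \<open>G\<close> is a
  section of it, and \<open>G(1)\<close> is the separability element.
\<close>

theorem separable_if_split:
  assumes \<mu>: "\<mu> \<in> additive_maps QP.T B"
    and \<mu>_pure: "\<And>q p. \<lbrakk>q \<in> carrier Q; p \<in> carrier P\<rbrakk> \<Longrightarrow> \<mu> (QP.pure q p) = pair q p"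
    and w: "w \<in> carrier QP.T" and \<mu>w: "\<mu> w = \<one>\<^bsub>B\<^esub>"
    and central: "\<And>b. b \<in> carrier B \<Longrightarrow> b \<odot>\<^bsub>QP.T\<^esub> w = w \<bullet>\<^bsub>QP.T\<^esub> b"
  shows "separable_extension A E lam"
proof -
  let ?T = "ext.EE.T"
  define L where "L p q = tensor_lift ?T (\<lambda>y x. ext.EE.pure (rank_one p y) (rank_one x q))" for p q
  have bal: "(\<lambda>y x. ext.EE.pure (rank_one p y) (rank_one x q)) \<in> balanced_maps A Q P ?T"
    if "p \<in> carrier P" "q \<in> carrier Q" for p q
  proof (rule balancedI)
    fix y a x assume *: "y \<in> carrier Q" "a \<in> carrier A" "x \<in> carrier P"
    have "ext.EE.pure (rank_one p y \<otimes>\<^bsub>E\<^esub> lam a) (rank_one x q) = ext.EE.pure (rank_one p y) (lam a \<otimes>\<^bsub>E\<^esub> rank_one x q)"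
      using ext.EE.pure_balanced[of "rank_one p y" a "rank_one x q"] * that by simp
    then show "ext.EE.pure (rank_one p (y \<bullet>\<^bsub>Q\<^esub> a)) (rank_one x q) = ext.EE.pure (rank_one p y) (rank_one (a \<odot>\<^bsub>P\<^esub> x) q)"
      using * that by (simp add: rank_one_mult_lam lam_mult_rank_one)
  next
    show "ext.EE.pure (rank_one p (y \<oplus>\<^bsub>Q\<^esub> y')) (rank_one x q) = ext.EE.pure (rank_one p y) (rank_one x q) \<oplus>\<^bsub>?T\<^esub> ext.EE.pure (rank_one p y') (rank_one x q)"
      if "y \<in> carrier Q" "y' \<in> carrier Q" "x \<in> carrier P" for y y' x
      using ext.EE.pure_add_left[of "rank_one p y" "rank_one p y'" "rank_one x q"] that \<open>p \<in> carrier P\<close> \<open>q \<in> carrier Q\<close>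
      by (simp add: rank_one_add_right)
    show "ext.EE.pure (rank_one p y) (rank_one (x \<oplus>\<^bsub>P\<^esub> x') q) = ext.EE.pure (rank_one p y) (rank_one x q) \<oplus>\<^bsub>?T\<^esub> ext.EE.pure (rank_one p y) (rank_one x' q)"
      if "y \<in> carrier Q" "x \<in> carrier P" "x' \<in> carrier P" for y x x'
      using ext.EE.pure_add_right[of "rank_one p y" "rank_one x q" "rank_one x' q"] that \<open>p \<in> carrier P\<close> \<open>q \<in> carrier Q\<close>
      by (simp add: rank_one_add_left)
  qed (use that in simp)
  have L_additive: "L p q \<in> additive_maps QP.T ?T" if "p \<in> carrier P" "q \<in> carrier Q" for p q
    unfolding L_def by (rule QP.tensor_lift_additive[OF ext.EE.T.abelian_group_axioms bal[OF that]])
  have L_pure: "L p q (QP.pure y x) = ext.EE.pure (rank_one p y) (rank_one x q)"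
    if "p \<in> carrier P" "q \<in> carrier Q" "y \<in> carrier Q" "x \<in> carrier P" for p q y x
    unfolding L_def by (rule QP.tensor_lift_pure[OF ext.EE.T.abelian_group_axioms bal[OF that(1,2)] that(3,4)])
  have L_closed: "L p q W \<in> carrier ?T" if "p \<in> carrier P" "q \<in> carrier Q" "W \<in> carrier QP.T" for p q W
    by (rule additive_closed[OF L_additive[OF that(1,2)] that(3)])
  have L_add: "L p q (W \<oplus>\<^bsub>QP.T\<^esub> W') = L p q W \<oplus>\<^bsub>?T\<^esub> L p q W'"
    if "p \<in> carrier P" "q \<in> carrier Q" "W \<in> carrier QP.T" "W' \<in> carrier QP.T" for p q W W'
    by (rule additive_add[OF L_additive[OF that(1,2)] that(3,4)])
  note [simp] = L_pure L_closed L_add additive_closed[OF \<mu>] additive_add[OF \<mu>] \<mu>_pure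
  have L_left_add: "L (p \<oplus>\<^bsub>P\<^esub> p') q W = L p q W \<oplus>\<^bsub>?T\<^esub> L p' q W"
    if "p \<in> carrier P" "p' \<in> carrier P" "q \<in> carrier Q" "W \<in> carrier QP.T" for p p' q W
    using that(4) by (induction W rule: QP.tensor_induct)
      (use that(1-3) ext.EE.pure_add_left in \<open>simp_all add: rank_one_add_left ext.EE.T.a_ac\<close>)
  have L_right_add: "L p (q \<oplus>\<^bsub>Q\<^esub> q') W = L p q W \<oplus>\<^bsub>?T\<^esub> L p q' W"
    if "p \<in> carrier P" "q \<in> carrier Q" "q' \<in> carrier Q" "W \<in> carrier QP.T" for p q q' W
    using that(4) by (induction W rule: QP.tensor_induct)
      (use that(1-3) ext.EE.pure_add_right in \<open>simp_all add: rank_one_add_right ext.EE.T.a_ac\<close>)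
  have L_left_b: "L (p \<bullet>\<^bsub>P\<^esub> b) q W = L p q (b \<odot>\<^bsub>QP.T\<^esub> W)"
    if "p \<in> carrier P" "q \<in> carrier Q" "b \<in> carrier B" "W \<in> carrier QP.T" for p q b W
    using that(4) by (induction W rule: QP.tensor_induct) (use that(1-3) in \<open>simp_all add: rank_one_middle\<close>)
  have L_right_b: "L p (b \<odot>\<^bsub>Q\<^esub> q) W = L p q (W \<bullet>\<^bsub>QP.T\<^esub> b)"
    if "p \<in> carrier P" "q \<in> carrier Q" "b \<in> carrier B" "W \<in> carrier QP.T" for p q b W
    using that(4) by (induction W rule: QP.tensor_induct) (use that(1-3) in \<open>simp_all add: rank_one_middle\<close>)
  have L_mult: "ext.mult (L p q W) = rank_one (p \<bullet>\<^bsub>P\<^esub> \<mu> W) q"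
    if "p \<in> carrier P" "q \<in> carrier Q" "W \<in> carrier QP.T" for p q W
    using that(3) by (induction W rule: QP.tensor_induct)
      (use that(1-2) in \<open>simp_all add: rank_one_mult_rank_one P.rsmult_r_distr rank_one_add_left additive_add[OF ext.mult_additive]\<close>)
  have L_E_left: "f \<odot>\<^bsub>?T\<^esub> L p q W = L (f p) q W"
    if "f \<in> carrier E" "p \<in> carrier P" "q \<in> carrier Q" "W \<in> carrier QP.T" for f p q W
    using that(4) by (induction W rule: QP.tensor_induct) (use that(1-3) in \<open>simp_all add: E_mult_rank_one E_apply\<close>)
  have L_rank_one_right: "L p q W \<bullet>\<^bsub>?T\<^esub> rank_one p' q' = L p (pair q p' \<odot>\<^bsub>Q\<^esub> q') W"
    if "p \<in> carrier P" "q \<in> carrier Q" "p' \<in> carrier P" "q' \<in> carrier Q" "W \<in> carrier QP.T" for p q p' q' W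
    using that(5) by (induction W rule: QP.tensor_induct)
      (use that(1-4) in \<open>simp_all add: rank_one_mult_rank_one rank_one_middle\<close>)
  define D where "D p q = L p q w" for p q
  have D_bal: "D \<in> balanced_maps B P Q ?T"
    by (rule balancedI)
      (use w central in \<open>simp_all add: D_def L_left_add L_right_add L_left_b L_right_b\<close>)
  define G where "G f = tensor_lift ?T D (\<alpha> f)" for f
  have G_additive: "G \<in> additive_maps E ?T"
    unfolding G_def
    by (rule additive_comp[OF \<alpha>_additive PQ.tensor_lift_additive[OF ext.EE.T.abelian_group_axioms D_bal]])
  have G_rank_one: "G (rank_one p q) = D p q" if "p \<in> carrier P" "q \<in> carrier Q" for p q
    using PQ.tensor_lift_pure[OF ext.EE.T.abelian_group_axioms D_bal] that by (simp add: G_def)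
  note [simp] = additive_closed[OF G_additive] additive_add[OF G_additive]
  have mult_G: "ext.mult (G f) = f" if "f \<in> carrier E" for f
    using that by (induction f rule: E_induct)
      (use w \<mu>w in \<open>simp_all add: G_rank_one D_def L_mult P.rsmult_one additive_add[OF ext.mult_additive]\<close>)
  have left_G: "f \<odot>\<^bsub>?T\<^esub> G g = G (f \<otimes>\<^bsub>E\<^esub> g)" if f: "f \<in> carrier E" and "g \<in> carrier E" for f g
    using that(2) by (induction g rule: E_induct)
      (use w f in \<open>simp_all add: G_rank_one D_def L_E_left E_mult_rank_one E_apply E.r_distr\<close>)
  have G_rank_one_right: "G g \<bullet>\<^bsub>?T\<^esub> rank_one p q = G (g \<otimes>\<^bsub>E\<^esub> rank_one p q)"
    if "p \<in> carrier P" "q \<in> carrier Q" "g \<in> carrier E" for g p q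
    using that(3) by (induction g rule: E_induct)
      (use w that(1,2) in \<open>simp_all add: G_rank_one D_def L_rank_one_right rank_one_mult_rank_one rank_one_middle E.l_distr\<close>)
  interpret TE: bimodule E E ?T by (rule ext.EE.bimodule_T)
  have right_G: "G g \<bullet>\<^bsub>?T\<^esub> f = G (g \<otimes>\<^bsub>E\<^esub> f)" if g: "g \<in> carrier E" and "f \<in> carrier E" for f g
    using that(2) by (induction f rule: E_induct)
      (use g in \<open>simp_all add: G_rank_one_right TE.rsmult_r_distr E.r_distr\<close>)
  show ?thesis
    unfolding ext.separable_extension_iff
    by (rule bexI[of _ "G \<one>\<^bsub>E\<^esub>"]) (simp_all add: mult_G left_G right_G)
qed

end

context sym_sep_context
begin

sublocale PQ: tensor A B A P Q by unfold_locales
sublocale QP: tensor B A B Q P by unfold_locales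

lemma nu_hom: "\<nu> \<in> bimodule_hom A A PQ.T (regular_bimodule A)"
  and mu_hom: "\<mu> \<in> bimodule_hom B B QP.T (regular_bimodule B)"
  using nu_split_epi mu_split_epi by (simp_all add: bimodule_split_epi_def)

lemma nu_additive: "\<nu> \<in> additive_maps PQ.T A"
  and mu_additive: "\<mu> \<in> additive_maps QP.T B"
  using bimodule_homD(1)[OF nu_hom] bimodule_homD(1)[OF mu_hom] by simp_all

lemmas nu_closed [simp] = additive_closed[OF nu_additive]
lemmas mu_closed [simp] = additive_closed[OF mu_additive]
lemmas nu_add = additive_add[OF nu_additive]
lemmas mu_add = additive_add[OF mu_additive]

lemma nu_left: "\<lbrakk>a \<in> carrier A; X \<in> carrier PQ.T\<rbrakk> \<Longrightarrow> \<nu> (a \<odot>\<^bsub>PQ.T\<^esub> X) = a \<otimes>\<^bsub>A\<^esub> \<nu> X"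
  and nu_right: "\<lbrakk>a \<in> carrier A; X \<in> carrier PQ.T\<rbrakk> \<Longrightarrow> \<nu> (X \<bullet>\<^bsub>PQ.T\<^esub> a) = \<nu> X \<otimes>\<^bsub>A\<^esub> a"
  using bimodule_homD(2,3)[OF nu_hom] by simp_all

lemma mu_left: "\<lbrakk>b \<in> carrier B; X \<in> carrier QP.T\<rbrakk> \<Longrightarrow> \<mu> (b \<odot>\<^bsub>QP.T\<^esub> X) = b \<otimes>\<^bsub>B\<^esub> \<mu> X"
  and mu_right: "\<lbrakk>b \<in> carrier B; X \<in> carrier QP.T\<rbrakk> \<Longrightarrow> \<mu> (X \<bullet>\<^bsub>QP.T\<^esub> b) = \<mu> X \<otimes>\<^bsub>B\<^esub> b"
  using bimodule_homD(2,3)[OF mu_hom] by simp_all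

sublocale dual_pair A B P Q "\<lambda>q p. \<mu> (QP.pure q p)" n pj qj
proof unfold_locales
  show "(\<lambda>q p. \<mu> (QP.pure q p)) \<in> balanced_maps A Q P B"
    by (rule balancedI) (simp_all add: QP.pure_add_left QP.pure_add_right QP.pure_balanced mu_add)
  show "\<mu> (QP.pure (b \<odot>\<^bsub>Q\<^esub> q) p) = b \<otimes>\<^bsub>B\<^esub> \<mu> (QP.pure q p)"
    if "b \<in> carrier B" "q \<in> carrier Q" "p \<in> carrier P" for b q p
    using mu_left[of b "QP.pure q p"] that by simp
  show "\<mu> (QP.pure q (p \<bullet>\<^bsub>P\<^esub> b)) = \<mu> (QP.pure q p) \<otimes>\<^bsub>B\<^esub> b"
    if "b \<in> carrier B" "q \<in> carrier Q" "p \<in> carrier P" for b q p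
    using mu_right[of b "QP.pure q p"] that by simp
qed (use second_family mu_p mu_q in simp_all)

abbreviation nv :: "'p \<Rightarrow> 'q \<Rightarrow> 'a" where "nv p q \<equiv> \<nu> (PQ.pure p q)"

lemma nv_left: "\<lbrakk>a \<in> carrier A; p \<in> carrier P; q \<in> carrier Q\<rbrakk> \<Longrightarrow> nv (a \<odot>\<^bsub>P\<^esub> p) q = a \<otimes>\<^bsub>A\<^esub> nv p q"
  using nu_left[of a "PQ.pure p q"] by simp

lemma nv_right: "\<lbrakk>a \<in> carrier A; p \<in> carrier P; q \<in> carrier Q\<rbrakk> \<Longrightarrow> nv p (q \<bullet>\<^bsub>Q\<^esub> a) = nv p q \<otimes>\<^bsub>A\<^esub> a"
  using nu_right[of a "PQ.pure p q"] by simp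

lemma nu_central:
  obtains z where "z \<in> carrier PQ.T" "\<nu> z = \<one>\<^bsub>A\<^esub>"
    "\<And>a. a \<in> carrier A \<Longrightarrow> a \<odot>\<^bsub>PQ.T\<^esub> z = z \<bullet>\<^bsub>PQ.T\<^esub> a"
  using nu_split_epi unfolding split_epi_regular_iff[OF PQ.bimodule_T] by blast

lemma mu_central:
  obtains w where "w \<in> carrier QP.T" "\<mu> w = \<one>\<^bsub>B\<^esub>"
    "\<And>b. b \<in> carrier B \<Longrightarrow> b \<odot>\<^bsub>QP.T\<^esub> w = w \<bullet>\<^bsub>QP.T\<^esub> b"
  using mu_split_epi unfolding split_epi_regular_iff[OF QP.bimodule_T] by blast

abbreviation "H \<equiv> Hom_left A P (regular_bimodule A)"

lemma H_bimodule: "bimodule B A H"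
  by (rule Hom_left_bimodule[OF P.bimodule_axioms regular_bimodule_bimodule[OF P.R.ring_axioms]])

definition \<psi> :: "'q \<Rightarrow> 'p \<Rightarrow> 'a" where
  "\<psi> q = (\<lambda>p\<in>carrier P. nv p q)"

lemma H_prop:
  assumes "h \<in> carrier H"
  shows "x \<in> carrier P \<Longrightarrow> h x \<in> carrier A"
    and "\<lbrakk>x \<in> carrier P; a \<in> carrier A\<rbrakk> \<Longrightarrow> h (a \<odot>\<^bsub>P\<^esub> x) = a \<otimes>\<^bsub>A\<^esub> h x"
    and "h \<in> additive_maps P A"
  using left_linearD(1-3)[of h A P "regular_bimodule A"] assms by (simp_all add: Hom_left_simps)

lemma \<psi>_closed [simp]: "q \<in> carrier Q \<Longrightarrow> \<psi> q \<in> carrier H"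
proof -
  assume q: "q \<in> carrier Q"
  then have "(\<lambda>p. nv p q) \<in> left_linear A P (regular_bimodule A)"
    by (intro left_linearI additiveI) (simp_all add: PQ.pure_add_left nu_add nv_left)
  then show ?thesis
    using restrict_left_linear[OF P.bimodule_axioms] by (simp add: Hom_left_simps \<psi>_def)
qed

lemma \<psi>_hom: "\<psi> \<in> bimodule_hom B A Q H"
  by (intro bimodule_homI additiveI)
    (auto simp: \<psi>_def[abs_def] PQ.pure_add_right nu_add PQ.pure_balanced nv_right intro: \<psi>_closed[unfolded \<psi>_def])

text \<open>
  The identities \<open>nu_p\<close> and \<open>nu_q\<close> say that the \<open>q'\<^sub>i\<close> and \<open>p'\<^sub>i\<close> are dual bases for \<open>\<nu>\<close>, so functionals on
  \<open>\<^sub>AP\<close> are represented by \<open>Q\<close> for the same reason as those on \<open>P\<^sub>B\<close>.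
\<close>

lemma \<psi>_bij: "bij_betw \<psi> (carrier Q) (carrier H)"
proof -
  define g where "g h = (\<Oplus>\<^bsub>Q\<^esub>i\<in>{..<m}. q' i \<bullet>\<^bsub>Q\<^esub> h (p' i))" for h
  have g_closed: "g h \<in> carrier Q" if "h \<in> carrier H" for h
    unfolding g_def by (rule Q.M.finsum_closed) (use H_prop(1)[OF that] first_family in auto)
  have g\<psi>: "g (\<psi> q) = q" if q: "q \<in> carrier Q" for q
  proof -
    have "g (\<psi> q) = (\<Oplus>\<^bsub>Q\<^esub>i\<in>{..<m}. q' i \<bullet>\<^bsub>Q\<^esub> nv (p' i) q)"
      unfolding g_def by (rule Q.M.finsum_eq) (use q first_family in \<open>simp_all add: \<psi>_def\<close>)
    then show ?thesis using nu_q[OF q] by simp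
  qed
  have \<psi>g: "\<psi> (g h) = h" if h: "h \<in> carrier H" for h
  proof (rule extensionalityI[of _ "carrier P"])
    show "\<psi> (g h) \<in> extensional (carrier P)" by (simp add: \<psi>_def)
    show "h \<in> extensional (carrier P)" using h by (simp add: Hom_left_simps)
    fix x assume x: "x \<in> carrier P"
    have hp: "h (p' i) \<in> carrier A" if "i < m" for i using H_prop(1)[OF h] first_family that by simp
    have "\<psi> (g h) x = nv x (g h)" using x by (simp add: \<psi>_def)
    also have "\<dots> = (\<Oplus>\<^bsub>A\<^esub>i\<in>{..<m}. nv x (q' i \<bullet>\<^bsub>Q\<^esub> h (p' i)))"
      unfolding g_def
      by (rule additive_finsum[OF Q.M.abelian_group_axioms P.R.abelian_group_axioms])
        (use x hp first_family in \<open>auto intro!: additiveI simp: PQ.pure_add_right nu_add\<close>)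
    also have "\<dots> = (\<Oplus>\<^bsub>A\<^esub>i\<in>{..<m}. h (nv x (q' i) \<odot>\<^bsub>P\<^esub> p' i))"
      by (rule P.R.finsum_eq) (use x hp H_prop(2)[OF h] first_family in \<open>simp_all add: nv_right\<close>)
    also have "\<dots> = h (\<Oplus>\<^bsub>P\<^esub>i\<in>{..<m}. nv x (q' i) \<odot>\<^bsub>P\<^esub> p' i)"
      by (rule additive_finsum[OF P.M.abelian_group_axioms P.R.abelian_group_axioms, symmetric])
        (use x H_prop(3)[OF h] first_family in auto)
    finally show "\<psi> (g h) x = h x" using nu_p[OF x] by simp
  qed
  show ?thesis
    by (rule bij_betw_byWitness[where f' = g]) (use g_closed g\<psi> \<psi>g in auto)
qed

theorem P_frobenius: "frobenius_bimodule A B P"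
  using Q_iso_Hom bimodule_isomorphic_span[OF _ _ \<psi>_hom \<psi>_bij Q.bimodule_axioms]
  unfolding frobenius_bimodule_def by (auto simp: P.bimodule_axioms P_fgp)

text \<open>
  Under \<open>P \<otimes>\<^sub>B Q \<rightarrow> P \<otimes>\<^sub>B Hom(\<^sub>AP, \<^sub>AA)\<close>, induced by \<open>\<psi>\<close>, the evaluation map pulls back to \<open>\<nu>\<close>. A central
  element over \<open>1\<close> for \<open>\<nu>\<close> is therefore mapped to one for the evaluation.
\<close>

theorem A_P_separable: "P_separable A B P"
proof -
  interpret PH: tensor A B A P H
    by (intro tensor.intro P.bimodule_axioms H_bimodule)
  define ev where "ev = tensor_lift A (\<lambda>(p::'p) f. f p :: 'a)"
  have ev_bal: "(\<lambda>p f. f p) \<in> balanced_maps B P H A"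
    by (rule balancedI) (auto simp: H_prop additive_add[OF H_prop(3)])
  have ev_additive: "ev \<in> additive_maps PH.T A"
    unfolding ev_def by (rule PH.tensor_lift_additive[OF P.R.abelian_group_axioms ev_bal])
  have ev_pure: "ev (PH.pure p f) = f p" if "p \<in> carrier P" "f \<in> carrier H" for p f
    unfolding ev_def by (rule PH.tensor_lift_pure[OF P.R.abelian_group_axioms ev_bal that])
  note [simp] = additive_closed[OF ev_additive] additive_add[OF ev_additive] ev_pure
  have ev_hom: "ev \<in> bimodule_hom A A PH.T (regular_bimodule A)"
  proof (rule bimodule_homI)
    show "ev \<in> additive_maps PH.T (regular_bimodule A)" using ev_additive by simp
    fix a X assume a: "a \<in> carrier A" and X: "X \<in> carrier PH.T"
    show "ev (a \<odot>\<^bsub>PH.T\<^esub> X) = a \<odot>\<^bsub>regular_bimodule A\<^esub> ev X"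
      using X by (induction X rule: PH.tensor_induct) (simp_all add: a H_prop P.R.r_distr)
    show "ev (X \<bullet>\<^bsub>PH.T\<^esub> a) = ev X \<bullet>\<^bsub>regular_bimodule A\<^esub> a"
      using X
    proof (induction X rule: PH.tensor_induct)
      case (pure p h)
      then have "h \<bullet>\<^bsub>H\<^esub> a \<in> carrier H" using bimodule.rsmult_closed[OF H_bimodule] a by blast
      then show ?case using pure a ev_pure[of p "h \<bullet>\<^bsub>H\<^esub> a"] by (simp add: Hom_left_simps(5))
    qed (simp_all add: a P.R.l_distr)
  qed
  define \<theta> where "\<theta> = tensor_lift PH.T (\<lambda>p q. PH.pure p (\<psi> q))"
  have \<theta>_bal: "(\<lambda>p q. PH.pure p (\<psi> q)) \<in> balanced_maps B P Q PH.T"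
    by (rule balancedI) (simp_all add: PH.pure_add_left PH.pure_add_right[symmetric] PH.pure_balanced
      bimodule_homD(2,5)[OF \<psi>_hom] del: Hom_left_simps)
  have \<theta>_additive: "\<theta> \<in> additive_maps PQ.T PH.T"
    unfolding \<theta>_def by (rule PQ.tensor_lift_additive[OF PH.T.abelian_group_axioms \<theta>_bal])
  have \<theta>_pure: "\<theta> (PQ.pure p q) = PH.pure p (\<psi> q)" if "p \<in> carrier P" "q \<in> carrier Q" for p q
    unfolding \<theta>_def by (rule PQ.tensor_lift_pure[OF PH.T.abelian_group_axioms \<theta>_bal that])
  note [simp] = additive_closed[OF \<theta>_additive] additive_add[OF \<theta>_additive] \<theta>_pure
  have ev_\<theta>: "ev (\<theta> X) = \<nu> X" if "X \<in> carrier PQ.T" for X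
    using that by (induction X rule: PQ.tensor_induct) (simp_all add: nu_add \<psi>_def[THEN fun_cong])
  have \<theta>_left: "\<theta> (a \<odot>\<^bsub>PQ.T\<^esub> X) = a \<odot>\<^bsub>PH.T\<^esub> \<theta> X" if "a \<in> carrier A" "X \<in> carrier PQ.T" for a X
    using that(2) by (induction X rule: PQ.tensor_induct) (simp_all add: that(1))
  have \<theta>_right: "\<theta> (X \<bullet>\<^bsub>PQ.T\<^esub> a) = \<theta> X \<bullet>\<^bsub>PH.T\<^esub> a" if "a \<in> carrier A" "X \<in> carrier PQ.T" for a X
    using that(2) by (induction X rule: PQ.tensor_induct)
      (simp_all add: that(1) bimodule_homD(3)[OF \<psi>_hom] del: Hom_left_simps)
  obtain z where z: "z \<in> carrier PQ.T" "\<nu> z = \<one>\<^bsub>A\<^esub>"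
    "\<And>a. a \<in> carrier A \<Longrightarrow> a \<odot>\<^bsub>PQ.T\<^esub> z = z \<bullet>\<^bsub>PQ.T\<^esub> a"
    by (rule nu_central) blast
  have "a \<odot>\<^bsub>PH.T\<^esub> \<theta> z = \<theta> z \<bullet>\<^bsub>PH.T\<^esub> a" if "a \<in> carrier A" for a
    using z \<theta>_left[OF that z(1)] \<theta>_right[OF that z(1)] that by simp
  then show ?thesis
    unfolding P_separable_def ev_def[symmetric] split_epi_regular_iff[OF PH.bimodule_T]
    using ev_hom z by (intro conjI bexI[of _ "\<theta> z"]) (simp_all add: ev_\<theta>)
qed

text \<open>
  As \<open>\<nu>\<close> is \<open>A\<close>-linear and takes the value \<open>1\<close>, elements of \<open>A\<close> that act equally on \<open>P\<close> are equal.
\<close>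

theorem lam_inj: "inj_on lam (carrier A)"
proof (rule inj_onI)
  fix a b assume ab: "a \<in> carrier A" "b \<in> carrier A" "lam a = lam b"
  obtain z where z: "z \<in> carrier PQ.T" "\<nu> z = \<one>\<^bsub>A\<^esub>"
    by (rule nu_central) blast
  have "a \<odot>\<^bsub>PQ.T\<^esub> X = b \<odot>\<^bsub>PQ.T\<^esub> X" if "X \<in> carrier PQ.T" for X
    using that
  proof (induction X rule: PQ.tensor_induct)
    case (pure p q)
    then show ?case using ab lam_apply[of p a] lam_apply[of p b] by simp
  qed (simp add: ab)
  then have "a \<otimes>\<^bsub>A\<^esub> \<nu> z = b \<otimes>\<^bsub>A\<^esub> \<nu> z"
    using nu_left[OF _ z(1)] ab z(1) by metis
  then show "a = b" using z ab by simp
qed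

text \<open>
  The form \<open>\<nu>\<close> on \<open>E \<cong> P \<otimes>\<^sub>B Q\<close> is bilinear over \<open>A\<close>, but its value at \<open>1\<close> is \<open>\<Sum>\<^sub>j \<nu>(p\<^sub>j \<otimes> q\<^sub>j)\<close>, which need
  not be \<open>1\<close>. Letting \<open>g\<close> act on a central \<open>z\<close> with \<open>\<nu>(z) = 1\<close> repairs this: \<open>g \<mapsto> \<nu>((g \<otimes> id) z)\<close> is
  right linear because \<open>a z = z a\<close>.
\<close>

theorem End_split: "split_extension A E lam"
proof -
  obtain z where z: "z \<in> carrier PQ.T" "\<nu> z = \<one>\<^bsub>A\<^esub>"
    "\<And>a. a \<in> carrier A \<Longrightarrow> a \<odot>\<^bsub>PQ.T\<^esub> z = z \<bullet>\<^bsub>PQ.T\<^esub> a"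
    by (rule nu_central) blast
  define L where "L g = tensor_lift A (\<lambda>u v. nv (g u) v)" for g :: "'p \<Rightarrow> 'p"
  have bal: "(\<lambda>u v. nv (g u) v) \<in> balanced_maps B P Q A" if "g \<in> carrier E" for g
    by (rule balancedI) (simp_all add: E_apply[OF that] PQ.pure_add_left PQ.pure_add_right nu_add
        PQ.pure_balanced)
  have L_additive: "L g \<in> additive_maps PQ.T A" if "g \<in> carrier E" for g
    unfolding L_def by (rule PQ.tensor_lift_additive[OF P.R.abelian_group_axioms bal[OF that]])
  have L_pure: "L g (PQ.pure u v) = nv (g u) v" if "g \<in> carrier E" "u \<in> carrier P" "v \<in> carrier Q" for g u v
    unfolding L_def by (rule PQ.tensor_lift_pure[OF P.R.abelian_group_axioms bal[OF that(1)] that(2,3)])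
  note [simp] = additive_closed[OF L_additive] additive_add[OF L_additive] L_pure E_apply(1)
  have L_add: "L (g \<oplus>\<^bsub>E\<^esub> h) X = L g X \<oplus>\<^bsub>A\<^esub> L h X"
    if "g \<in> carrier E" "h \<in> carrier E" "X \<in> carrier PQ.T" for g h X
    using that(3) by (induction X rule: PQ.tensor_induct)
      (use that(1,2) in \<open>simp_all add: PQ.pure_add_left nu_add P.R.a_ac\<close>)
  have L_left: "L (lam a \<otimes>\<^bsub>E\<^esub> g) X = a \<otimes>\<^bsub>A\<^esub> L g X"
    if "a \<in> carrier A" "g \<in> carrier E" "X \<in> carrier PQ.T" for a g X
    using that(3) by (induction X rule: PQ.tensor_induct)
      (use that(1,2) in \<open>simp_all add: nv_left P.R.r_distr\<close>)
  have L_inner: "L (g \<otimes>\<^bsub>E\<^esub> lam a) X = L g (a \<odot>\<^bsub>PQ.T\<^esub> X)"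
    if "a \<in> carrier A" "g \<in> carrier E" "X \<in> carrier PQ.T" for a g X
    using that(3) by (induction X rule: PQ.tensor_induct) (use that(1,2) in simp_all)
  have L_right: "L g (X \<bullet>\<^bsub>PQ.T\<^esub> a) = L g X \<otimes>\<^bsub>A\<^esub> a"
    if "a \<in> carrier A" "g \<in> carrier E" "X \<in> carrier PQ.T" for a g X
    using that(3) by (induction X rule: PQ.tensor_induct)
      (use that(1,2) in \<open>simp_all add: nv_right P.R.l_distr\<close>)
  have L_one: "L \<one>\<^bsub>E\<^esub> X = \<nu> X" if "X \<in> carrier PQ.T" for X
    using that by (induction X rule: PQ.tensor_induct) (simp_all add: nu_add)
  have "(\<lambda>g. L g z) \<in> bimodule_hom A A (ring_bimodule E lam lam) (regular_bimodule A)"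
    by (intro bimodule_homI additiveI) (simp_all add: z L_add L_left L_inner L_right)
  moreover have "L \<one>\<^bsub>E\<^esub> z = \<one>\<^bsub>A\<^esub>" using L_one z by simp
  ultimately show ?thesis
    unfolding split_extension_def
    by (intro conjI bexI[of _ "\<lambda>g. L g z"] ring_hom_ringI2 P.R.ring_axioms E.ring_axioms lam_hom)
qed

theorem End_separable: "separable_extension A E lam"
proof -
  obtain w where w: "w \<in> carrier QP.T" "\<mu> w = \<one>\<^bsub>B\<^esub>"
    "\<And>b. b \<in> carrier B \<Longrightarrow> b \<odot>\<^bsub>QP.T\<^esub> w = w \<bullet>\<^bsub>QP.T\<^esub> b"
    by (rule mu_central) blast
  then show ?thesis by (intro separable_if_split[OF mu_additive refl])
qed

text \<open>
  For \<open>x = [p, q]\<close>, the inner sum over \<open>i\<close> in each identity of a Frobenius system is one of the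
  identities for \<open>\<nu>\<close>, and the remaining sum over \<open>j\<close> is one of those for \<open>\<mu>\<close>.
\<close>

theorem End_frobenius: "frobenius_extension A E lam"
proof -
  define Fr where "Fr f = \<nu> (\<alpha> f)" for f
  let ?I = "{..<n} \<times> {..<m}"
  define X where "X z = rank_one (pj (fst z)) (q' (snd z))" for z :: "nat \<times> nat"
  define Y where "Y z = rank_one (p' (snd z)) (qj (fst z))" for z :: "nat \<times> nat"
  have XE: "X z \<in> carrier E" and YE: "Y z \<in> carrier E" if "z \<in> ?I" for z
    using that by (auto simp: X_def Y_def first_family pj qj)
  have Fr_additive: "Fr \<in> additive_maps E A"
    unfolding Fr_def by (rule additive_comp[OF \<alpha>_additive nu_additive])
  have Fr_rank_one: "Fr (rank_one p q) = nv p q" if "p \<in> carrier P" "q \<in> carrier Q" for p q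
    using that by (simp add: Fr_def)
  note [simp] = additive_closed[OF Fr_additive] additive_add[OF Fr_additive]
  have lam_add: "lam (a \<oplus>\<^bsub>A\<^esub> b) = lam a \<oplus>\<^bsub>E\<^esub> lam b" if "a \<in> carrier A" "b \<in> carrier A" for a b
    by (rule ring_hom_add[OF lam_hom that])
  have X_dual: "(\<Oplus>\<^bsub>E\<^esub>z\<in>?I. X z \<otimes>\<^bsub>E\<^esub> lam (Fr (Y z \<otimes>\<^bsub>E\<^esub> x))) = x" if "x \<in> carrier E" for x
    using that
  proof (induction x rule: E_induct)
    case (rank_one p q)
    let ?c = "\<lambda>j. \<mu> (QP.pure (qj j) p)"
    have "(\<Oplus>\<^bsub>E\<^esub>z\<in>?I. X z \<otimes>\<^bsub>E\<^esub> lam (Fr (Y z \<otimes>\<^bsub>E\<^esub> rank_one p q)))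
        = (\<Oplus>\<^bsub>E\<^esub>z\<in>?I. rank_one (pj (fst z)) (q' (snd z) \<bullet>\<^bsub>Q\<^esub> nv (p' (snd z)) (?c (fst z) \<odot>\<^bsub>Q\<^esub> q)))"
      by (rule E.finsum_eq)
        (use rank_one in \<open>auto simp: X_def Y_def first_family pj qj rank_one_mult_rank_one Fr_rank_one rank_one_mult_lam PQ.pure_balanced\<close>)
    also have "\<dots> = (\<Oplus>\<^bsub>E\<^esub>j\<in>{..<n}. \<Oplus>\<^bsub>E\<^esub>i\<in>{..<m}. rank_one (pj j) (q' i \<bullet>\<^bsub>Q\<^esub> nv (p' i) (?c j \<odot>\<^bsub>Q\<^esub> q)))"
      by (rule E.finsum_Times) (use rank_one in \<open>auto simp: first_family pj qj\<close>)
    also have "\<dots> = (\<Oplus>\<^bsub>E\<^esub>j\<in>{..<n}. rank_one (pj j) (\<Oplus>\<^bsub>Q\<^esub>i\<in>{..<m}. q' i \<bullet>\<^bsub>Q\<^esub> nv (p' i) (?c j \<odot>\<^bsub>Q\<^esub> q)))"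
      by (rule E.finsum_eq, rule additive_finsum[OF Q.M.abelian_group_axioms E.abelian_group_axioms
            rank_one_right_additive, symmetric])
        (use rank_one in \<open>auto simp: first_family pj qj intro!: rank_one_closed Q.M.finsum_closed\<close>)
    also have "\<dots> = (\<Oplus>\<^bsub>E\<^esub>j\<in>{..<n}. rank_one (pj j \<bullet>\<^bsub>P\<^esub> ?c j) q)"
      by (rule E.finsum_eq) (use rank_one nu_q in \<open>auto simp: pj qj rank_one_middle\<close>)
    also have "\<dots> = rank_one (\<Oplus>\<^bsub>P\<^esub>j\<in>{..<n}. pj j \<bullet>\<^bsub>P\<^esub> ?c j) q"
      by (rule additive_finsum[OF P.M.abelian_group_axioms E.abelian_group_axioms
            rank_one_left_additive, symmetric]) (use rank_one in \<open>auto simp: pj qj\<close>)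
    finally show ?case using dual_p[OF rank_one(1)] by simp
  next
    case (add f g)
    have "(\<Oplus>\<^bsub>E\<^esub>z\<in>?I. X z \<otimes>\<^bsub>E\<^esub> lam (Fr (Y z \<otimes>\<^bsub>E\<^esub> (f \<oplus>\<^bsub>E\<^esub> g))))
        = (\<Oplus>\<^bsub>E\<^esub>z\<in>?I. X z \<otimes>\<^bsub>E\<^esub> lam (Fr (Y z \<otimes>\<^bsub>E\<^esub> f)) \<oplus>\<^bsub>E\<^esub> X z \<otimes>\<^bsub>E\<^esub> lam (Fr (Y z \<otimes>\<^bsub>E\<^esub> g)))"
      by (rule E.finsum_eq) (use add XE YE in \<open>simp_all add: E.r_distr lam_add\<close>)
    also have "\<dots> = f \<oplus>\<^bsub>E\<^esub> g"
      by (subst E.finsum_add) (use add XE YE in simp_all)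
    finally show ?case .
  qed
  have Y_dual: "(\<Oplus>\<^bsub>E\<^esub>z\<in>?I. lam (Fr (x \<otimes>\<^bsub>E\<^esub> X z)) \<otimes>\<^bsub>E\<^esub> Y z) = x" if "x \<in> carrier E" for x
    using that
  proof (induction x rule: E_induct)
    case (rank_one p q)
    let ?c = "\<lambda>j. \<mu> (QP.pure q (pj j))"
    have "(\<Oplus>\<^bsub>E\<^esub>z\<in>?I. lam (Fr (rank_one p q \<otimes>\<^bsub>E\<^esub> X z)) \<otimes>\<^bsub>E\<^esub> Y z)
        = (\<Oplus>\<^bsub>E\<^esub>z\<in>?I. rank_one (nv (p \<bullet>\<^bsub>P\<^esub> ?c (fst z)) (q' (snd z)) \<odot>\<^bsub>P\<^esub> p' (snd z)) (qj (fst z)))"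
      by (rule E.finsum_eq)
        (use rank_one in \<open>auto simp: X_def Y_def first_family pj qj rank_one_mult_rank_one Fr_rank_one lam_mult_rank_one\<close>)
    also have "\<dots> = (\<Oplus>\<^bsub>E\<^esub>j\<in>{..<n}. \<Oplus>\<^bsub>E\<^esub>i\<in>{..<m}. rank_one (nv (p \<bullet>\<^bsub>P\<^esub> ?c j) (q' i) \<odot>\<^bsub>P\<^esub> p' i) (qj j))"
      by (rule E.finsum_Times) (use rank_one in \<open>auto simp: first_family pj qj\<close>)
    also have "\<dots> = (\<Oplus>\<^bsub>E\<^esub>j\<in>{..<n}. rank_one (\<Oplus>\<^bsub>P\<^esub>i\<in>{..<m}. nv (p \<bullet>\<^bsub>P\<^esub> ?c j) (q' i) \<odot>\<^bsub>P\<^esub> p' i) (qj j))"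
      by (rule E.finsum_eq, rule additive_finsum[OF P.M.abelian_group_axioms E.abelian_group_axioms
            rank_one_left_additive, symmetric])
        (use rank_one in \<open>auto simp: first_family pj qj intro!: rank_one_closed P.M.finsum_closed\<close>)
    also have "\<dots> = (\<Oplus>\<^bsub>E\<^esub>j\<in>{..<n}. rank_one p (?c j \<odot>\<^bsub>Q\<^esub> qj j))"
      by (rule E.finsum_eq) (use rank_one nu_p in \<open>auto simp: pj qj rank_one_middle\<close>)
    also have "\<dots> = rank_one p (\<Oplus>\<^bsub>Q\<^esub>j\<in>{..<n}. ?c j \<odot>\<^bsub>Q\<^esub> qj j)"
      by (rule additive_finsum[OF Q.M.abelian_group_axioms E.abelian_group_axioms
            rank_one_right_additive, symmetric]) (use rank_one in \<open>auto simp: pj qj\<close>)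
    finally show ?case using dual_q[OF rank_one(2)] by simp
  next
    case (add f g)
    have "(\<Oplus>\<^bsub>E\<^esub>z\<in>?I. lam (Fr ((f \<oplus>\<^bsub>E\<^esub> g) \<otimes>\<^bsub>E\<^esub> X z)) \<otimes>\<^bsub>E\<^esub> Y z)
        = (\<Oplus>\<^bsub>E\<^esub>z\<in>?I. lam (Fr (f \<otimes>\<^bsub>E\<^esub> X z)) \<otimes>\<^bsub>E\<^esub> Y z \<oplus>\<^bsub>E\<^esub> lam (Fr (g \<otimes>\<^bsub>E\<^esub> X z)) \<otimes>\<^bsub>E\<^esub> Y z)"
      by (rule E.finsum_eq) (use add XE YE in \<open>simp_all add: E.l_distr lam_add\<close>)
    also have "\<dots> = f \<oplus>\<^bsub>E\<^esub> g"
      by (subst E.finsum_add) (use add XE YE in simp_all)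
    finally show ?case .
  qed
  interpret frobenius_system A E lam Fr ?I X Y
  proof unfold_locales
    show "Fr \<in> bimodule_hom A A (ring_bimodule E lam lam) (regular_bimodule A)"
      by (intro bimodule_homI) (simp_all add: Fr_additive Fr_def[abs_def] \<alpha>_left \<alpha>_right nu_left nu_right,
          use Fr_additive in \<open>simp add: Fr_def[abs_def]\<close>)
  qed (use XE YE X_dual Y_dual lam_hom in simp_all)
  show ?thesis by (rule frobenius_extension)
qed

theorem endomorphism_extension: "endomorphism_extension_condition A B P"
  unfolding endomorphism_extension_condition_def
  using ring_hom_ringI2[OF P.R.ring_axioms E.ring_axioms lam_hom] lam_inj End_split End_separable End_frobenius by blast

end

section \<open>From the endomorphism ring to a symmetric separable equivalence\<close>

context dual_pair
begin

lemma pair_additive_left: "p \<in> carrier P \<Longrightarrow> (\<lambda>q. pair q p) \<in> additive_maps Q B"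
  by (rule additiveI) (simp_all add: pair_add_left)

lemma pair_additive_right: "q \<in> carrier Q \<Longrightarrow> pair q \<in> additive_maps P B"
  by (rule additiveI) (simp_all add: pair_add_right)

lemma pair_nondegenerate:
  assumes "q \<in> carrier Q" "q' \<in> carrier Q" "\<And>x. x \<in> carrier P \<Longrightarrow> pair q x = pair q' x"
  shows "q = q'"
proof -
  have "(\<Oplus>\<^bsub>Q\<^esub>j\<in>{..<n}. pair q (pj j) \<odot>\<^bsub>Q\<^esub> qj j) = (\<Oplus>\<^bsub>Q\<^esub>j\<in>{..<n}. pair q' (pj j) \<odot>\<^bsub>Q\<^esub> qj j)"
    by (rule Q.M.finsum_eq) (simp_all add: assms pj qj)
  then show ?thesis using dual_q assms(1,2) by simp
qed

text \<open>
  The right action of \<open>E\<close> on \<open>Q\<close> dual to its action on \<open>P\<close>; for \<open>Q = Hom(P\<^sub>B, B\<^sub>B)\<close> it is composition.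
  Its laws follow from \<open>pair_qact\<close>, because \<open>q\<close> is determined by \<open>pair q\<close>.
\<close>

definition qact :: "'q \<Rightarrow> ('p \<Rightarrow> 'p) \<Rightarrow> 'q" where
  "qact q f = (\<Oplus>\<^bsub>Q\<^esub>j\<in>{..<n}. pair q (f (pj j)) \<odot>\<^bsub>Q\<^esub> qj j)"

lemma qact_closed [simp]: "\<lbrakk>q \<in> carrier Q; f \<in> carrier E\<rbrakk> \<Longrightarrow> qact q f \<in> carrier Q"
  unfolding qact_def by (rule Q.M.finsum_closed) (auto simp: E_apply pj qj)

lemma pair_qact [simp]:
  assumes q: "q \<in> carrier Q" and f: "f \<in> carrier E" and x: "x \<in> carrier P"
  shows "pair (qact q f) x = pair q (f x)"
proof -
  have "pair (qact q f) x = (\<Oplus>\<^bsub>B\<^esub>j\<in>{..<n}. pair (pair q (f (pj j)) \<odot>\<^bsub>Q\<^esub> qj j) x)"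
    unfolding qact_def
    by (rule additive_finsum[OF Q.M.abelian_group_axioms P.S.abelian_group_axioms pair_additive_left[OF x]])
      (use q f in \<open>simp add: E_apply pj qj\<close>)
  also have "\<dots> = (\<Oplus>\<^bsub>B\<^esub>j\<in>{..<n}. pair q (f (pj j \<bullet>\<^bsub>P\<^esub> pair (qj j) x)))"
    by (rule P.S.finsum_eq) (use q f x in \<open>simp_all add: E_apply pj qj pair_left pair_right\<close>)
  also have "\<dots> = pair q (f (\<Oplus>\<^bsub>P\<^esub>j\<in>{..<n}. pj j \<bullet>\<^bsub>P\<^esub> pair (qj j) x))"
    by (rule additive_finsum[OF P.M.abelian_group_axioms P.S.abelian_group_axioms
          additive_comp[OF E_apply(4)[OF f] pair_additive_right[OF q]], symmetric])
      (use x in \<open>simp add: pj qj\<close>)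
  finally show ?thesis using dual_p[OF x] by simp
qed

lemma qact_add_left:
  "\<lbrakk>q \<in> carrier Q; q' \<in> carrier Q; f \<in> carrier E\<rbrakk> \<Longrightarrow> qact (q \<oplus>\<^bsub>Q\<^esub> q') f = qact q f \<oplus>\<^bsub>Q\<^esub> qact q' f"
  by (rule pair_nondegenerate) (simp_all add: pair_add_left E_apply)

lemma qact_add_right:
  "\<lbrakk>q \<in> carrier Q; f \<in> carrier E; g \<in> carrier E\<rbrakk> \<Longrightarrow> qact q (f \<oplus>\<^bsub>E\<^esub> g) = qact q f \<oplus>\<^bsub>Q\<^esub> qact q g"
  by (rule pair_nondegenerate) (simp_all add: pair_add_left pair_add_right E_apply)

lemma qact_lsmult:
  "\<lbrakk>b \<in> carrier B; q \<in> carrier Q; f \<in> carrier E\<rbrakk> \<Longrightarrow> qact (b \<odot>\<^bsub>Q\<^esub> q) f = b \<odot>\<^bsub>Q\<^esub> qact q f"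
  by (rule pair_nondegenerate) (simp_all add: pair_left E_apply)

lemma qact_mult:
  "\<lbrakk>q \<in> carrier Q; f \<in> carrier E; g \<in> carrier E\<rbrakk> \<Longrightarrow> qact q (f \<otimes>\<^bsub>E\<^esub> g) = qact (qact q f) g"
  by (rule pair_nondegenerate) (simp_all add: E_apply)

lemma qact_lam: "\<lbrakk>q \<in> carrier Q; a \<in> carrier A\<rbrakk> \<Longrightarrow> qact q (lam a) = q \<bullet>\<^bsub>Q\<^esub> a"
  by (rule pair_nondegenerate) (simp_all add: pair_middle)

lemma qact_rank_one:
  "\<lbrakk>q \<in> carrier Q; p \<in> carrier P; q' \<in> carrier Q\<rbrakk> \<Longrightarrow> qact q (rank_one p q') = pair q p \<odot>\<^bsub>Q\<^esub> q'"
  by (rule pair_nondegenerate) (simp_all add: pair_left pair_right)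

lemma rank_one_mult_E: "\<lbrakk>p \<in> carrier P; q \<in> carrier Q; f \<in> carrier E\<rbrakk> \<Longrightarrow> rank_one p q \<otimes>\<^bsub>E\<^esub> f = rank_one p (qact q f)"
  by (rule E_eqI) (simp_all add: E_apply)

lemma P_fgp_right: "fg_projective_right B P"
proof (rule fg_projective_rightI[OF P.bimodule_axioms, of "{..<n}" pj "\<lambda>j. pair (qj j)"])
  show "pair (qj j) \<in> right_linear B P (regular_bimodule B)" if "j \<in> {..<n}" for j
    using that pair_additive_right[of "qj j"] by (intro right_linearI) (simp_all add: qj pair_right)
qed (simp_all add: pj dual_p)

lemma Q_fgp_left: "fg_projective_left B Q"
proof (rule fg_projective_leftI[OF Q.bimodule_axioms, of "{..<n}" qj "\<lambda>j q. pair q (pj j)"])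
  show "(\<lambda>q. pair q (pj j)) \<in> left_linear B Q (regular_bimodule B)" if "j \<in> {..<n}" for j
    using that pair_additive_left[of "pj j"] by (intro left_linearI) (simp_all add: pj pair_left)
qed (simp_all add: qj dual_q)

definition pairing_map :: "('q, 'p) tensor \<Rightarrow> 'b" where
  "pairing_map = tensor_lift B pair"

lemma pairing_map_additive: "pairing_map \<in> additive_maps QP.T B"
  unfolding pairing_map_def by (rule QP.tensor_lift_additive[OF P.S.abelian_group_axioms pair_balanced])

lemma pairing_map_pure [simp]: "\<lbrakk>q \<in> carrier Q; p \<in> carrier P\<rbrakk> \<Longrightarrow> pairing_map (QP.pure q p) = pair q p"
  unfolding pairing_map_def by (rule QP.tensor_lift_pure[OF P.S.abelian_group_axioms pair_balanced])

lemma pairing_map_hom: "pairing_map \<in> bimodule_hom B B QP.T (regular_bimodule B)"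
proof (rule bimodule_homI)
  show "pairing_map \<in> additive_maps QP.T (regular_bimodule B)" using pairing_map_additive by simp
  note [simp] = additive_closed[OF pairing_map_additive] additive_add[OF pairing_map_additive]
  show "pairing_map (b \<odot>\<^bsub>QP.T\<^esub> W) = b \<odot>\<^bsub>regular_bimodule B\<^esub> pairing_map W" if "b \<in> carrier B" "W \<in> carrier QP.T" for b W
    using that(2) by (induction W rule: QP.tensor_induct) (simp_all add: that(1) pair_left P.S.r_distr)
  show "pairing_map (W \<bullet>\<^bsub>QP.T\<^esub> b) = pairing_map W \<bullet>\<^bsub>regular_bimodule B\<^esub> b" if "b \<in> carrier B" "W \<in> carrier QP.T" for b W
    using that(2) by (induction W rule: QP.tensor_induct) (simp_all add: that(1) pair_right P.S.l_distr)
qed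

text \<open>
  Let \<open>e = \<Sum> x \<otimes> y\<close> be a separability element and write \<open>W(v, u) = v e u = \<Sum> v x \<otimes> y u\<close>. Then
  \<open>W(v f, u) = W(v, f u)\<close> for \<open>f \<in> E\<close>, because \<open>f e = e f\<close>, so \<open>v e u\<close> only depends on the class of
  \<open>v \<otimes> u\<close> in \<open>Q \<otimes>\<^sub>E P\<close>. The pairing identifies \<open>Q \<otimes>\<^sub>E P\<close> with \<open>B\<close> when \<open>P\<^sub>B\<close> is a generator, and the
  class of \<open>\<Sum>\<^sub>l v\<^sub>l \<otimes> u\<^sub>l\<close> corresponds to \<open>1\<close>; that is why \<open>w = \<Sum>\<^sub>l v\<^sub>l e u\<^sub>l\<close> is central.
\<close>

theorem pairing_map_split_epi:
  assumes sep: "separable_extension A E lam"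
    and u: "\<And>l. l < k \<Longrightarrow> u l \<in> carrier P" and v: "\<And>l. l < k \<Longrightarrow> v l \<in> carrier Q"
    and unit: "(\<Oplus>\<^bsub>B\<^esub>l\<in>{..<k::nat}. pair (v l) (u l)) = \<one>\<^bsub>B\<^esub>"
  shows "bimodule_split_epi B B QP.T (regular_bimodule B) pairing_map"
proof -
  let ?T = "ext.EE.T"
  obtain e where e: "e \<in> carrier ?T" "ext.mult e = \<one>\<^bsub>E\<^esub>"
    and e_central: "\<And>f. f \<in> carrier E \<Longrightarrow> f \<odot>\<^bsub>?T\<^esub> e = e \<bullet>\<^bsub>?T\<^esub> f"
    using sep unfolding ext.separable_extension_iff by blast
  define W where "W v u = tensor_lift QP.T (\<lambda>x y. QP.pure (qact v x) (y u))" for v and u :: 'p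
  have bal: "(\<lambda>x y. QP.pure (qact v x) (y u)) \<in>
      balanced_maps A (ring_bimodule E (\<lambda>x. x) lam) (ring_bimodule E lam (\<lambda>x. x)) QP.T"
    if "v \<in> carrier Q" "u \<in> carrier P" for v u
    by (rule balancedI) (use that in \<open>simp_all add: E_apply qact_add_right QP.pure_add_left
        QP.pure_add_right qact_mult qact_lam QP.pure_balanced\<close>)
  have W_additive: "W v u \<in> additive_maps ?T QP.T" if "v \<in> carrier Q" "u \<in> carrier P" for v u
    unfolding W_def by (rule ext.EE.tensor_lift_additive[OF QP.T.abelian_group_axioms bal[OF that]])
  have W_pure: "W v u (ext.EE.pure x y) = QP.pure (qact v x) (y u)"
    if "v \<in> carrier Q" "u \<in> carrier P" "x \<in> carrier E" "y \<in> carrier E" for v u x y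
    unfolding W_def
    using ext.EE.tensor_lift_pure[OF QP.T.abelian_group_axioms bal[OF that(1,2)], of x y] that by simp
  note [simp] = W_pure additive_closed[OF W_additive] additive_add[OF W_additive] E_apply(1)
    additive_closed[OF pairing_map_additive] additive_add[OF pairing_map_additive]
    additive_closed[OF ext.mult_additive] additive_add[OF ext.mult_additive]
  have W_add_left: "W (v \<oplus>\<^bsub>Q\<^esub> v') u Z = W v u Z \<oplus>\<^bsub>QP.T\<^esub> W v' u Z"
    if "v \<in> carrier Q" "v' \<in> carrier Q" "u \<in> carrier P" "Z \<in> carrier ?T" for v v' u Z
    using that(4) by (induction Z rule: ext.EE.tensor_induct)
      (use that(1-3) in \<open>simp_all add: qact_add_left QP.pure_add_left QP.T.a_ac\<close>)
  have W_add_right: "W v (u \<oplus>\<^bsub>P\<^esub> u') Z = W v u Z \<oplus>\<^bsub>QP.T\<^esub> W v u' Z"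
    if "v \<in> carrier Q" "u \<in> carrier P" "u' \<in> carrier P" "Z \<in> carrier ?T" for v u u' Z
    using that(4) by (induction Z rule: ext.EE.tensor_induct)
      (use that(1-3) in \<open>simp_all add: E_apply QP.pure_add_right QP.T.a_ac\<close>)
  have W_lsmult: "b \<odot>\<^bsub>QP.T\<^esub> W v u Z = W (b \<odot>\<^bsub>Q\<^esub> v) u Z"
    if "v \<in> carrier Q" "u \<in> carrier P" "b \<in> carrier B" "Z \<in> carrier ?T" for v u b Z
    using that(4) by (induction Z rule: ext.EE.tensor_induct)
      (use that(1-3) in \<open>simp_all add: qact_lsmult\<close>)
  have W_rsmult: "W v u Z \<bullet>\<^bsub>QP.T\<^esub> b = W v (u \<bullet>\<^bsub>P\<^esub> b) Z"
    if "v \<in> carrier Q" "u \<in> carrier P" "b \<in> carrier B" "Z \<in> carrier ?T" for v u b Z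
    using that(4) by (induction Z rule: ext.EE.tensor_induct)
      (use that(1-3) in \<open>simp_all add: E_apply\<close>)
  have W_qact: "W (qact v f) u Z = W v u (f \<odot>\<^bsub>?T\<^esub> Z)"
    if "v \<in> carrier Q" "u \<in> carrier P" "f \<in> carrier E" "Z \<in> carrier ?T" for v u f Z
    using that(4) by (induction Z rule: ext.EE.tensor_induct)
      (use that(1-3) in \<open>simp_all add: qact_mult\<close>)
  have W_apply: "W v (f u) Z = W v u (Z \<bullet>\<^bsub>?T\<^esub> f)"
    if "v \<in> carrier Q" "u \<in> carrier P" "f \<in> carrier E" "Z \<in> carrier ?T" for v u f Z
    using that(4) by (induction Z rule: ext.EE.tensor_induct) (use that(1-3) in simp_all)
  have pairing_map_W: "pairing_map (W v u Z) = pair v (ext.mult Z u)"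
    if "v \<in> carrier Q" "u \<in> carrier P" "Z \<in> carrier ?T" for v u Z
    using that(3) by (induction Z rule: ext.EE.tensor_induct)
      (use that(1-2) in \<open>simp_all add: pair_add_right\<close>)
  have W_left_e: "(\<lambda>v. W v u e) \<in> additive_maps Q QP.T" if "u \<in> carrier P" for u
    by (rule additiveI) (use that e W_add_left in simp_all)
  have W_right_e: "(\<lambda>u. W v u e) \<in> additive_maps P QP.T" if "v \<in> carrier Q" for v
    by (rule additiveI) (use that e W_add_right in simp_all)
  define w where "w = (\<Oplus>\<^bsub>QP.T\<^esub>l\<in>{..<k}. W (v l) (u l) e)"
  have w: "w \<in> carrier QP.T"
    unfolding w_def by (rule QP.T.finsum_closed) (use u v e in auto)
  have pairing_map_w: "pairing_map w = \<one>\<^bsub>B\<^esub>"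
  proof -
    have "pairing_map w = (\<Oplus>\<^bsub>B\<^esub>l\<in>{..<k}. pairing_map (W (v l) (u l) e))"
      unfolding w_def
      by (rule additive_finsum[OF QP.T.abelian_group_axioms P.S.abelian_group_axioms pairing_map_additive])
        (use u v e in simp)
    also have "\<dots> = (\<Oplus>\<^bsub>B\<^esub>l\<in>{..<k}. pair (v l) (u l))"
      by (rule P.S.finsum_eq) (use u v e in \<open>simp_all add: pairing_map_W\<close>)
    finally show ?thesis using unit by simp
  qed
  interpret QPT: bimodule B B QP.T by (rule QP.bimodule_T)
  have central: "b \<odot>\<^bsub>QP.T\<^esub> w = w \<bullet>\<^bsub>QP.T\<^esub> b" if b: "b \<in> carrier B" for b
  proof -
    (* Moving the unit of B across: b v = sum over l of v_l [u_l b, v], and the rank-one map then slides past e. *)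
    have v_exp: "b \<odot>\<^bsub>Q\<^esub> q = (\<Oplus>\<^bsub>Q\<^esub>l\<in>{..<k}. qact (v l) (rank_one (u l \<bullet>\<^bsub>P\<^esub> b) q))" if q: "q \<in> carrier Q" for q
    proof -
      have "(\<Oplus>\<^bsub>Q\<^esub>l\<in>{..<k}. qact (v l) (rank_one (u l \<bullet>\<^bsub>P\<^esub> b) q)) = (\<Oplus>\<^bsub>Q\<^esub>l\<in>{..<k}. pair (v l) (u l) \<odot>\<^bsub>Q\<^esub> (b \<odot>\<^bsub>Q\<^esub> q))"
        by (rule Q.M.finsum_eq) (use b q u v in \<open>simp_all add: qact_rank_one pair_right Q.lsmult_assoc\<close>)
      also have "\<dots> = (\<Oplus>\<^bsub>B\<^esub>l\<in>{..<k}. pair (v l) (u l)) \<odot>\<^bsub>Q\<^esub> (b \<odot>\<^bsub>Q\<^esub> q)"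
        by (rule Q.finsum_lsmult[symmetric]) (use b q u v in simp_all)
      finally show ?thesis using unit b q by (simp add: Q.lsmult_one)
    qed
    have u_exp: "(\<Oplus>\<^bsub>P\<^esub>l\<in>{..<k}. x \<bullet>\<^bsub>P\<^esub> pair (v l) (u l)) = x" if "x \<in> carrier P" for x
      using P.finsum_rsmult[of x "{..<k}" "\<lambda>l. pair (v l) (u l)"] unit that u v by (simp add: P.rsmult_one)
    have "b \<odot>\<^bsub>QP.T\<^esub> w = (\<Oplus>\<^bsub>QP.T\<^esub>h\<in>{..<k}. b \<odot>\<^bsub>QP.T\<^esub> W (v h) (u h) e)"
      unfolding w_def by (rule QPT.lsmult_finsum[OF b]) (use u v e in simp)
    also have "\<dots> = (\<Oplus>\<^bsub>QP.T\<^esub>h\<in>{..<k}. W (\<Oplus>\<^bsub>Q\<^esub>l\<in>{..<k}. qact (v l) (rank_one (u l \<bullet>\<^bsub>P\<^esub> b) (v h))) (u h) e)"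
      by (rule QP.T.finsum_eq) (use b u v e in \<open>simp_all add: W_lsmult v_exp[symmetric]\<close>)
    also have "\<dots> = (\<Oplus>\<^bsub>QP.T\<^esub>h\<in>{..<k}. \<Oplus>\<^bsub>QP.T\<^esub>l\<in>{..<k}. W (qact (v l) (rank_one (u l \<bullet>\<^bsub>P\<^esub> b) (v h))) (u h) e)"
      by (rule QP.T.finsum_eq, rule additive_finsum[OF Q.M.abelian_group_axioms QP.T.abelian_group_axioms W_left_e])
        (use b u v e in \<open>auto intro!: QP.T.finsum_closed\<close>)
    also have "\<dots> = (\<Oplus>\<^bsub>QP.T\<^esub>l\<in>{..<k}. \<Oplus>\<^bsub>QP.T\<^esub>h\<in>{..<k}. W (qact (v l) (rank_one (u l \<bullet>\<^bsub>P\<^esub> b) (v h))) (u h) e)"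
      by (rule QP.T.finsum_swap) (use b u v e in simp_all)
    also have "\<dots> = (\<Oplus>\<^bsub>QP.T\<^esub>l\<in>{..<k}. \<Oplus>\<^bsub>QP.T\<^esub>h\<in>{..<k}. W (v l) (u l \<bullet>\<^bsub>P\<^esub> b \<bullet>\<^bsub>P\<^esub> pair (v h) (u h)) e)"
    proof (intro QP.T.finsum_eq)
      fix l h assume "l \<in> {..<k}" "h \<in> {..<k}"
      then have lh: "l < k" "h < k" by simp_all
      let ?f = "rank_one (u l \<bullet>\<^bsub>P\<^esub> b) (v h)"
      have f: "?f \<in> carrier E" using lh b u v by simp
      have "W (qact (v l) ?f) (u h) e = W (v l) (u h) (?f \<odot>\<^bsub>?T\<^esub> e)"
        using lh f u v e by (simp add: W_qact)
      also have "\<dots> = W (v l) (?f (u h)) e"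
        using lh f u v e by (simp only: e_central W_apply)
      finally show "W (qact (v l) ?f) (u h) e = W (v l) (u l \<bullet>\<^bsub>P\<^esub> b \<bullet>\<^bsub>P\<^esub> pair (v h) (u h)) e"
        using lh u by simp
    qed (use b u v e in \<open>auto intro!: QP.T.finsum_closed\<close>)
    also have "\<dots> = (\<Oplus>\<^bsub>QP.T\<^esub>l\<in>{..<k}. W (v l) (\<Oplus>\<^bsub>P\<^esub>h\<in>{..<k}. u l \<bullet>\<^bsub>P\<^esub> b \<bullet>\<^bsub>P\<^esub> pair (v h) (u h)) e)"
      by (rule QP.T.finsum_eq, rule additive_finsum[OF P.M.abelian_group_axioms QP.T.abelian_group_axioms
            W_right_e, symmetric])
        (use b u v e in \<open>auto intro!: additive_closed[OF W_additive] P.M.finsum_closed\<close>)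
    also have "\<dots> = (\<Oplus>\<^bsub>QP.T\<^esub>l\<in>{..<k}. W (v l) (u l) e \<bullet>\<^bsub>QP.T\<^esub> b)"
      by (rule QP.T.finsum_eq) (use b u v e in \<open>simp_all add: W_rsmult u_exp\<close>)
    also have "\<dots> = w \<bullet>\<^bsub>QP.T\<^esub> b"
      unfolding w_def by (rule QPT.rsmult_finsum[OF b, symmetric]) (use u v e in simp)
    finally show ?thesis .
  qed
  show ?thesis
    unfolding split_epi_regular_iff[OF QP.bimodule_T]
    using pairing_map_hom w pairing_map_w central by blast
qed

text \<open>
  The splitting of \<open>A \<rightarrow> E\<close> is \<open>F(d -)\<close> for some \<open>d\<close>. As it is also left linear, \<open>F(a d -) = F(d a -)\<close>, so
  \<open>d\<close> commutes with \<open>A\<close>; and \<open>F(d) = 1\<close> because the splitting preserves \<open>1\<close>.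
\<close>

theorem frobenius_form_split_epi:
  assumes "frobenius_system A E lam F I X Y" and split: "split_extension A E lam"
  shows "bimodule_split_epi A A PQ.T (regular_bimodule A) (\<lambda>X. F (\<beta> X))"
proof -
  interpret fs: frobenius_system A E lam F I X Y by (rule assms(1))
  have hom: "(\<lambda>X. F (\<beta> X)) \<in> bimodule_hom A A PQ.T (regular_bimodule A)"
  proof (rule bimodule_homI)
    show "(\<lambda>X. F (\<beta> X)) \<in> additive_maps PQ.T (regular_bimodule A)"
      using additive_comp[OF \<beta>_additive fs.F_additive] by simp
  qed (simp_all add: \<beta>_left \<beta>_right fs.F_left fs.F_right)
  from split obtain f where f: "f \<in> bimodule_hom A A (ring_bimodule E lam lam) (regular_bimodule A)"
    and f1: "f \<one>\<^bsub>E\<^esub> = \<one>\<^bsub>A\<^esub>"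
    unfolding split_extension_def by blast
  have f_left: "f (lam a \<otimes>\<^bsub>E\<^esub> x) = a \<otimes>\<^bsub>A\<^esub> f x" if "a \<in> carrier A" "x \<in> carrier E" for a x
    using bimodule_homD(2)[OF f that(1), of x] that by simp
  have "f \<in> right_linear A (ring_bimodule E (\<lambda>x. x) lam :: ('p \<Rightarrow> 'p, 'a, 'p \<Rightarrow> 'p) bimodule) (regular_bimodule A)"
    using bimodule_homD(1,3)[OF f] by (intro right_linearI) simp_all
  then obtain d where d: "d \<in> carrier E" and fd: "\<And>x. x \<in> carrier E \<Longrightarrow> f x = F (d \<otimes>\<^bsub>E\<^esub> x)"
    by (rule fs.F_represents) blast
  have comm: "lam a \<otimes>\<^bsub>E\<^esub> d = d \<otimes>\<^bsub>E\<^esub> lam a" if a: "a \<in> carrier A" for a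
  proof (rule fs.F_nondegenerate)
    fix x assume x: "x \<in> carrier E"
    have "F (lam a \<otimes>\<^bsub>E\<^esub> d \<otimes>\<^bsub>E\<^esub> x) = a \<otimes>\<^bsub>A\<^esub> f x"
      using a d x by (simp add: E.m_assoc fs.F_left fd)
    also have "\<dots> = F (d \<otimes>\<^bsub>E\<^esub> lam a \<otimes>\<^bsub>E\<^esub> x)"
      using a d x f_left[OF a x] fd[of "lam a \<otimes>\<^bsub>E\<^esub> x"] by (simp add: E.m_assoc)
    finally show "F (lam a \<otimes>\<^bsub>E\<^esub> d \<otimes>\<^bsub>E\<^esub> x) = F (d \<otimes>\<^bsub>E\<^esub> lam a \<otimes>\<^bsub>E\<^esub> x)" .
  qed (use a d in simp_all)
  have "F (\<beta> (\<alpha> d)) = \<one>\<^bsub>A\<^esub>" using fd[of "\<one>\<^bsub>E\<^esub>"] f1 d by simp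
  moreover have "a \<odot>\<^bsub>PQ.T\<^esub> \<alpha> d = \<alpha> d \<bullet>\<^bsub>PQ.T\<^esub> a" if "a \<in> carrier A" for a
    using that d comm by (simp add: \<alpha>_left[symmetric] \<alpha>_right[symmetric])
  ultimately show ?thesis
    unfolding split_epi_regular_iff[OF PQ.bimodule_T]
    using hom d by (intro conjI bexI[of _ "\<alpha> d"]) simp_all
qed

text \<open>
  With \<open>\<nu>(p \<otimes> q) = F([p, q])\<close>, \<open>q' = v\<^sub>l X\<^sub>i\<close> and \<open>p' = Y\<^sub>i u\<^sub>l\<close>, summing over \<open>i\<close> with the identities of the
  Frobenius system leaves \<open>\<Sum>\<^sub>l [p, v\<^sub>l] u\<^sub>l = p \<Sum>\<^sub>l v\<^sub>l(u\<^sub>l)\<close> and \<open>\<Sum>\<^sub>l v\<^sub>l [u\<^sub>l, q] = \<Sum>\<^sub>l v\<^sub>l(u\<^sub>l) q\<close>. The two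
  identities so obtained are also dual bases for \<open>\<^sub>AP\<close> and \<open>Q\<^sub>A\<close>, which gives finite generation and
  projectivity over \<open>A\<close>.
\<close>

theorem sym_sep_context_if_endomorphism_extension:
  assumes sep: "separable_extension A E lam" and split: "split_extension A E lam"
    and frob: "frobenius_extension A E lam"
    and u: "\<And>l. l < k \<Longrightarrow> u l \<in> carrier P" and v: "\<And>l. l < k \<Longrightarrow> v l \<in> carrier Q"
    and unit: "(\<Oplus>\<^bsub>B\<^esub>l\<in>{..<k::nat}. pair (v l) (u l)) = \<one>\<^bsub>B\<^esub>"
  shows "\<exists>\<nu> N q' p'. sym_sep_context A B P Q \<nu> pairing_map N q' p' n pj qj"
proof -
  obtain F N X Y where fs: "frobenius_system A E lam F {..<N::nat} X Y"
    by (rule frobenius_extension_system[OF frob]) blast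
  interpret fs: frobenius_system A E lam F "{..<N}" X Y by (rule fs)
  define \<nu> where "\<nu> = (\<lambda>X. F (\<beta> X))"
  have \<nu>_split: "bimodule_split_epi A A PQ.T (regular_bimodule A) \<nu>"
    unfolding \<nu>_def by (rule frobenius_form_split_epi[OF fs split])
  have \<nu>_pure: "\<nu> (PQ.pure p q) = F (rank_one p q)" if "p \<in> carrier P" "q \<in> carrier Q" for p q
    using that by (simp add: \<nu>_def)
  let ?I = "{..<k} \<times> {..<N}"
  define xq where "xq z = qact (v (fst z)) (X (snd z))" for z
  define yp where "yp z = Y (snd z) (u (fst z))" for z
  have XE: "X i \<in> carrier E" and YE: "Y i \<in> carrier E" if "i < N" for i
    using fs.XE fs.YE that by simp_all
  have xq: "xq z \<in> carrier Q" and yp: "yp z \<in> carrier P" if "z \<in> ?I" for z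
    using that by (auto simp: xq_def yp_def u v XE YE E_apply(1)[OF YE])
  have nu_p: "(\<Oplus>\<^bsub>P\<^esub>z\<in>?I. \<nu> (PQ.pure p (xq z)) \<odot>\<^bsub>P\<^esub> yp z) = p" if p: "p \<in> carrier P" for p
  proof -
    let ?g = "\<lambda>l i. lam (F (rank_one p (v l) \<otimes>\<^bsub>E\<^esub> X i)) \<otimes>\<^bsub>E\<^esub> Y i"
    have g: "?g l i \<in> carrier E" if "l < k" "i < N" for l i
      using that p v XE YE by simp
    have "(\<Oplus>\<^bsub>P\<^esub>z\<in>?I. \<nu> (PQ.pure p (xq z)) \<odot>\<^bsub>P\<^esub> yp z) = (\<Oplus>\<^bsub>P\<^esub>z\<in>?I. ?g (fst z) (snd z) (u (fst z)))"
      by (rule P.M.finsum_eq)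
        (use p u v XE YE in \<open>auto simp: xq_def yp_def \<nu>_pure rank_one_mult_E E_apply(1)[OF YE]\<close>)
    also have "\<dots> = (\<Oplus>\<^bsub>P\<^esub>l\<in>{..<k}. \<Oplus>\<^bsub>P\<^esub>i\<in>{..<N}. ?g l i (u l))"
      by (rule P.M.finsum_Times) (use E_apply(1)[OF g u] in \<open>auto simp del: E_mult_apply\<close>)
    also have "\<dots> = (\<Oplus>\<^bsub>P\<^esub>l\<in>{..<k}. p \<bullet>\<^bsub>P\<^esub> pair (v l) (u l))"
    proof (rule P.M.finsum_eq)
      fix l assume "l \<in> {..<k}"
      then have l: "l < k" by simp
      have "(\<Oplus>\<^bsub>P\<^esub>i\<in>{..<N}. ?g l i (u l)) = (\<Oplus>\<^bsub>E\<^esub>i\<in>{..<N}. ?g l i) (u l)"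
        by (rule additive_finsum[OF E.abelian_group_axioms P.M.abelian_group_axioms
              eval_additive[OF u[OF l]], symmetric]) (use g l in simp)
      also have "\<dots> = rank_one p (v l) (u l)" using fs.Y_dual[of "rank_one p (v l)"] p v[OF l] by simp
      finally show "(\<Oplus>\<^bsub>P\<^esub>i\<in>{..<N}. ?g l i (u l)) = p \<bullet>\<^bsub>P\<^esub> pair (v l) (u l)" using u[OF l] by simp
    qed (use p u v in simp)
    also have "\<dots> = p"
      using P.finsum_rsmult[of p "{..<k}" "\<lambda>l. pair (v l) (u l)"] unit p u v by (simp add: P.rsmult_one)
    finally show ?thesis .
  qed
  have nu_q: "(\<Oplus>\<^bsub>Q\<^esub>z\<in>?I. xq z \<bullet>\<^bsub>Q\<^esub> \<nu> (PQ.pure (yp z) q)) = q" if q: "q \<in> carrier Q" for q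
  proof -
    let ?g = "\<lambda>l i. X i \<otimes>\<^bsub>E\<^esub> lam (F (Y i \<otimes>\<^bsub>E\<^esub> rank_one (u l) q))"
    have g: "?g l i \<in> carrier E" if "l < k" "i < N" for l i
      using that q u XE YE by simp
    have "(\<Oplus>\<^bsub>Q\<^esub>z\<in>?I. xq z \<bullet>\<^bsub>Q\<^esub> \<nu> (PQ.pure (yp z) q)) = (\<Oplus>\<^bsub>Q\<^esub>z\<in>?I. qact (v (fst z)) (?g (fst z) (snd z)))"
    proof (rule Q.M.finsum_eq)
      fix z assume "z \<in> ?I"
      then have z: "fst z < k" "snd z < N" by auto
      have "F (Y (snd z) \<otimes>\<^bsub>E\<^esub> rank_one (u (fst z)) q) = F (rank_one (yp z) q)"
        using z q u YE by (simp add: E_mult_rank_one yp_def)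
      then show "xq z \<bullet>\<^bsub>Q\<^esub> \<nu> (PQ.pure (yp z) q) = qact (v (fst z)) (?g (fst z) (snd z))"
        using z q yp[OF \<open>z \<in> ?I\<close>] v XE by (simp add: \<nu>_pure xq_def qact_mult qact_lam)
      show "qact (v (fst z)) (?g (fst z) (snd z)) \<in> carrier Q"
        using z v g by simp
    qed
    also have "\<dots> = (\<Oplus>\<^bsub>Q\<^esub>l\<in>{..<k}. \<Oplus>\<^bsub>Q\<^esub>i\<in>{..<N}. qact (v l) (?g l i))"
      by (rule Q.M.finsum_Times) (use g v in auto)
    also have "\<dots> = (\<Oplus>\<^bsub>Q\<^esub>l\<in>{..<k}. pair (v l) (u l) \<odot>\<^bsub>Q\<^esub> q)"
    proof (rule Q.M.finsum_eq)
      fix l assume "l \<in> {..<k}"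
      then have l: "l < k" by simp
      have "(\<Oplus>\<^bsub>Q\<^esub>i\<in>{..<N}. qact (v l) (?g l i)) = qact (v l) (\<Oplus>\<^bsub>E\<^esub>i\<in>{..<N}. ?g l i)"
        by (rule additive_finsum[OF E.abelian_group_axioms Q.M.abelian_group_axioms, symmetric])
          (use g l v in \<open>auto intro!: additiveI simp: qact_add_right\<close>)
      also have "\<dots> = qact (v l) (rank_one (u l) q)" using fs.X_dual[of "rank_one (u l) q"] q u[OF l] by simp
      finally show "(\<Oplus>\<^bsub>Q\<^esub>i\<in>{..<N}. qact (v l) (?g l i)) = pair (v l) (u l) \<odot>\<^bsub>Q\<^esub> q"
        using u[OF l] v[OF l] q by (simp add: qact_rank_one)
    qed (use q u v in simp)
    also have "\<dots> = q"
      using Q.finsum_lsmult[of q "{..<k}" "\<lambda>l. pair (v l) (u l)"] unit q u v by (simp add: Q.lsmult_one)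
    finally show ?thesis .
  qed
  have \<nu>_closed: "\<nu> (PQ.pure p q) \<in> carrier A" if "p \<in> carrier P" "q \<in> carrier Q" for p q
    using that by (simp add: \<nu>_pure)
  have P_left: "fg_projective_left A P"
  proof (rule fg_projective_leftI[OF P.bimodule_axioms, of ?I yp "\<lambda>z p. \<nu> (PQ.pure p (xq z))"])
    show "(\<lambda>p. \<nu> (PQ.pure p (xq z))) \<in> left_linear A P (regular_bimodule A)" if "z \<in> ?I" for z
      using xq[OF that]
      by (intro left_linearI additiveI)
        (simp_all add: \<nu>_pure rank_one_add_left additive_add[OF fs.F_additive] lam_mult_rank_one[symmetric] fs.F_left)
  qed (use yp nu_p in simp_all)
  have Q_right: "fg_projective_right A Q"
  proof (rule fg_projective_rightI[OF Q.bimodule_axioms, of ?I xq "\<lambda>z q. \<nu> (PQ.pure (yp z) q)"])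
    show "(\<lambda>q. \<nu> (PQ.pure (yp z) q)) \<in> right_linear A Q (regular_bimodule A)" if "z \<in> ?I" for z
      using yp[OF that]
      by (intro right_linearI additiveI)
        (simp_all add: \<nu>_pure rank_one_add_right additive_add[OF fs.F_additive] rank_one_mult_lam[symmetric] fs.F_right)
  qed (use xq nu_q in simp_all)
  (* A context indexes its families by an initial segment of the natural numbers. *)
  obtain h where h: "bij_betw h {..<card ?I} ?I"
    using ex_bij_betw_nat_finite[of ?I] by (auto simp: atLeast0LessThan)
  then have hI: "h i \<in> ?I" if "i < card ?I" for i
    using that unfolding bij_betw_def by blast
  have inj: "inj_on h {..<card ?I}" and img: "h ` {..<card ?I} = ?I"
    using h unfolding bij_betw_def by blast+
  have nu_p': "(\<Oplus>\<^bsub>P\<^esub>i\<in>{..<card ?I}. \<nu> (PQ.pure p (xq (h i))) \<odot>\<^bsub>P\<^esub> yp (h i)) = p" if p: "p \<in> carrier P" for p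
    using P.M.finsum_reindex[of "\<lambda>z. \<nu> (PQ.pure p (xq z)) \<odot>\<^bsub>P\<^esub> yp z" h "{..<card ?I}"] inj nu_p[OF p] p
    unfolding img by (auto simp: xq yp \<nu>_closed)
  have nu_q': "(\<Oplus>\<^bsub>Q\<^esub>i\<in>{..<card ?I}. xq (h i) \<bullet>\<^bsub>Q\<^esub> \<nu> (PQ.pure (yp (h i)) q)) = q" if q: "q \<in> carrier Q" for q
    using Q.M.finsum_reindex[of "\<lambda>z. xq z \<bullet>\<^bsub>Q\<^esub> \<nu> (PQ.pure (yp z) q)" h "{..<card ?I}"] inj nu_q[OF q] q
    unfolding img by (auto simp: xq yp \<nu>_closed)
  have mu_q: "(\<Oplus>\<^bsub>Q\<^esub>j\<in>{..<n}. pairing_map (QP.pure q (pj j)) \<odot>\<^bsub>Q\<^esub> qj j) = q" if q: "q \<in> carrier Q" for q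
  proof -
    have "(\<Oplus>\<^bsub>Q\<^esub>j\<in>{..<n}. pairing_map (QP.pure q (pj j)) \<odot>\<^bsub>Q\<^esub> qj j) = (\<Oplus>\<^bsub>Q\<^esub>j\<in>{..<n}. pair q (pj j) \<odot>\<^bsub>Q\<^esub> qj j)"
      by (rule Q.M.finsum_eq) (use q in \<open>simp_all add: pj qj\<close>)
    then show ?thesis using dual_q[OF q] by simp
  qed
  have mu_p: "(\<Oplus>\<^bsub>P\<^esub>j\<in>{..<n}. pj j \<bullet>\<^bsub>P\<^esub> pairing_map (QP.pure (qj j) p)) = p" if p: "p \<in> carrier P" for p
  proof -
    have "(\<Oplus>\<^bsub>P\<^esub>j\<in>{..<n}. pj j \<bullet>\<^bsub>P\<^esub> pairing_map (QP.pure (qj j) p)) = (\<Oplus>\<^bsub>P\<^esub>j\<in>{..<n}. pj j \<bullet>\<^bsub>P\<^esub> pair (qj j) p)"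
      by (rule P.M.finsum_eq) (use p in \<open>simp_all add: pj qj\<close>)
    then show ?thesis using dual_p[OF p] by simp
  qed
  have "sym_sep_context A B P Q \<nu> pairing_map (card ?I) (\<lambda>i. xq (h i)) (\<lambda>i. yp (h i)) n pj qj"
    by (intro sym_sep_context.intro sym_sep_context_axioms.intro P.bimodule_axioms Q.bimodule_axioms
        P_left P_fgp_right Q_fgp_left Q_right \<nu>_split pairing_map_split_epi[OF sep u v unit]
        xq[OF hI] yp[OF hI] pj qj nu_p' nu_q' mu_q mu_p)
  then show ?thesis by blast
qed

end

lemma hom_dual_pair:
  fixes P :: "('a, 'b, 'p) bimodule"
  assumes P: "bimodule A B P" and fgp: "fg_projective_right B P"
  obtains n pj qj where "dual_pair A B P (Hom_right B P (regular_bimodule B)) (\<lambda>q p. q p) n pj qj"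
proof -
  let ?B = "regular_bimodule B" and ?Q = "Hom_right B P (regular_bimodule B)"
  interpret P: bimodule A B P by (rule P)
  interpret RB: bimodule B B ?B by (rule regular_bimodule_bimodule[OF P.S.ring_axioms])
  interpret Q: bimodule B A ?Q
    by (rule Hom_right_bimodule[OF P RB.bimodule_axioms])
  obtain n :: nat and x f where x: "\<And>i. i < n \<Longrightarrow> x i \<in> carrier P"
    and f: "\<And>i. i < n \<Longrightarrow> f i \<in> right_linear B P ?B"
    and dual: "\<And>y. y \<in> carrier P \<Longrightarrow> (\<Oplus>\<^bsub>P\<^esub>i\<in>{..<n}. x i \<bullet>\<^bsub>P\<^esub> f i y) = y"
    by (rule fg_projective_right_dual_basis[OF P fgp]) blast
  define g where "g i = (\<lambda>y\<in>carrier P. f i y)" for i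
  have g: "g i \<in> carrier ?Q" if "i < n" for i
    using restrict_right_linear[OF P f[OF that]] by (simp add: g_def Hom_right_simps(1))
  have q_closed: "q y \<in> carrier B" if "q \<in> carrier ?Q" "y \<in> carrier P" for q y
    using right_linearD(3)[of q B P ?B y] that by (simp add: Hom_right_simps(1))
  have q_right: "q (y \<bullet>\<^bsub>P\<^esub> b) = q y \<otimes>\<^bsub>B\<^esub> b" if "q \<in> carrier ?Q" "y \<in> carrier P" "b \<in> carrier B" for q y b
    using right_linearD(2)[of q B P ?B b y] that by (simp add: Hom_right_simps(1))
  have q_additive: "q \<in> additive_maps P B" if "q \<in> carrier ?Q" for q
    using right_linearD(1)[of q B P ?B] that by (simp add: Hom_right_simps(1))
  have eval: "(\<lambda>q. q y) \<in> additive_maps ?Q B" if "y \<in> carrier P" for y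
    by (rule additiveI) (use that q_closed in simp_all)
  have "dual_pair A B P ?Q (\<lambda>q p. q p) n x g"
  proof (intro dual_pair.intro dual_pair_axioms.intro P Q.bimodule_axioms)
    show "(\<lambda>q p. q p) \<in> balanced_maps A ?Q P B"
      by (rule balancedI) (simp_all add: q_closed additive_add[OF q_additive])
    show "(\<Oplus>\<^bsub>P\<^esub>j\<in>{..<n}. x j \<bullet>\<^bsub>P\<^esub> g j p) = p" if "p \<in> carrier P" for p
      using dual[OF that] that by (simp add: g_def)
    show "(\<Oplus>\<^bsub>?Q\<^esub>j\<in>{..<n}. q (x j) \<odot>\<^bsub>?Q\<^esub> g j) = q" if q: "q \<in> carrier ?Q" for q
    proof (rule extensionalityI[of _ "carrier P"])
      have t: "q (x j) \<odot>\<^bsub>?Q\<^esub> g j \<in> carrier ?Q" if "j < n" for j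
        using Q.lsmult_closed[OF q_closed[OF q x[OF that]] g[OF that]] .
      have "(\<Oplus>\<^bsub>?Q\<^esub>j\<in>{..<n}. q (x j) \<odot>\<^bsub>?Q\<^esub> g j) \<in> carrier ?Q"
        by (rule Q.M.finsum_closed) (use t in auto)
      then show "(\<Oplus>\<^bsub>?Q\<^esub>j\<in>{..<n}. q (x j) \<odot>\<^bsub>?Q\<^esub> g j) \<in> extensional (carrier P)"
        by (simp only: Hom_right_simps(1) Int_iff)
      show "q \<in> extensional (carrier P)" using q by (simp only: Hom_right_simps(1) Int_iff)
      fix y assume y: "y \<in> carrier P"
      have "(\<Oplus>\<^bsub>?Q\<^esub>j\<in>{..<n}. q (x j) \<odot>\<^bsub>?Q\<^esub> g j) y = (\<Oplus>\<^bsub>B\<^esub>j\<in>{..<n}. (q (x j) \<odot>\<^bsub>?Q\<^esub> g j) y)"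
        by (rule additive_finsum[OF Q.M.abelian_group_axioms P.S.abelian_group_axioms eval[OF y]])
          (use t in simp)
      also have "\<dots> = (\<Oplus>\<^bsub>B\<^esub>j\<in>{..<n}. q (x j \<bullet>\<^bsub>P\<^esub> g j y))"
        by (rule P.S.finsum_eq)
          (use y q_right[OF q] x q_closed[OF g] q_closed[OF q] in \<open>simp_all add: P.rsmult_closed\<close>)
      also have "\<dots> = q (\<Oplus>\<^bsub>P\<^esub>j\<in>{..<n}. x j \<bullet>\<^bsub>P\<^esub> g j y)"
        by (rule additive_finsum[OF P.M.abelian_group_axioms P.S.abelian_group_axioms q_additive[OF q], symmetric])
          (use y x q_closed[OF g] in \<open>simp add: P.rsmult_closed\<close>)
      also have "(\<Oplus>\<^bsub>P\<^esub>j\<in>{..<n}. x j \<bullet>\<^bsub>P\<^esub> g j y) = y"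
        using dual[OF y] y by (simp add: g_def)
      finally show "(\<Oplus>\<^bsub>?Q\<^esub>j\<in>{..<n}. q (x j) \<odot>\<^bsub>?Q\<^esub> g j) y = q y" .
    qed
  qed (simp_all add: x g q_right)
  then show thesis by (rule that)
qed

theorem sym_sep_equivalent_if_endomorphism_extension:
  fixes P :: "('a, 'b, 'r) bimodule"
  assumes P: "bimodule A B P" and prog: "progenerator_right B P"
    and cond: "endomorphism_extension_condition A B P"
  shows "sym_sep_equivalent TYPE('r) TYPE('r \<Rightarrow> 'b) A B"
proof -
  have fgp: "fg_projective_right B P" and gen: "generator_right B P"
    using prog by (simp_all add: progenerator_right_def)
  obtain n pj qj where dp: "dual_pair A B P (Hom_right B P (regular_bimodule B)) (\<lambda>q p. q p) n pj qj"
    by (rule hom_dual_pair[OF P fgp])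
  interpret dual_pair A B P "Hom_right B P (regular_bimodule B)" "\<lambda>q p. q p" n pj qj by (rule dp)
  obtain k :: nat and u v where u: "\<And>i. i < k \<Longrightarrow> u i \<in> carrier P"
    and v: "\<And>i. i < k \<Longrightarrow> v i \<in> right_linear B P (regular_bimodule B)"
    and unit: "(\<Oplus>\<^bsub>B\<^esub>i\<in>{..<k}. v i (u i)) = \<one>\<^bsub>B\<^esub>"
    by (rule generator_right_unit[OF P gen]) blast
  define w where "w i = (\<lambda>x\<in>carrier P. v i x)" for i
  have w: "w i \<in> carrier (Hom_right B P (regular_bimodule B))" if "i < k" for i
    using restrict_right_linear[OF P v[OF that]] by (simp add: w_def Hom_right_simps(1))
  have "(\<Oplus>\<^bsub>B\<^esub>i\<in>{..<k}. w i (u i)) = (\<Oplus>\<^bsub>B\<^esub>i\<in>{..<k}. v i (u i))"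
    by (rule P.S.finsum_eq) (use u right_linearD(3)[OF v u] in \<open>simp_all add: w_def\<close>)
  then have unit': "(\<Oplus>\<^bsub>B\<^esub>i\<in>{..<k}. w i (u i)) = \<one>\<^bsub>B\<^esub>" using unit by simp
  have "\<exists>\<nu> N q' p'. sym_sep_context A B P (Hom_right B P (regular_bimodule B)) \<nu> pairing_map N q' p' n pj qj"
    by (rule sym_sep_context_if_endomorphism_extension[OF _ _ _ u w unit'])
      (use cond in \<open>simp_all add: endomorphism_extension_condition_def\<close>)
  then show ?thesis unfolding sym_sep_equivalent_def by blast
qed

theorem theorem4p1:
  fixes A :: "'a ring" and B :: "'b ring"
  assumes "ring A" and "ring B"
  shows "(\<forall>(P :: ('a, 'b, 'p) bimodule) (Q :: ('b, 'a, 'q) bimodule) \<nu> \<mu> m q' p' n pj qj.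
            sym_sep_context A B P Q \<nu> \<mu> m q' p' n pj qj \<longrightarrow>
              frobenius_bimodule A B P \<and>
              P_separable A B P \<and>
              (let PQ = mu_ring A B P Q \<mu>
                          (\<Oplus>\<^bsub>tensor_group B P Q\<^esub>j\<in>{..<n}. pure_tensor B P Q (pj j) (qj j))
               in ring PQ \<and> End_right B P \<simeq> PQ) \<and>
              endomorphism_extension_condition A B P)
       \<and> (\<forall>P :: ('a, 'b, 'r) bimodule.
            bimodule A B P \<and> progenerator_right B P \<and> fg_projective_left A P \<and>
            endomorphism_extension_condition A B P \<longrightarrow>
              sym_sep_equivalent TYPE('r) TYPE('r \<Rightarrow> 'b) A B)"
proof (intro conjI allI impI)
  fix P :: "('a, 'b, 'p) bimodule" and Q :: "('b, 'a, 'q) bimodule" and \<nu> \<mu> m q' p' n pj qj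
  assume "sym_sep_context A B P Q \<nu> \<mu> m q' p' n pj qj"
  then interpret sym_sep_context A B P Q \<nu> \<mu> m q' p' n pj qj .
  show "frobenius_bimodule A B P" by (rule P_frobenius)
  show "P_separable A B P" by (rule A_P_separable)
  show "endomorphism_extension_condition A B P" by (rule endomorphism_extension)
  show "let PQ = mu_ring A B P Q \<mu>
          (\<Oplus>\<^bsub>tensor_group B P Q\<^esub>j\<in>{..<n}. pure_tensor B P Q (pj j) (qj j))
        in ring PQ \<and> End_right B P \<simeq> PQ"
    using End_iso_mu_ring[OF refl] unfolding Let_def is_ring_iso_def by blast
next
  fix P :: "('a, 'b, 'r) bimodule"
  assume "bimodule A B P \<and> progenerator_right B P \<and> fg_projective_left A P \<and>
    endomorphism_extension_condition A B P"
  then show "sym_sep_equivalent TYPE('r) TYPE('r \<Rightarrow> 'b) A B"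
    by (blast intro: sym_sep_equivalent_if_endomorphism_extension)
qed

end
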